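(* Let $0<k<n$, suppose $W_k(c)$ has dimension two, and let $\lambda\in\mathbb{C}$. The following statements are equivalent. (1) $\lambda$ is a singular point on the boundary of $W_k(c)$. (2) $W_k(c)$ has a corner at $\lambda$. (3) There is a face $F$ of $B$ that contains the point $(k/n,k\lambda/n)$ and has the following properties: (a) $F$ is a sharp face of $B$ of dimension at most one. (b) $F=\Psi([z^-,z^+])$, where $z^-$ and $z^+$ are central projections. (c) The points $\Psi(z^-)$ and $\Psi(z^+)$ are isolated extreme points of $B$. (d) There are faces $F_1$ and $F_2$ of $B$ of dimension two such that $F_1\cap F_2=F$, and if $(t,\gamma)\in F$, then $F_i\cap I_t$ is a line segment for each $i$. In particular, if $L_1$ and $L_2$ denote the sectorial tangent lines of support to $W_k(c)$ at $\lambda$, then their images $\pi_k(L_i)$ intersect the relative interiors of the $F_i$'s. (4) $\lambda$ is an isolated extreme point of $W_k(c)$.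
   Context: Let $c$ be a linear operator on an $n$-dimensional complex Hilbert space $H$ and $\tau$ the normalized trace on the algebra $B(H)$ of all linear operators on $H$ (so $\tau(1)=1$). Let $N$ be the subalgebra of $B(H)$ generated by $c$, $c^*$ and $1$; a central projection is a projection lying in the center of $N$. Define $\Psi(a)=(\tau(a),\tau(ca))\in\mathbb{R}\times\mathbb{C}$ for $a\in B(H)$ self-adjoint. The spectral scale of $c$ is the compact convex set $B=\{\Psi(a): a\in B(H),\ 0\le a\le 1\}$. For $0\le t\le1$ the isotrace slice is $I_t=\{(x_0,z)\in B: x_0=t\}$. For $0\le a^-\le a^+$, $[a^-,a^+]=\{a\in B(H): a^-\le a\le a^+\}$. The $k$-numerical range of $c$ is the compact convex set $W_k(c)=\left\{\frac1k\sum_{i=1}^k\langle c\mathbf{x}_i,\mathbf{x}_i\rangle:\ \mathbf{x}_1,\dots,\mathbf{x}_k\in H \text{ orthonormal}\right\}\subset\mathbb{C}$. The map $\pi_k:\mathbb{C}\to\mathbb{R}\times\mathbb{C}$, $\pi_k(z)=(k/n,kz/n)$, is affine and maps $W_k(c)$ bijectively onto $I_{k/n}$. A point on the boundary of a convex subset of $\mathbb{R}^2$ is singular if the boundary curve is not differentiable there. A two-dimensional compact convex subset of the plane has a corner at a boundary point if there is more than one tangent line of support through that point. At a corner, the tangent lines of support through the point all lie in a sector; the two tangent lines of support that bound this sector are called the sectorial tangent lines of support. A face of $B$ is a nonempty convex subset $F\subseteq B$ such that any line segment in $B$ whose relative interior meets $F$ is contained in $F$. A face of $B$ is sharp if it is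 contained in at least two distinct hyperplanes of support of $B$ in $\mathbb{R}\times\mathbb{C}\cong\mathbb{R}^3$. An isolated extreme point of a convex set $X$ is an extreme point of $X$ that is isolated in the set of all extreme points of $X$.
   Formalization: In (3)(d) the line segment F_i∩I_t may shrink to a single point when (t,γ) is an endpoint of F other than (k/n, kλ/n); with nondegenerate segments there the claim fails, e.g. for c=diag(1,1,i,0), k=1, λ=1. *)

theory Defs
  imports "HOL-Analysis.Analysis"
begin

text \<open>
  The \<open>n\<close>-dimensional Hilbert space is \<open>complex ^ 'n\<close> with \<open>n = CARD('n)\<close>; linear operators on it
  are square matrices acting by \<^term>\<open>(*v)\<close>.  The inner product of the library on \<open>complex ^ 'n\<close> is
  real valued (the real part of the one below).
\<close>

definition cinner :: "complex ^ 'n \<Rightarrow> complex ^ 'n \<Rightarrow> complex" where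
  "cinner x y = (\<Sum>i\<in>UNIV. x $ i * cnj (y $ i))"

definition mat_adj :: "complex ^ 'n ^ 'n \<Rightarrow> complex ^ 'n ^ 'n" where
  "mat_adj a = (\<chi> i j. cnj (a $ j $ i))"

definition self_adjoint :: "complex ^ 'n ^ 'n \<Rightarrow> bool" where
  "self_adjoint a \<longleftrightarrow> mat_adj a = a"

definition positive_op :: "complex ^ 'n ^ 'n \<Rightarrow> bool" where
  "positive_op a \<longleftrightarrow> self_adjoint a \<and> (\<forall>x. 0 \<le> Re (cinner (a *v x) x))"

definition op_le :: "complex ^ 'n ^ 'n \<Rightarrow> complex ^ 'n ^ 'n \<Rightarrow> bool" where
  "op_le a b \<longleftrightarrow> positive_op (b - a)"

definition op_interval :: "complex ^ 'n ^ 'n \<Rightarrow> complex ^ 'n ^ 'n \<Rightarrow> (complex ^ 'n ^ 'n) set" where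
  "op_interval l u = {a. op_le l a \<and> op_le a u}"

definition norm_trace :: "complex ^ 'n ^ 'n \<Rightarrow> complex" where
  "norm_trace a = trace a / of_nat CARD('n)"

text \<open>\<^term>\<open>mat r ** a\<close> is the scalar multiple of \<open>a\<close> by the complex number \<open>r\<close>.\<close>

definition unital_subalgebra :: "(complex ^ 'n ^ 'n) set \<Rightarrow> bool" where
  "unital_subalgebra S \<longleftrightarrow> mat 1 \<in> S \<and>
     (\<forall>a\<in>S. \<forall>b\<in>S. a + b \<in> S \<and> a ** b \<in> S) \<and> (\<forall>r. \<forall>a\<in>S. mat r ** a \<in> S)"

definition generated_algebra :: "complex ^ 'n ^ 'n \<Rightarrow> (complex ^ 'n ^ 'n) set" where
  "generated_algebra c = unital_subalgebra hull {c, mat_adj c, mat 1}"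

definition central_projection :: "complex ^ 'n ^ 'n \<Rightarrow> complex ^ 'n ^ 'n \<Rightarrow> bool" where
  "central_projection c z \<longleftrightarrow> self_adjoint z \<and> z ** z = z \<and>
     z \<in> generated_algebra c \<and> (\<forall>a\<in>generated_algebra c. z ** a = a ** z)"

text \<open>
  \<open>Psi\<close> is only applied to self-adjoint \<open>a\<close>, whose trace is real, so that taking the real part
  merely changes the type.
\<close>

definition Psi :: "complex ^ 'n ^ 'n \<Rightarrow> complex ^ 'n ^ 'n \<Rightarrow> real \<times> complex" where
  "Psi c a = (Re (norm_trace a), norm_trace (c ** a))"

definition spectral_scale :: "complex ^ 'n ^ 'n \<Rightarrow> (real \<times> complex) set" where
  "spectral_scale c = Psi c ` op_interval 0 (mat 1)"

definition isotrace_slice :: "complex ^ 'n ^ 'n \<Rightarrow> real \<Rightarrow> (real \<times> complex) set" where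
  "isotrace_slice c t = {p \<in> spectral_scale c. fst p = t}"

definition k_numerical_range :: "nat \<Rightarrow> complex ^ 'n ^ 'n \<Rightarrow> complex set" where
  "k_numerical_range k c =
     {(\<Sum>i=1..k. cinner (c *v x i) (x i)) / of_nat k | x :: nat \<Rightarrow> complex ^ 'n.
        \<forall>i\<in>{1..k}. \<forall>j\<in>{1..k}. cinner (x i) (x j) = (if i = j then 1 else 0)}"

definition slice_map :: "nat \<Rightarrow> nat \<Rightarrow> complex \<Rightarrow> real \<times> complex" where
  "slice_map n k z = (real k / real n, of_nat k * z / of_nat n)"

text \<open>
  Hyperplanes of support; in the plane \<^typ>\<open>complex\<close> these are the tangent lines of support.
\<close>

definition supporting_hyperplane :: "'a::euclidean_space set \<Rightarrow> 'a set \<Rightarrow> bool" where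
  "supporting_hyperplane X P \<longleftrightarrow>
     (\<exists>a b. a \<noteq> 0 \<and> P = {x. a \<bullet> x = b} \<and> X \<subseteq> {x. a \<bullet> x \<le> b} \<and> X \<inter> P \<noteq> {})"

definition sharp_face :: "'a::euclidean_space set \<Rightarrow> 'a set \<Rightarrow> bool" where
  "sharp_face X F \<longleftrightarrow> F face_of X \<and> F \<noteq> {} \<and>
     (\<exists>P Q. P \<noteq> Q \<and> supporting_hyperplane X P \<and> supporting_hyperplane X Q \<and> F \<subseteq> P \<and> F \<subseteq> Q)"

definition isolated_extreme_point :: "'a::euclidean_space set \<Rightarrow> 'a \<Rightarrow> bool" where
  "isolated_extreme_point X p \<longleftrightarrow> p isolated_in {x. x extreme_point_of X}"

text \<open>
  The boundary curve of a plane convex set is differentiable at \<open>p\<close> if near \<open>p\<close> it has a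
  homeomorphic parametrization that is differentiable with nonzero velocity at \<open>p\<close>.  (With zero
  velocity allowed, every boundary point would qualify.)
\<close>

definition boundary_differentiable_at :: "complex set \<Rightarrow> complex \<Rightarrow> bool" where
  "boundary_differentiable_at W p \<longleftrightarrow>
     (\<exists>U (\<gamma> :: real \<Rightarrow> complex) \<delta> v. open U \<and>
        homeomorphism {-1<..<1} (frontier W \<inter> U) \<gamma> \<delta> \<and> \<gamma> 0 = p \<and>
        v \<noteq> 0 \<and> (\<gamma> has_vector_derivative v) (at 0))"

definition singular_boundary_point :: "complex set \<Rightarrow> complex \<Rightarrow> bool" where
  "singular_boundary_point W p \<longleftrightarrow> p \<in> frontier W \<and> \<not> boundary_differentiable_at W p"

definition tangent_line_of_support :: "complex set \<Rightarrow> complex \<Rightarrow> complex set \<Rightarrow> bool" where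
  "tangent_line_of_support W p L \<longleftrightarrow> supporting_hyperplane W L \<and> p \<in> L"

definition has_corner_at :: "complex set \<Rightarrow> complex \<Rightarrow> bool" where
  "has_corner_at W p \<longleftrightarrow> p \<in> frontier W \<and>
     (\<exists>L M. L \<noteq> M \<and> tangent_line_of_support W p L \<and> tangent_line_of_support W p M)"

text \<open>
  \<open>L1\<close> and \<open>L2\<close> have outer normals \<open>a1\<close> and \<open>a2\<close>; they cut the plane into two double sectors with
  apex \<open>p\<close>.  The one containing \<open>W\<close> is where the two linear forms have the same sign, and the
  other one, given by the inequality below, has to contain every line of support through \<open>p\<close>.
\<close>

definition sectorial_tangent_lines ::
  "complex set \<Rightarrow> complex \<Rightarrow> complex set \<Rightarrow> complex set \<Rightarrow> bool" where
  "sectorial_tangent_lines W p L1 L2 \<longleftrightarrow> p \<in> frontier W \<and> L1 \<noteq> L2 \<and>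
     tangent_line_of_support W p L1 \<and> tangent_line_of_support W p L2 \<and>
     (\<exists>a1 a2. a1 \<noteq> 0 \<and> a2 \<noteq> 0 \<and>
        L1 = {z. a1 \<bullet> (z - p) = 0} \<and> W \<subseteq> {z. a1 \<bullet> (z - p) \<le> 0} \<and>
        L2 = {z. a2 \<bullet> (z - p) = 0} \<and> W \<subseteq> {z. a2 \<bullet> (z - p) \<le> 0} \<and>
        (\<forall>L. tangent_line_of_support W p L \<longrightarrow>
             L \<subseteq> {z. (a1 \<bullet> (z - p)) * (a2 \<bullet> (z - p)) \<le> 0}))"

end

theory Submission
  imports Defs
begin

text \<open>
  The spectral scale \<open>B\<close> is the image of the effects \<open>0 \<le> a \<le> 1\<close> under a real linear map, so a
  linear functional on \<open>B\<close> is maximal at the image of \<open>a\<close> exactly if \<open>Re (trace (h ** a))\<close> is maximal for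
  a certain self-adjoint \<open>h\<close> (\<open>support_op\<close>).  By the spectral theorem the maximizing effects form
  an order interval between two spectral projections of \<open>h\<close>, and they all commute with \<open>h\<close>
  (\<open>support_projections\<close>, \<open>support_pair_maximizers\<close>, \<open>support_pair_commute\<close>).

  The slice of \<open>B\<close> at height \<open>k/n\<close> is a copy of \<open>W\<^sub>k(c)\<close>: an extreme effect with prescribed integral
  trace and prescribed \<open>trace (c ** a)\<close> is a projection (\<open>k_numerical_range_iff\<close>).  Hence \<open>W\<^sub>k(c)\<close> is compact
  and convex, and its lines of support extend to planes of support of \<open>B\<close>
  (\<open>extend_line_of_support\<close>).

  Two different lines of support at a corner of \<open>W\<^sub>k(c)\<close> therefore give self-adjoint \<open>h\<^sub>1\<close> and \<open>h\<^sub>2\<close>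
  that are maximized by a common effect.  The effects that maximize both are those that maximize
  \<open>h\<^sub>1 + h\<^sub>2\<close>, so they form an interval \<open>[z\<^sup>-, z\<^sup>+]\<close> of operators commuting with \<open>h\<^sub>1\<close> and \<open>h\<^sub>2\<close>, thus with
  \<open>c\<close> and its adjoint; in particular \<open>z\<^sup>-\<close> and \<open>z\<^sup>+\<close> are central.  Compressing an effect to the three
  central pieces \<open>z\<^sup>-\<close>, \<open>z\<^sup>+ - z\<^sup>-\<close> and \<open>1 - z\<^sup>+\<close>, and averaging it on the middle one, does not move its image.
  After this reduction an effect whose image is close to a point \<open>y\<close> over \<open>[z\<^sup>-, z\<^sup>+]\<close> has room to be
  pushed twice as far from \<open>y\<close>: near \<open>y\<close> the set \<open>B\<close> looks like a cone with apex \<open>y\<close>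
  (\<open>spectral_scale_corner_face\<close>).  Extreme points cannot accumulate at the apex of a cone, which
  shows that corners of \<open>W\<^sub>k(c)\<close> are isolated extreme points and that \<open>z\<^sup>-\<close> and \<open>z\<^sup>+\<close> give isolated
  extreme points of \<open>B\<close>.

  Conversely, if \<open>l\<close> is an isolated extreme point of a plane convex body, the body is the convex hull of
  \<open>l\<close> and a compact convex set that misses \<open>l\<close>, and the extremal slopes seen from \<open>l\<close> are attained: there
  are two edges at \<open>l\<close> (\<open>isolated_extreme_point_edges\<close>).  Each edge of \<open>W\<^sub>k(c)\<close> spreads to a two-dimensional
  face of \<open>B\<close>, and these two faces meet in the image of \<open>[z\<^sup>-, z\<^sup>+]\<close> (\<open>isolated_imp_faces\<close>).  In the other
  direction two such faces cut the slice in two edges; were they collinear they would coincide, and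
  their intersection would consist of points of equal trace, which forces \<open>z\<^sup>- = z\<^sup>+\<close> and
  contradicts the length of the edge (\<open>faces_imp_corner\<close>).

  Finally, a regular boundary curve through a corner would have a velocity orthogonal to two independent
  normals, and away from corners the boundary is locally the graph of a convex function with
  derivative \<open>0\<close> over its only tangent line (\<open>singular_iff_corner\<close>).
\<close>

section \<open>Matrices, adjoints and the complex inner product\<close>

lemma matrix_sub_ldistrib: "A ** (B - C) = A ** B - A ** C"
  for A :: "'a::comm_ring_1 ^ 'n ^ 'm"
  by (vector matrix_matrix_mult_def sum_subtractf[symmetric] algebra_simps)

lemma matrix_sub_rdistrib: "(B - C) ** A = B ** A - C ** A"
  for A :: "'a::comm_ring_1 ^ 'n ^ 'm"
  by (vector matrix_matrix_mult_def sum_subtractf[symmetric] algebra_simps)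

lemma matrix_add_rdistrib: "(B + C) ** A = B ** A + C ** A"
  for A :: "'a::comm_ring_1 ^ 'n ^ 'm"
  by (vector matrix_matrix_mult_def sum.distrib[symmetric] algebra_simps)

lemma matrix_mult_zero [simp]: "A ** 0 = 0" "0 ** A = 0"
  for A :: "'a::comm_ring_1 ^ 'n ^ 'm"
  by (vector matrix_matrix_mult_def)+

lemma matrix_mult_sum_left: "(\<Sum>i\<in>S. f i) ** A = (\<Sum>i\<in>S. f i ** A)"
  for A :: "'a::comm_ring_1 ^ 'n ^ 'm"
  by (induct S rule: infinite_finite_induct) (auto simp: matrix_add_rdistrib)

lemma matrix_mult_sum_right: "A ** (\<Sum>i\<in>S. f i) = (\<Sum>i\<in>S. A ** f i)"
  for A :: "'a::comm_ring_1 ^ 'n ^ 'm"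
  by (induct S rule: infinite_finite_induct) (auto simp: matrix_add_ldistrib)

lemmas matrix_distribs = matrix_add_ldistrib matrix_add_rdistrib matrix_sub_ldistrib matrix_sub_rdistrib

lemma mat_mult_nth [simp]: "(mat r ** A) $ i $ j = r * A $ i $ j"
  for A :: "'a::comm_ring_1 ^ 'n ^ 'm"
  by (simp add: matrix_matrix_mult_def mat_def if_distrib [of "\<lambda>x. x * _"] cong: if_cong)

lemma mat_mult_nth_right: "(A ** mat r) $ i $ j = r * A $ i $ j"
  for A :: "'a::comm_ring_1 ^ 'n ^ 'm"
  by (simp add: matrix_matrix_mult_def mat_def if_distrib [of "\<lambda>x. _ * x"] mult.commute cong: if_cong)

lemma mat_mult_commute: "A ** mat r = mat r ** A"
  for A :: "'a::comm_ring_1 ^ 'n ^ 'm"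
  by (simp add: vec_eq_iff mat_mult_nth_right)

lemma mat_mult_left_commute: "A ** (mat r ** B) = mat r ** (A ** B)"
  for A :: "'a::comm_ring_1 ^ 'n ^ 'm"
  by (metis mat_mult_commute matrix_mul_assoc)

lemma mat_mult_vec: "mat r *v x = r *s x" for x :: "'a::comm_ring_1 ^ 'n"
  by (simp add: matrix_vector_mult_def mat_def vec_eq_iff if_distrib [of "\<lambda>x. x * _"] cong: if_cong)

lemma trace_mat_mult: "trace (mat r ** A) = r * trace A" for A :: "'a::comm_ring_1 ^ 'n ^ 'n"
  by (simp add: trace_def sum_distrib_left)

lemma trace_zero [simp]: "trace (0 :: 'a::comm_ring_1 ^ 'n ^ 'n) = 0"
  by (simp add: trace_def)

lemma trace_sum: "trace (\<Sum>i\<in>S. f i :: 'a::comm_ring_1 ^ 'n ^ 'n) = (\<Sum>i\<in>S. trace (f i))"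
  by (induct S rule: infinite_finite_induct) (auto simp: trace_add)

lemma scaleR_matrix: "r *\<^sub>R A = mat (of_real r) ** (A :: complex ^ 'n ^ 'm)"
  by (simp add: vec_eq_iff scaleR_conv_of_real[of _ "_::complex"])

lemma scaleR_vector: "r *\<^sub>R x = of_real r *s (x :: complex ^ 'n)"
  by (simp add: vec_eq_iff scaleR_conv_of_real[of _ "_::complex"])

lemma matrix_vector_scaleR: "A *v (r *\<^sub>R x) = r *\<^sub>R (A *v x)" for A :: "complex ^ 'n ^ 'm"
  by (simp add: scaleR_vector vector_scalar_commute)

lemma cinner_add_left: "cinner (x + y) z = cinner x z + cinner y z"
  by (simp add: cinner_def sum.distrib algebra_simps)
lemma cinner_diff_left: "cinner (x - y) z = cinner x z - cinner y z"
  by (simp add: cinner_def sum_subtractf algebra_simps)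
lemma cinner_diff_right: "cinner z (x - y) = cinner z x - cinner z y"
  by (simp add: cinner_def sum_subtractf algebra_simps)
lemma cinner_scale_left: "cinner (r *s x) y = r * cinner x y"
  by (simp add: cinner_def sum_distrib_left mult.assoc)
lemma cinner_scale_right: "cinner x (r *s y) = cnj r * cinner x y"
  by (simp add: cinner_def sum_distrib_left algebra_simps)
lemma cinner_scaleR_left: "cinner (r *\<^sub>R x) y = of_real r * cinner x y"
  by (simp add: scaleR_vector cinner_scale_left)
lemma cinner_scaleR_right: "cinner x (r *\<^sub>R y) = of_real r * cinner x y"
  by (simp add: scaleR_vector cinner_scale_right)
lemma cinner_zero [simp]: "cinner 0 x = 0" "cinner x 0 = 0"
  by (simp_all add: cinner_def)
lemma cinner_sum_left: "cinner (\<Sum>i\<in>S. f i) y = (\<Sum>i\<in>S. cinner (f i) y)"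
  by (induct S rule: infinite_finite_induct) (auto simp: cinner_add_left)
lemma cinner_commute: "cinner y x = cnj (cinner x y)"
  by (simp add: cinner_def mult.commute)
lemma Re_cinner: "Re (cinner x y) = x \<bullet> y"
  by (simp add: cinner_def inner_vec_def inner_complex_def)
lemma cinner_self: "cinner x x = of_real ((norm x)\<^sup>2)"
  by (rule complex_eqI) (simp_all add: Re_cinner power2_norm_eq_inner, simp add: cinner_def)

lemma cinner_adj: "cinner (A *v x) y = cinner x (mat_adj A *v y)"
  apply (simp add: cinner_def mat_adj_def matrix_vector_mult_def sum_distrib_left sum_distrib_right)
  apply (subst sum.swap)
  apply (simp add: algebra_simps)
  done

lemma mat_adj_add: "mat_adj (A + B) = mat_adj A + mat_adj B"
  by (simp add: mat_adj_def vec_eq_iff)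
lemma mat_adj_diff: "mat_adj (A - B) = mat_adj A - mat_adj B"
  by (simp add: mat_adj_def vec_eq_iff)
lemma mat_adj_mult: "mat_adj (A ** B) = mat_adj B ** mat_adj A"
  by (simp add: mat_adj_def vec_eq_iff matrix_matrix_mult_def mult.commute)
lemma mat_adj_mat [simp]: "mat_adj (mat r) = mat (cnj r)"
  by (simp add: mat_adj_def vec_eq_iff mat_def)
lemma mat_adj_zero [simp]: "mat_adj 0 = 0"
  by (simp add: mat_adj_def vec_eq_iff)
lemma mat_adj_adj [simp]: "mat_adj (mat_adj A) = A"
  by (simp add: mat_adj_def vec_eq_iff)
lemma mat_adj_sum: "mat_adj (\<Sum>i\<in>S. f i) = (\<Sum>i\<in>S. mat_adj (f i))"
  by (induct S rule: infinite_finite_induct) (auto simp: mat_adj_add)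
lemma trace_mat_adj: "trace (mat_adj A) = cnj (trace A)"
  by (simp add: trace_def mat_adj_def)

lemma self_adjoint_cinner: "self_adjoint A \<Longrightarrow> cinner (A *v x) y = cinner x (A *v y)"
  by (metis cinner_adj self_adjoint_def)

text \<open>The rank one operator \<open>|x\<rangle>\<langle>y|\<close>.\<close>

definition ketbra :: "complex ^ 'n \<Rightarrow> complex ^ 'n \<Rightarrow> complex ^ 'n ^ 'n" where
  "ketbra x y = (\<chi> i j. x $ i * cnj (y $ j))"

lemma ketbra_vec: "ketbra x y *v z = cinner z y *s x"
  by (simp add: ketbra_def matrix_vector_mult_def cinner_def vec_eq_iff sum_distrib_left sum_distrib_right algebra_simps)

lemma mat_adj_ketbra [simp]: "mat_adj (ketbra x y) = ketbra y x"
  by (simp add: ketbra_def mat_adj_def vec_eq_iff mult.commute)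

lemma mult_ketbra: "A ** ketbra x y = ketbra (A *v x) y"
  by (simp add: ketbra_def matrix_vector_mult_def matrix_matrix_mult_def vec_eq_iff sum_distrib_right mult.assoc)

lemma trace_ketbra: "trace (ketbra x y) = cinner x y"
  by (simp add: ketbra_def trace_def cinner_def)

lemma trace_mult_ketbra: "trace (A ** ketbra x y) = cinner (A *v x) y"
  by (simp add: mult_ketbra trace_ketbra)

section \<open>The spectral theorem\<close>

text \<open>If the form of \<open>g\<close> is nonnegative near \<open>x\<close> in the direction \<open>g x\<close> and
  vanishes at \<open>x\<close>, then \<open>x\<close> minimizes it and the first order condition is \<open>g x
  = 0\<close>. Positivity is only asked on a set \<open>V\<close>, because the spectral theorem applies this
  on an invariant subspace.\<close>

lemma positive_op_kernel:
  assumes "\<And>y. y \<in> V \<Longrightarrow> 0 \<le> Re (cinner (g *v y) y)" and sa: "self_adjoint g"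
    and x: "Re (cinner (g *v x) x) = 0" and V: "\<And>r. x - r *\<^sub>R (g *v x) \<in> V"
  shows "g *v x = 0"
proof -
  define K where "K = Re (cinner (g *v (g *v x)) (g *v x))"
  have key: "2 * r * (norm (g *v x))\<^sup>2 \<le> r\<^sup>2 * K" for r
  proof -
    have "0 \<le> Re (cinner (g *v (x - r *\<^sub>R (g *v x))) (x - r *\<^sub>R (g *v x)))"
      using assms(1) V by blast
    also have "\<dots> = - 2 * r * (norm (g *v x))\<^sup>2 + r\<^sup>2 * K"
      using x self_adjoint_cinner[OF sa, of "g *v x" x]
      by (simp add: K_def matrix_vector_mult_diff_distrib matrix_vector_scaleR cinner_diff_left cinner_diff_right
          cinner_scaleR_left cinner_scaleR_right cinner_self algebra_simps power2_eq_square)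
    finally show ?thesis by simp
  qed
  show ?thesis
  proof (rule ccontr)
    assume "g *v x \<noteq> 0"
    then have n: "(norm (g *v x))\<^sup>2 > 0" by simp
    show False
    proof (cases "K > 0")
      case True
      define N where "N = (norm (g *v x))\<^sup>2"
      have "2 * (N / K) * N \<le> (N / K)\<^sup>2 * K" using key[of "N / K"] by (simp add: N_def)
      then have "N * N \<le> 0" using True by (simp add: power2_eq_square field_simps)
      moreover have "0 < N * N" using n by (simp add: N_def)
      ultimately show False by simp
    next
      case False
      with key[of 1] n show False by simp
    qed
  qed
qed

lemma positive_op_cinner_zero: "positive_op g \<Longrightarrow> Re (cinner (g *v x) x) = 0 \<Longrightarrow> g *v x = 0"
  by (rule positive_op_kernel[of UNIV]) (auto simp: positive_op_def)

definition orthonormal_basis :: "('n \<Rightarrow> complex ^ 'n) \<Rightarrow> bool" where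
  "orthonormal_basis e \<longleftrightarrow> (\<forall>i j. cinner (e i) (e j) = (if i = j then 1 else 0))"

text \<open>A family indexed by the coordinates has as many members as the dimension, so orthonormality makes the matrix
  of its columns an isometry, hence unitary: the family is complete.\<close>

lemma orthonormal_basis_resolution:
  fixes e :: "'n \<Rightarrow> complex ^ 'n"
  assumes "orthonormal_basis e"
  shows "(\<Sum>i\<in>UNIV. ketbra (e i) (e i)) = mat 1"
proof -
  define U :: "complex ^ 'n ^ 'n" where "U = (\<chi> r i. e i $ r)"
  have "(mat_adj U ** U) $ i $ j = cinner (e j) (e i)" for i j
    by (simp add: U_def mat_adj_def matrix_matrix_mult_def cinner_def mult.commute)
  then have "mat_adj U ** U = mat 1"
    using assms by (simp add: vec_eq_iff mat_def orthonormal_basis_def)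
  then have "U ** mat_adj U = mat 1"
    by (simp add: matrix_left_right_inverse)
  moreover have "U ** mat_adj U = (\<Sum>i\<in>UNIV. ketbra (e i) (e i))"
    by (simp add: U_def mat_adj_def matrix_matrix_mult_def vec_eq_iff ketbra_def)
  ultimately show ?thesis by simp
qed

lemma orthonormal_basis_expand:
  assumes "orthonormal_basis e"
  shows "x = (\<Sum>i\<in>UNIV. cinner x (e i) *s e i)"
proof -
  have "x = (\<Sum>i\<in>UNIV. ketbra (e i) (e i)) *v x"
    by (simp add: orthonormal_basis_resolution[OF assms])
  also have "\<dots> = (\<Sum>i\<in>UNIV. cinner x (e i) *s e i)"
    by (simp add: ketbra_vec matrix_vector_mult_def vec_eq_iff sum_distrib_right ketbra_def cinner_def)
       (subst sum.swap, simp add: algebra_simps)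
  finally show ?thesis .
qed

lemma orthonormal_basis_eqI:
  fixes A B :: "complex ^ 'n ^ 'n"
  assumes "orthonormal_basis e" "\<And>i. A *v e i = B *v e i"
  shows "A = B"
proof -
  have "A ** (\<Sum>i\<in>UNIV. ketbra (e i) (e i)) = B ** (\<Sum>i\<in>UNIV. ketbra (e i) (e i))"
    unfolding matrix_mult_sum_right mult_ketbra assms(2) ..
  then show ?thesis
    by (simp add: orthonormal_basis_resolution[OF assms(1)])
qed

lemma trace_orthonormal_basis:
  assumes "orthonormal_basis e"
  shows "trace A = (\<Sum>i\<in>UNIV. cinner (A *v e i) (e i))"
proof -
  have "trace A = trace (A ** (\<Sum>i\<in>UNIV. ketbra (e i) (e i)))"
    by (simp add: orthonormal_basis_resolution[OF assms])
  then show ?thesis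
    by (simp add: matrix_mult_sum_right trace_sum trace_mult_ketbra)
qed

text \<open>The orthogonal complement of \<open>S\<close> is invariant under \<open>h\<close>, and a unit vector in it
  that maximizes the quadratic form of \<open>h\<close> is an eigenvector. The complement is nonzero, since
  otherwise the projections onto the members of \<open>S\<close> would add up to the identity and comparing
  traces would give \<open>card S = n\<close>.\<close>

lemma exists_eigenvector_orthogonal:
  fixes h :: "complex ^ 'n ^ 'n"
  assumes sa: "self_adjoint h" and fin: "finite S" and card: "card S < CARD('n)"
    and on: "\<And>x y. x \<in> S \<Longrightarrow> y \<in> S \<Longrightarrow> cinner x y = (if x = y then 1 else 0)"
    and ev: "\<And>x. x \<in> S \<Longrightarrow> \<exists>r::real. h *v x = of_real r *s x"
  shows "\<exists>x (r::real). norm x = 1 \<and> (\<forall>y\<in>S. cinner x y = 0) \<and> h *v x = of_real r *s x"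
proof -
  define V where "V = {x. \<forall>y\<in>S. cinner x y = 0}"
  have "\<exists>x\<in>V. x \<noteq> 0"
  proof (rule ccontr)
    assume no: "\<not> ?thesis"
    define Q where "Q = (\<Sum>y\<in>S. ketbra y y)"
    have "mat 1 - Q = 0"
    proof -
      have "(mat 1 - Q) *v x = 0 *v x" for x
      proof -
        have Qx: "Q *v x = (\<Sum>y\<in>S. cinner x y *s y)"
          unfolding Q_def using fin
          by (induct S) (auto simp: matrix_vector_mult_add_rdistrib ketbra_vec)
        have "cinner (x - Q *v x) y = 0" if "y \<in> S" for y
        proof -
          have "(\<Sum>z\<in>S. cinner x z * cinner z y) = (\<Sum>z\<in>S. if z = y then cinner x y else 0)"
            using on that by (intro sum.cong) auto
          also have "\<dots> = cinner x y" using fin that by simp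
          finally show ?thesis
            by (simp add: Qx cinner_diff_left cinner_sum_left cinner_scale_left)
        qed
        then have "x - Q *v x \<in> V" by (simp add: V_def)
        with no show ?thesis by (auto simp: matrix_vector_mult_diff_rdistrib)
      qed
      then show ?thesis by (subst matrix_eq) blast
    qed
    then have "trace (mat 1 :: complex ^ 'n ^ 'n) = trace Q" by simp
    also have "\<dots> = (\<Sum>y\<in>S. 1)"
      unfolding Q_def trace_sum trace_ketbra using on by (intro sum.cong) auto
    finally have "CARD('n) = card S"
      by (metis of_nat_eq_iff sum_constant mult.right_neutral trace_I)
    with card show False by simp
  qed
  then obtain x0 where x0: "x0 \<in> V" "x0 \<noteq> 0" by blast
  have scale: "r *\<^sub>R x \<in> V" if "x \<in> V" for x r
    using that by (simp add: V_def cinner_scaleR_left)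
  have diff: "x - y \<in> V" if "x \<in> V" "y \<in> V" for x y
    using that by (simp add: V_def cinner_diff_left)
  \<comment> \<open>invariance of the complement, because \<open>h\<close> is self-adjoint and \<open>S\<close> consists of eigenvectors\<close>
  have hV: "h *v x \<in> V" if "x \<in> V" for x
  proof -
    have "cinner (h *v x) y = 0" if y: "y \<in> S" for y
    proof -
      obtain r :: real where "h *v y = of_real r *s y" using ev y by blast
      then show ?thesis
        using \<open>x \<in> V\<close> y by (simp add: self_adjoint_cinner[OF sa] cinner_scale_right V_def)
    qed
    then show ?thesis by (simp add: V_def)
  qed
  have cont_c: "continuous_on UNIV (\<lambda>x. cinner x y)" for y :: "complex ^ 'n"
    unfolding cinner_def by (intro continuous_intros)
  have "closed V"
  proof -
    have "V = (\<Inter>y\<in>S. {x. cinner x y = 0})" by (auto simp: V_def)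
    moreover have "closed {x. cinner x y = 0}" for y :: "complex ^ 'n"
      by (intro closed_Collect_eq cont_c continuous_on_const)
    ultimately show ?thesis by auto
  qed
  then have comp: "compact (V \<inter> sphere 0 1)"
    by (simp add: closed_Int_compact)
  have ne: "V \<inter> sphere 0 1 \<noteq> {}"
    using scale[OF x0(1), of "inverse (norm x0)"] x0(2) by (auto intro!: exI[of _ "inverse (norm x0) *\<^sub>R x0"])
  have cont: "continuous_on (V \<inter> sphere 0 1) (\<lambda>x. Re (cinner (h *v x) x))"
    unfolding cinner_def matrix_vector_mult_def
    by (intro continuous_intros continuous_on_Re)
  obtain x where x: "x \<in> V" "norm x = 1"
    and max: "\<And>y. y \<in> V \<Longrightarrow> norm y = 1 \<Longrightarrow> Re (cinner (h *v y) y) \<le> Re (cinner (h *v x) x)"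
    using continuous_attains_sup[OF comp ne cont] by auto
  \<comment> \<open>at the maximum \<open>M\<close> the operator \<open>M - h\<close> is positive on the complement and vanishes at \<open>x\<close>\<close>
  define M where "M = Re (cinner (h *v x) x)"
  define g where "g = mat (of_real M) - h"
  have g: "g *v y = M *\<^sub>R y - h *v y" for y
    by (simp add: g_def matrix_vector_mult_diff_rdistrib mat_mult_vec scaleR_vector)
  have "g *v x = 0"
  proof (rule positive_op_kernel[of V])
    show "self_adjoint g" using sa by (simp add: g_def self_adjoint_def mat_adj_diff)
    show "Re (cinner (g *v x) x) = 0"
      using x(2) by (simp add: g cinner_diff_left cinner_scaleR_left cinner_self M_def)
    show "x - r *\<^sub>R (g *v x) \<in> V" for r
      unfolding g by (intro diff scale hV x)
    show "0 \<le> Re (cinner (g *v y) y)" if "y \<in> V" for y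
    proof (cases "y = 0")
      case False
      define u where "u = inverse (norm y) *\<^sub>R y"
      have y: "y = norm y *\<^sub>R u" using False by (simp add: u_def)
      have "u \<in> V" "norm u = 1" using scale[OF that] False by (auto simp: u_def)
      then have "Re (cinner (h *v u) u) \<le> M" using max M_def by blast
      moreover have "Re (cinner (g *v y) y) = (norm y)\<^sup>2 * (M - Re (cinner (h *v u) u))"
      proof -
        have "Re (cinner (g *v (r *\<^sub>R u)) (r *\<^sub>R u)) = r\<^sup>2 * (M - Re (cinner (h *v u) u))" for r
          by (simp add: g matrix_vector_scaleR cinner_diff_left cinner_scaleR_left cinner_scaleR_right
              cinner_self \<open>norm u = 1\<close> power2_eq_square right_diff_distrib)
        from this[of "norm y"] show ?thesis by (simp flip: y)
      qed
      ultimately show ?thesis by simp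
    qed simp
  qed
  then have "h *v x = of_real M *s x" by (simp add: g scaleR_vector)
  with x show ?thesis by (auto simp: V_def)
qed

theorem spectral_theorem:
  fixes h :: "complex ^ 'n ^ 'n"
  assumes sa: "self_adjoint h"
  obtains e and l :: "'n \<Rightarrow> real" where "orthonormal_basis e" "\<And>i. h *v e i = of_real (l i) *s e i"
proof -
  have "\<exists>S. finite S \<and> card S = m \<and> (\<forall>x\<in>S. \<forall>y\<in>S. cinner x y = (if x = y then 1 else 0)) \<and>
          (\<forall>x\<in>S. \<exists>r::real. h *v x = of_real r *s x)" if "m \<le> CARD('n)" for m
    using that
  proof (induct m)
    case 0
    show ?case by (intro exI[of _ "{}"]) auto
  next
    case (Suc m)
    then obtain S where S: "finite S" "card S = m"
      "\<And>x y. x \<in> S \<Longrightarrow> y \<in> S \<Longrightarrow> cinner x y = (if x = y then 1 else 0)"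
      "\<And>x. x \<in> S \<Longrightarrow> \<exists>r::real. h *v x = of_real r *s x" by auto
    then obtain x and r :: real where x: "norm x = 1" "\<forall>y\<in>S. cinner x y = 0" "h *v x = of_real r *s x"
      using exists_eigenvector_orthogonal[OF sa, of S] Suc.prems by auto
    have "cinner x x = 1" by (simp add: cinner_self x)
    then have "x \<notin> S" using x by auto
    have "cinner y x = 0" if "y \<in> S" for y using x that by (metis cinner_commute complex_cnj_zero)
    with S x \<open>x \<notin> S\<close> \<open>cinner x x = 1\<close> show ?case
      by (intro exI[of _ "insert x S"]) auto
  qed
  then obtain S where S: "finite S" "card S = CARD('n)"
      "\<And>x y. x \<in> S \<Longrightarrow> y \<in> S \<Longrightarrow> cinner x y = (if x = y then 1 else 0)"
      "\<And>x. x \<in> S \<Longrightarrow> \<exists>r::real. h *v x = of_real r *s x" by (metis order_refl)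
  obtain e :: "'n \<Rightarrow> complex ^ 'n" where e: "bij_betw e UNIV S"
    using S finite_same_card_bij[of "UNIV :: 'n set" S] by auto
  have eS: "e i \<in> S" for i using e bij_betwE by blast
  have ei: "e i = e j \<longleftrightarrow> i = j" for i j using e by (auto simp: bij_betw_def inj_on_def)
  have "orthonormal_basis e"
    unfolding orthonormal_basis_def using S(3)[OF eS eS] by (simp add: ei)
  moreover obtain l :: "'n \<Rightarrow> real" where "\<And>i. h *v e i = of_real (l i) *s e i"
    using S(4)[OF eS] by metis
  ultimately show thesis using that by blast
qed

section \<open>Positive operators, effects and projections\<close>

lemma positive_op_add: "positive_op a \<Longrightarrow> positive_op b \<Longrightarrow> positive_op (a + b)"
  by (simp add: positive_op_def self_adjoint_def mat_adj_add matrix_vector_mult_add_rdistrib cinner_add_left)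

lemma positive_op_compress:
  assumes "positive_op g"
  shows "positive_op (mat_adj A ** g ** A)"
proof -
  have "cinner ((mat_adj A ** g ** A) *v x) x = cinner (g *v (A *v x)) (A *v x)" for x
    using cinner_adj[of "mat_adj A" "g *v (A *v x)" x]
    by (simp flip: matrix_vector_mul_assoc)
  then show ?thesis
    using assms by (simp add: positive_op_def self_adjoint_def mat_adj_mult matrix_mul_assoc)
qed

lemma positive_op_compress_sa:
  "positive_op g \<Longrightarrow> self_adjoint z \<Longrightarrow> positive_op (z ** g ** z)"
  using positive_op_compress[of g z] by (simp add: self_adjoint_def)

lemma positive_op_eigen:
  assumes "positive_op g" "orthonormal_basis e" "\<And>i. g *v e i = of_real (l i) *s e i"
  shows "l i \<ge> 0"
proof -
  have "Re (cinner (g *v e i) (e i)) = l i"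
    using assms(2) by (simp add: assms(3) cinner_scale_left orthonormal_basis_def)
  then show ?thesis using assms(1) by (metis positive_op_def)
qed

lemma norm_orthonormal_basis:
  assumes "orthonormal_basis e"
  shows "(norm x)\<^sup>2 = (\<Sum>i\<in>UNIV. (norm (cinner x (e i)))\<^sup>2)"
proof -
  have "complex_of_real ((norm x)\<^sup>2) = cinner (\<Sum>i\<in>UNIV. cinner x (e i) *s e i) x"
    by (simp only: cinner_self flip: orthonormal_basis_expand[OF assms])
  also have "\<dots> = (\<Sum>i\<in>UNIV. cinner x (e i) * cnj (cinner x (e i)))"
    by (simp add: cinner_sum_left cinner_scale_left flip: cinner_commute)
  also have "\<dots> = of_real (\<Sum>i\<in>UNIV. (norm (cinner x (e i)))\<^sup>2)"
    by (simp flip: complex_norm_square)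
  finally show ?thesis by (simp only: of_real_eq_iff)
qed

lemma quadratic_form_eigen:
  assumes "orthonormal_basis e" "\<And>i. g *v e i = of_real (l i) *s e i"
  shows "cinner (g *v x) x = of_real (\<Sum>i\<in>UNIV. l i * (norm (cinner x (e i)))\<^sup>2)"
proof -
  have lin: "g *v (\<Sum>i\<in>S. f i) = (\<Sum>i\<in>S. g *v f i)" for f and S :: "'a set"
    by (induct S rule: infinite_finite_induct) (auto simp: matrix_vector_right_distrib)
  have "cinner (g *v x) x = cinner (\<Sum>i\<in>UNIV. (cinner x (e i) * of_real (l i)) *s e i) x"
    by (subst (1) orthonormal_basis_expand[OF assms(1), of x])
       (simp add: lin vector_scalar_commute assms(2))
  also have "\<dots> = (\<Sum>i\<in>UNIV. of_real (l i) * (cinner x (e i) * cnj (cinner x (e i))))"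
    by (simp add: cinner_sum_left cinner_scale_left mult_ac flip: cinner_commute)
  also have "\<dots> = of_real (\<Sum>i\<in>UNIV. l i * (norm (cinner x (e i)))\<^sup>2)"
    by (simp flip: complex_norm_square)
  finally show ?thesis .
qed

text \<open>Every eigenvalue of a positive operator is at most the sum of all of them.\<close>

lemma positive_op_le_trace:
  assumes "positive_op g"
  shows "Re (cinner (g *v x) x) \<le> Re (trace g) * (norm x)\<^sup>2"
proof -
  from assms have "self_adjoint g" by (simp add: positive_op_def)
  then obtain e l where e: "orthonormal_basis e" and l: "\<And>i. g *v e i = of_real (l i) *s e i"
    using spectral_theorem by blast
  have l0: "l i \<ge> 0" for i using positive_op_eigen[OF assms e l] .
  have tr: "Re (trace g) = (\<Sum>i\<in>UNIV. l i)"
    using e by (simp add: trace_orthonormal_basis[OF e] l cinner_scale_left orthonormal_basis_def)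
  have "l i \<le> Re (trace g)" for i
    unfolding tr by (rule member_le_sum) (auto simp: l0)
  then have "(\<Sum>i\<in>UNIV. l i * (norm (cinner x (e i)))\<^sup>2) \<le> (\<Sum>i\<in>UNIV. Re (trace g) * (norm (cinner x (e i)))\<^sup>2)"
    by (intro sum_mono mult_right_mono) auto
  then show ?thesis
    by (simp add: quadratic_form_eigen[OF e l] norm_orthonormal_basis[OF e, of x] sum_distrib_left)
qed

lemma positive_op_trace_nonneg:
  assumes "positive_op g"
  shows "0 \<le> Re (trace g)"
proof -
  have "0 \<le> Re (cinner (g *v vec 1) (vec 1))" using assms by (simp add: positive_op_def)
  then have "0 \<le> Re (trace g) * (norm (vec 1 :: complex ^ 'a))\<^sup>2"
    using positive_op_le_trace[OF assms] order_trans by blast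
  moreover have "(0::real) < (norm (vec 1 :: complex ^ 'a))\<^sup>2"
    by (simp add: vec_eq_iff)
  ultimately show ?thesis by (simp add: zero_le_mult_iff)
qed

lemma positive_op_trace_zero:
  assumes "positive_op g" "Re (trace g) = 0"
  shows "g = 0"
proof -
  have "g *v x = 0 *v x" for x
  proof -
    have "Re (cinner (g *v x) x) = 0"
      using positive_op_le_trace[OF assms(1), of x] assms by (auto simp: positive_op_def intro: antisym)
    then show ?thesis using positive_op_cinner_zero[OF assms(1)] by simp
  qed
  then show ?thesis by (subst matrix_eq) blast
qed

lemma op_le_trace_eq:
  assumes "op_le a b" "Re (trace a) = Re (trace b)"
  shows "a = b"
  using positive_op_trace_zero[of "b - a"] assms by (simp add: op_le_def trace_sub)

lemma op_le_trace_mono: "op_le a b \<Longrightarrow> Re (trace a) \<le> Re (trace b)"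
  using positive_op_trace_nonneg[of "b - a"] by (simp add: op_le_def trace_sub)

lemma op_le_refl: "op_le a a"
  by (simp add: op_le_def positive_op_def self_adjoint_def)

lemma op_le_trans: "op_le a b \<Longrightarrow> op_le b c \<Longrightarrow> op_le a c"
  unfolding op_le_def using positive_op_add[of "b - a" "c - b"] by simp

abbreviation effects :: "(complex ^ 'n ^ 'n) set" where
  "effects \<equiv> op_interval 0 (mat 1)"

lemma effects_iff: "a \<in> effects \<longleftrightarrow> positive_op a \<and> positive_op (mat 1 - a)"
  by (simp add: op_interval_def op_le_def)

lemma effects_complement: "a \<in> effects \<Longrightarrow> mat 1 - a \<in> effects"
  by (simp add: effects_iff)

definition projection :: "complex ^ 'n ^ 'n \<Rightarrow> bool" where
  "projection z \<longleftrightarrow> self_adjoint z \<and> z ** z = z"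

lemma projection_complement: "projection z \<Longrightarrow> projection (mat 1 - z)"
  by (simp add: projection_def self_adjoint_def mat_adj_diff matrix_distribs)

lemma positive_op_one [simp]: "positive_op (mat 1)"
  by (simp add: positive_op_def self_adjoint_def cinner_self)

lemma projection_positive: "projection z \<Longrightarrow> positive_op z"
  using positive_op_compress_sa[of "mat 1" z] by (simp add: projection_def)

lemma projection_effect: "projection z \<Longrightarrow> z \<in> effects"
  using projection_positive projection_complement effects_iff by blast

lemma mat_adj_mult_eqD: "A ** B = C \<Longrightarrow> mat_adj B ** mat_adj A = mat_adj C"
  by (auto simp: mat_adj_mult)

lemma projection_le_commute:
  assumes "projection p" "projection q" "p ** q = p"
  shows "q ** p = p"
  using arg_cong[OF assms(3), of mat_adj] assms(1,2)
  by (simp add: mat_adj_mult projection_def self_adjoint_def)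

lemma projection_diff:
  assumes "projection p" "projection q" "p ** q = p"
  shows "projection (q - p)"
  using assms projection_le_commute[OF assms]
  by (simp add: projection_def self_adjoint_def mat_adj_diff matrix_distribs)

text \<open>A vector in the range of \<open>z\<close> is then a null vector of the positive form of \<open>a\<close>,
  hence in the kernel of \<open>a\<close>.\<close>

lemma positive_op_mult_eq_zero:
  assumes "positive_op a" "self_adjoint z" "z ** a ** z = 0"
  shows "a ** z = 0" "z ** a = 0"
proof -
  have "(a ** z) *v x = 0 *v x" for x
  proof -
    have "cinner (a *v (z *v x)) (z *v x) = cinner ((z ** a ** z) *v x) x"
      using self_adjoint_cinner[OF assms(2)] by (simp flip: matrix_vector_mul_assoc)
    then have "Re (cinner (a *v (z *v x)) (z *v x)) = 0" by (simp add: assms(3))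
    then show ?thesis
      using positive_op_cinner_zero[OF assms(1)] by (simp flip: matrix_vector_mul_assoc)
  qed
  then show *: "a ** z = 0" by (subst matrix_eq) blast
  show "z ** a = 0"
    using arg_cong[OF *, of mat_adj] assms by (simp add: mat_adj_mult self_adjoint_def positive_op_def)
qed

lemma trace_projection_mult:
  "projection z \<Longrightarrow> trace (z ** a) = trace (z ** a ** z)"
  by (metis matrix_mul_assoc projection_def trace_mul_sym)

lemma trace_projection_effect_nonneg:
  assumes "projection z" "positive_op a"
  shows "0 \<le> Re (trace (z ** a))"
  using positive_op_trace_nonneg[OF positive_op_compress_sa[OF assms(2), of z]] assms(1)
  by (simp add: trace_projection_mult projection_def)

lemma trace_projection_effect_zero:
  assumes "projection z" "positive_op a" "Re (trace (z ** a)) = 0"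
  shows "a ** z = 0" "z ** a = 0"
proof -
  have "z ** a ** z = 0"
    using positive_op_trace_zero[OF positive_op_compress_sa[OF assms(2), of z]] assms
    by (simp add: trace_projection_mult projection_def)
  then show "a ** z = 0" "z ** a = 0"
    using positive_op_mult_eq_zero assms by (auto simp: projection_def)
qed

text \<open>An effect is between \<open>p\<close> and \<open>q\<close> exactly if it is the identity on the range of
  \<open>p\<close> and vanishes off the range of \<open>q\<close>: compressing \<open>p \<le> a \<le>
  1\<close> to \<open>p\<close>, and \<open>0 \<le> a \<le> q\<close> to \<open>1 - q\<close>, leaves sums of
  two positive operators that are zero.\<close>

lemma op_interval_projections_iff:
  assumes p: "projection p" and q: "projection q" and pq: "p ** q = p"
  shows "a \<in> op_interval p q \<longleftrightarrow> a \<in> effects \<and> a ** p = p \<and> a ** q = a"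
proof
  assume a: "a \<in> op_interval p q"
  have le: "op_le p a" "op_le a q" "op_le 0 p" "op_le q (mat 1)"
    using a projection_effect[OF p] projection_effect[OF q] by (auto simp: op_interval_def)
  then have eff: "a \<in> effects"
    unfolding op_interval_def using op_le_trans by blast
  have sp: "self_adjoint p" "p ** p = p" and sq: "self_adjoint q" "q ** q = q"
    using p q by (auto simp: projection_def)
  have "p ** (a - p) ** p + p ** (mat 1 - a) ** p = 0"
    by (simp add: matrix_distribs sp)
  moreover have "positive_op (p ** (a - p) ** p)" "positive_op (p ** (mat 1 - a) ** p)"
    using le(1) eff sp(1) by (auto intro!: positive_op_compress_sa simp: op_le_def effects_iff)
  ultimately have "Re (trace (p ** (mat 1 - a) ** p)) = 0"
    using positive_op_trace_nonneg trace_add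
    by (smt (verit) add.commute plus_complex.sel(1) trace_zero zero_complex.sel(1))
  then have "(mat 1 - a) ** p = 0"
    using trace_projection_effect_zero(1)[OF p, of "mat 1 - a"] eff
    by (simp add: trace_projection_mult[OF p] effects_iff)
  then have 1: "a ** p = p" by (simp add: matrix_distribs)
  let ?r = "mat 1 - q"
  have r: "projection ?r" "self_adjoint ?r" "q ** ?r = 0"
    using projection_complement[OF q] sq by (auto simp: projection_def matrix_distribs)
  have "?r ** a ** ?r + ?r ** (q - a) ** ?r = 0"
    using r(3) by (simp add: matrix_distribs sq flip: matrix_mul_assoc)
  moreover have "positive_op (?r ** a ** ?r)" "positive_op (?r ** (q - a) ** ?r)"
    using le(2) eff r(2) by (auto intro!: positive_op_compress_sa simp: op_le_def effects_iff)
  ultimately have "Re (trace (?r ** a ** ?r)) = 0"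
    using positive_op_trace_nonneg trace_add
    by (smt (verit) add.commute plus_complex.sel(1) trace_zero zero_complex.sel(1))
  then have "a ** ?r = 0"
    using trace_projection_effect_zero(1)[OF r(1), of a] eff
    by (simp add: trace_projection_mult[OF r(1)] effects_iff)
  then have "a ** q = a" by (simp add: matrix_distribs)
  with eff 1 show "a \<in> effects \<and> a ** p = p \<and> a ** q = a" by blast
next
  assume a: "a \<in> effects \<and> a ** p = p \<and> a ** q = a"
  have sp: "self_adjoint p" "p ** p = p" and sq: "self_adjoint q" "q ** q = q"
    using p q by (auto simp: projection_def)
  have adj: "mat_adj a = a" "mat_adj p = p" "mat_adj q = q"
    using a sp sq by (auto simp: effects_iff positive_op_def self_adjoint_def)
  have pa: "p ** a = p" and qa: "q ** a = a"
    using a mat_adj_mult_eqD[of a p p] mat_adj_mult_eqD[of a q a] adj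
    by simp_all
  have "(mat 1 - p) ** a ** (mat 1 - p) = a - p"
    using a pa sp by (simp add: matrix_distribs)
  moreover have "positive_op ((mat 1 - p) ** a ** (mat 1 - p))"
    using a projection_complement[OF p] by (intro positive_op_compress_sa) (auto simp: effects_iff projection_def)
  moreover have "q ** (mat 1 - a) ** q = q - a"
    using a qa sq by (simp add: matrix_distribs)
  moreover have "positive_op (q ** (mat 1 - a) ** q)"
    using a sq by (intro positive_op_compress_sa) (auto simp: effects_iff)
  ultimately show "a \<in> op_interval p q" by (simp add: op_interval_def op_le_def)
qed

section \<open>Support projections of a self-adjoint operator\<close>

text \<open>Functional calculus: if \<open>h\<close> has the eigenbasis \<open>e\<close> with eigenvalues
  \<open>l\<close>, then \<open>diag_op e (f \<circ> l)\<close> is \<open>f(h)\<close>.\<close>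

definition diag_op :: "('n \<Rightarrow> complex ^ 'n) \<Rightarrow> ('n \<Rightarrow> complex) \<Rightarrow> complex ^ 'n ^ 'n" where
  "diag_op e d = (\<Sum>i\<in>UNIV. mat (d i) ** ketbra (e i) (e i))"

lemma diag_op_basis:
  assumes "orthonormal_basis e"
  shows "diag_op e d *v e j = d j *s e j"
proof -
  have "diag_op e d ** ketbra (e j) (e j) = mat (d j) ** ketbra (e j) (e j)"
  proof -
    have "diag_op e d ** ketbra (e j) (e j) = (\<Sum>i\<in>UNIV. if i = j then mat (d j) ** ketbra (e j) (e j) else 0)"
      unfolding diag_op_def matrix_mult_sum_left using assms
      by (intro sum.cong) (auto simp: mult_ketbra ketbra_vec orthonormal_basis_def simp flip: matrix_mul_assoc,
          simp_all add: ketbra_def vec_eq_iff)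
    then show ?thesis by simp
  qed
  from arg_cong[OF this, of "\<lambda>A. A *v e j"] show ?thesis
    using assms by (simp add: orthonormal_basis_def ketbra_vec mat_mult_vec flip: matrix_vector_mul_assoc)
qed

lemma diag_op_mult:
  "orthonormal_basis e \<Longrightarrow> diag_op e d ** diag_op e d' = diag_op e (\<lambda>i. d i * d' i)"
  by (rule orthonormal_basis_eqI)
     (auto simp: diag_op_basis vector_scalar_commute mult.commute simp flip: matrix_vector_mul_assoc)

lemma diag_op_add: "diag_op e (\<lambda>i. d i + d' i) = diag_op e d + diag_op e d'"
  by (simp add: diag_op_def flip: sum.distrib, rule sum.cong) (auto simp: vec_eq_iff algebra_simps)

lemma diag_op_const: "orthonormal_basis e \<Longrightarrow> diag_op e (\<lambda>i. r) = mat r"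
  by (rule orthonormal_basis_eqI) (auto simp: diag_op_basis mat_mult_vec)

lemma mat_adj_diag_op: "mat_adj (diag_op e d) = diag_op e (\<lambda>i. cnj (d i))"
  by (simp add: diag_op_def mat_adj_sum mat_adj_mult mat_mult_commute)

lemma trace_diag_op_mult: "trace (diag_op e d ** a) = (\<Sum>i\<in>UNIV. d i * cinner (a *v e i) (e i))"
proof -
  have "trace (mat (d i) ** ketbra (e i) (e i) ** a) = d i * cinner (a *v e i) (e i)" for i
    by (metis matrix_mul_assoc trace_mat_mult trace_mul_sym trace_mult_ketbra)
  then show ?thesis
    by (simp add: diag_op_def matrix_mult_sum_left trace_sum)
qed

lemma unital_subalgebra_mat: "unital_subalgebra S \<Longrightarrow> mat r \<in> S"
  unfolding unital_subalgebra_def by (metis matrix_mul_rid)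

text \<open>A function of \<open>h\<close> is a polynomial in \<open>h\<close>: on the finite spectrum every function is
  a combination of the Lagrange polynomials \<open>ind\<close>.\<close>

lemma diag_op_in_subalgebra:
  fixes f :: "real \<Rightarrow> complex" and l :: "'n::finite \<Rightarrow> real"
  assumes S: "unital_subalgebra S" and e: "orthonormal_basis e"
    and h: "diag_op e (\<lambda>i. of_real (l i)) \<in> S"
  shows "diag_op e (\<lambda>i. f (l i)) \<in> S"
proof -
  let ?D = "\<lambda>g. diag_op e (\<lambda>i. g (l i))"
  have add: "?D (\<lambda>t. g t + g' t) \<in> S" if "?D g \<in> S" "?D g' \<in> S" for g g' :: "real \<Rightarrow> complex"
    using S that by (simp add: diag_op_add unital_subalgebra_def)
  have mult: "?D (\<lambda>t. g t * g' t) \<in> S" if "?D g \<in> S" "?D g' \<in> S" for g g' :: "real \<Rightarrow> complex"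
    using S that e by (simp add: unital_subalgebra_def flip: diag_op_mult)
  have const: "?D (\<lambda>t. r) \<in> S" for r
    using unital_subalgebra_mat[OF S] e by (simp add: diag_op_const)
  have prod: "?D (\<lambda>t. \<Prod>\<nu>\<in>T. g \<nu> t) \<in> S" if "finite T" "\<And>\<nu>. ?D (g \<nu>) \<in> S" for T :: "real set" and g :: "real \<Rightarrow> real \<Rightarrow> complex"
    using that(1) by induct (auto simp: const intro!: mult that(2))
  have sum: "?D (\<lambda>t. \<Sum>\<nu>\<in>T. g \<nu> t) \<in> S" if "finite T" "\<And>\<nu>. ?D (g \<nu>) \<in> S" for T :: "real set" and g :: "real \<Rightarrow> real \<Rightarrow> complex"
    using that(1) by induct (auto simp: const intro!: add that(2))
  define ind where "ind \<mu> t = (\<Prod>\<nu>\<in>range l - {\<mu>}. (complex_of_real t + (- of_real \<nu>)) * (1 / of_real (\<mu> - \<nu>)))" for \<mu> t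
  have "?D (ind \<mu>) \<in> S" for \<mu>
    unfolding ind_def by (intro prod mult add const h) auto
  then have "?D (\<lambda>t. \<Sum>\<mu>\<in>range l. f \<mu> * ind \<mu> t) \<in> S"
    by (intro sum mult const) auto
  moreover have "(\<Sum>\<mu>\<in>range l. f \<mu> * ind \<mu> (l i)) = f (l i)" for i
  proof -
    have "ind \<mu> (l i) = (if \<mu> = l i then 1 else 0)" for \<mu>
      by (auto simp: ind_def intro!: prod.neutral)
    then show ?thesis by (simp add: if_distrib[of "\<lambda>x. _ * x"] cong: if_cong)
  qed
  ultimately show ?thesis by simp
qed

text \<open>This describes \<open>zm\<close> and \<open>zp\<close> as the spectral projections of \<open>h\<close> for
  the positive and for the nonnegative part of the spectrum. The last clause makes the maximality of
  \<open>zm\<close> quantitative: an effect pays at least \<open>\<delta>\<close> times the amount by which it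
  fails to be in the interval from \<open>zm\<close> to \<open>zp\<close>.\<close>

definition support_pair :: "complex ^ 'n ^ 'n \<Rightarrow> complex ^ 'n ^ 'n \<Rightarrow> complex ^ 'n ^ 'n \<Rightarrow> bool" where
  "support_pair h zm zp \<longleftrightarrow> projection zm \<and> projection zp \<and> zm ** zp = zm \<and>
     h ** zp = h ** zm \<and> zm ** h = h ** zm \<and> zp ** h = h ** zp \<and>
     (\<exists>\<delta>>0. \<forall>a\<in>effects. Re (trace (h ** a)) +
        \<delta> * (Re (trace (zm ** (mat 1 - a))) + Re (trace ((mat 1 - zp) ** a))) \<le> Re (trace (h ** zm)))"

text \<open>In an eigenbasis of \<open>h\<close> only the diagonal entries \<open>t i \<in> [0,1]\<close> of
  \<open>a\<close> matter for the trace of \<open>h ** a\<close>, which is \<open>\<Sum>i. l i * t i\<close>;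
  it is largest if \<open>t i\<close> is \<open>1\<close> where \<open>l i > 0\<close> and \<open>0\<close>
  where \<open>l i < 0\<close>.\<close>

theorem support_projections:
  fixes h :: "complex ^ 'n ^ 'n"
  assumes sa: "self_adjoint h"
  obtains zm zp where "support_pair h zm zp"
    "\<And>A. unital_subalgebra A \<Longrightarrow> h \<in> A \<Longrightarrow> zm \<in> A \<and> zp \<in> A"
proof -
  obtain e l where e: "orthonormal_basis e" and l: "\<And>i. h *v e i = of_real (l i) *s e i"
    using spectral_theorem[OF sa] by blast
  define pos nonneg where "pos t = (if t > 0 then 1 else 0 :: complex)"
    and "nonneg t = (if t \<ge> 0 then 1 else 0 :: complex)" for t :: real
  define zm zp where "zm = diag_op e (\<lambda>i. pos (l i))" and "zp = diag_op e (\<lambda>i. nonneg (l i))"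
  have h: "h = diag_op e (\<lambda>i. of_real (l i))"
    by (rule orthonormal_basis_eqI[OF e]) (simp add: l diag_op_basis[OF e])
  \<comment> \<open>the smallest nonzero modulus of an eigenvalue; the \<open>1\<close> is only there to cover \<open>h = 0\<close>\<close>
  define \<delta> where "\<delta> = Min (insert 1 ((\<lambda>i. \<bar>l i\<bar>) ` {i. l i \<noteq> 0}))"
  have \<delta>: "\<delta> > 0" unfolding \<delta>_def by (subst Min_gr_iff) auto
  have \<delta>_le: "\<delta> \<le> \<bar>l i\<bar>" if "l i \<noteq> 0" for i
    unfolding \<delta>_def using that by (intro Min_le) auto
  have one: "mat 1 = diag_op e (\<lambda>i. 1)" by (simp add: diag_op_const[OF e])
  have "support_pair h zm zp"
    unfolding support_pair_def
  proof (intro conjI exI[of _ \<delta>] ballI)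
    show "projection zm" "projection zp"
      by (simp_all add: projection_def self_adjoint_def zm_def zp_def mat_adj_diag_op diag_op_mult[OF e] pos_def nonneg_def
          if_distrib cong: if_cong)
    show "zm ** zp = zm"
      unfolding zm_def zp_def diag_op_mult[OF e] by (rule arg_cong[of _ _ "diag_op e"]) (auto simp: pos_def nonneg_def)
    show "h ** zp = h ** zm"
      unfolding h zm_def zp_def diag_op_mult[OF e] by (rule arg_cong[of _ _ "diag_op e"]) (auto simp: pos_def nonneg_def)
    show "zm ** h = h ** zm" "zp ** h = h ** zp"
      unfolding h zm_def zp_def diag_op_mult[OF e] by (simp_all add: mult.commute)
    show "\<delta> > 0" by fact
    fix a :: "complex ^ 'n ^ 'n" assume a: "a \<in> effects"
    define t where "t i = Re (cinner (a *v e i) (e i))" for i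
    have t0: "0 \<le> t i" for i using a by (simp add: effects_iff positive_op_def t_def)
    have "0 \<le> Re (cinner ((mat 1 - a) *v e i) (e i))" for i
      using a by (simp add: effects_iff positive_op_def)
    moreover have ee: "cinner (e i) (e i) = 1" for i using e by (simp add: orthonormal_basis_def)
    ultimately have t1: "t i \<le> 1" for i
      by (simp add: t_def matrix_vector_mult_diff_rdistrib cinner_diff_left)
    have 1: "Re (trace (h ** a)) = (\<Sum>i\<in>UNIV. l i * t i)"
      unfolding h trace_diag_op_mult by (simp add: t_def)
    have 2: "Re (trace (zm ** (mat 1 - a))) = (\<Sum>i\<in>UNIV. (if l i > 0 then 1 - t i else 0))"
      unfolding zm_def trace_diag_op_mult Re_sum
      by (intro sum.cong) (auto simp: pos_def matrix_vector_mult_diff_rdistrib cinner_diff_left t_def ee)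
    have 3: "Re (trace ((mat 1 - zp) ** a)) = (\<Sum>i\<in>UNIV. (if l i < 0 then t i else 0))"
      unfolding zp_def matrix_sub_rdistrib matrix_mul_lid trace_sub trace_diag_op_mult trace_orthonormal_basis[OF e, of a]
      by (simp add: sum_subtractf[symmetric], rule sum.cong) (auto simp: nonneg_def t_def)
    have 4: "Re (trace (h ** zm)) = (\<Sum>i\<in>UNIV. if l i > 0 then l i else 0)"
      unfolding h trace_diag_op_mult zm_def diag_op_basis[OF e] Re_sum
      by (intro sum.cong) (auto simp: pos_def cinner_scale_left ee)
    have "l i * t i + \<delta> * ((if l i > 0 then 1 - t i else 0) + (if l i < 0 then t i else 0)) \<le> (if l i > 0 then l i else 0)" for i
    proof -
      consider "l i > 0" | "l i = 0" | "l i < 0" by linarith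
      then show ?thesis
      proof cases
        case 1
        with \<delta>_le[of i] t1[of i] have "\<delta> * (1 - t i) \<le> l i * (1 - t i)" by (intro mult_right_mono) auto
        with 1 show ?thesis by (simp add: algebra_simps)
      next
        case 3
        with \<delta>_le[of i] t0[of i] have "\<delta> * t i \<le> - l i * t i" by (intro mult_right_mono) auto
        with 3 show ?thesis by simp
      qed simp
    qed
    then show "Re (trace (h ** a)) + \<delta> * (Re (trace (zm ** (mat 1 - a))) + Re (trace ((mat 1 - zp) ** a)))
            \<le> Re (trace (h ** zm))"
      unfolding 1 2 3 4 sum.distrib[symmetric] sum_distrib_left by (rule sum_mono)
  qed
  moreover have "zm \<in> A \<and> zp \<in> A" if "unital_subalgebra A" "h \<in> A" for A
    using that diag_op_in_subalgebra[OF that(1) e] unfolding h zm_def zp_def by blast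
  ultimately show thesis by (rule that)
qed

text \<open>
  At a maximizer both penalty terms vanish, which says that \<open>a\<close> is the identity on \<open>zm\<close> and zero on
  \<open>1 - zp\<close>.  Conversely such an \<open>a\<close> differs from \<open>zm\<close> only on \<open>zp - zm\<close>, where \<open>h\<close> is zero.\<close>

lemma
  assumes "support_pair h zm zp"
  shows support_pair_maximizers: "op_interval zm zp = {a \<in> effects. Re (trace (h ** a)) = Re (trace (h ** zm))}"
    and support_pair_max: "a \<in> effects \<Longrightarrow> Re (trace (h ** a)) \<le> Re (trace (h ** zm))"
proof -
  have z: "projection zm" "projection zp" "zm ** zp = zm" and h: "h ** zp = h ** zm"
    using assms by (simp_all add: support_pair_def)
  obtain \<delta> :: real where \<delta>: "\<delta> > 0"
    and bound: "\<And>a. a \<in> effects \<Longrightarrow> Re (trace (h ** a)) +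
        \<delta> * (Re (trace (zm ** (mat 1 - a))) + Re (trace ((mat 1 - zp) ** a))) \<le> Re (trace (h ** zm))"
    using assms unfolding support_pair_def by blast
  note iff = op_interval_projections_iff[OF z]
  have nn: "0 \<le> Re (trace (zm ** (mat 1 - a)))" "0 \<le> Re (trace ((mat 1 - zp) ** a))" if "a \<in> effects" for a
    using that z projection_complement[OF z(2)] by (auto intro!: trace_projection_effect_nonneg simp: effects_iff)
  show "Re (trace (h ** a)) \<le> Re (trace (h ** zm))" if "a \<in> effects"
  proof -
    have "0 \<le> \<delta> * (Re (trace (zm ** (mat 1 - a))) + Re (trace ((mat 1 - zp) ** a)))"
      using nn[OF that] \<delta> by simp
    with bound[OF that] show ?thesis by linarith
  qed
  have "a ** zm = zm \<and> a ** zp = a" if "a \<in> effects" "Re (trace (h ** a)) = Re (trace (h ** zm))" for a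
  proof -
    have "\<delta> * (Re (trace (zm ** (mat 1 - a))) + Re (trace ((mat 1 - zp) ** a))) \<le> 0"
      using bound[OF that(1)] that(2) by linarith
    then have "Re (trace (zm ** (mat 1 - a))) + Re (trace ((mat 1 - zp) ** a)) \<le> 0"
      using \<delta> by (simp add: mult_le_0_iff)
    then have "Re (trace (zm ** (mat 1 - a))) = 0" "Re (trace ((mat 1 - zp) ** a)) = 0"
      using nn[OF that(1)] by linarith+
    then have "(mat 1 - a) ** zm = 0" "a ** (mat 1 - zp) = 0"
      using trace_projection_effect_zero(1)[OF z(1)] trace_projection_effect_zero(1)[OF projection_complement[OF z(2)]] that(1)
      by (simp_all add: effects_iff)
    then show ?thesis by (simp add: matrix_distribs)
  qed
  moreover have "Re (trace (h ** a)) = Re (trace (h ** zm))" if "a \<in> op_interval zm zp" for a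
  proof -
    have a: "a ** zm = zm" "a ** zp = a" "mat_adj a = a" "mat_adj zp = zp"
      using that z by (auto simp: iff effects_iff positive_op_def self_adjoint_def projection_def)
    then have "zp ** a = a" using mat_adj_mult_eqD[OF a(2)] a by simp
    then have "h ** a = h ** zp ** a" by (simp flip: matrix_mul_assoc)
    also have "trace \<dots> = trace (h ** zm)"
    proof -
      have "zm ** a = zm"
        using mat_adj_mult_eqD[OF a(1)] a z by (simp add: projection_def self_adjoint_def)
      then show ?thesis by (simp add: h flip: matrix_mul_assoc)
    qed
    finally show ?thesis by simp
  qed
  ultimately show "op_interval zm zp = {a \<in> effects. Re (trace (h ** a)) = Re (trace (h ** zm))}"
    using iff by blast
qed

text \<open>On \<open>zm\<close> and on \<open>1 - zp\<close> the operator \<open>a\<close> is a scalar, and on the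
  remaining piece \<open>h\<close> is zero.\<close>

lemma support_pair_commute:
  assumes "support_pair h zm zp" and a: "a \<in> op_interval zm zp"
  shows "a ** h = h ** a"
proof -
  have z: "projection zm" "projection zp" "zm ** zp = zm"
    and h: "h ** zp = h ** zm" "zm ** h = h ** zm" "zp ** h = h ** zp"
    using assms(1) by (simp_all add: support_pair_def)
  have a: "a ** zm = zm" "a ** zp = a" "mat_adj a = a" "mat_adj zp = zp" "mat_adj zm = zm"
    using a z by (auto simp: op_interval_projections_iff[OF z] effects_iff positive_op_def self_adjoint_def projection_def)
  have *: "zp ** a = a" "zm ** a = zm"
    using mat_adj_mult_eqD[OF a(2)] mat_adj_mult_eqD[OF a(1)] a by simp_all
  have "h ** a = h ** zp ** a" by (simp add: * flip: matrix_mul_assoc)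
  also have "\<dots> = h ** zm" by (simp add: h(1) *, simp add: * flip: matrix_mul_assoc)
  also have "\<dots> = a ** (zm ** h)" by (simp add: matrix_mul_assoc a(1) flip: h(2))
  also have "\<dots> = a ** (zp ** h)" by (simp add: h)
  also have "\<dots> = a ** h" by (simp add: a matrix_mul_assoc)
  finally show ?thesis by simp
qed

section \<open>The effects form a compact convex set\<close>

lemma matrix_vector_minus: "(- A) *v x = - (A *v x)" for A :: "'a::comm_ring_1 ^ 'n ^ 'm"
  using matrix_vector_mult_diff_rdistrib[of 0 A x] by simp

lemma cinner_minus_left: "cinner (- x) y = - cinner x y"
  using cinner_diff_left[of 0 x y] by simp

lemma extreme_point_symmetric_segment:
  fixes x :: "'a::real_vector"
  assumes "x extreme_point_of S" "x + d \<in> S" "x - d \<in> S"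
  shows "d = 0"
proof (rule ccontr)
  assume d: "d \<noteq> 0"
  have "x - d \<noteq> x + d"
  proof
    assume "x - d = x + d"
    then have "2 *\<^sub>R d = 0" by (simp add: scaleR_2 algebra_simps add_eq_0_iff)
    with d show False by simp
  qed
  then have "midpoint (x - d) (x + d) \<in> open_segment (x - d) (x + d)" by simp
  moreover have "midpoint (x - d) (x + d) = x"
    by (simp add: midpoint_def scaleR_2[symmetric])
  ultimately show False using assms by (auto simp: extreme_point_of_def)
qed

lemma continuous_quadratic_form: "continuous_on UNIV (\<lambda>a. Re (cinner (a *v x) x))"
  unfolding cinner_def matrix_vector_mult_def by (intro continuous_intros)

lemma linear_mat_adj: "linear mat_adj"
  by (rule linearI) (simp_all add: mat_adj_def vec_eq_iff)

lemma linear_trace_mult: "linear (\<lambda>a. trace (c ** a))" for c :: "complex ^ 'n ^ 'n"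
  by (rule linearI) (simp_all add: matrix_add_ldistrib trace_add scaleR_matrix mat_mult_left_commute trace_mat_mult scaleR_conv_of_real)

lemma linear_trace: "linear (trace :: complex ^ 'n ^ 'n \<Rightarrow> complex)"
  using linear_trace_mult[of "mat 1"] by simp

lemma linear_continuous: "linear f \<Longrightarrow> continuous_on S f"
  for f :: "'a::euclidean_space \<Rightarrow> 'b::real_normed_vector"
  by (simp add: linear_continuous_on linear_conv_bounded_linear)

lemma linear_closed_vimage: "linear f \<Longrightarrow> closed S \<Longrightarrow> closed (f -` S)"
  for f :: "'a::euclidean_space \<Rightarrow> 'b::real_normed_vector"
  by (simp add: continuous_closed_vimage linear_continuous_at linear_conv_bounded_linear)

lemma norm_matrix_trace: "(norm a)\<^sup>2 = Re (trace (a ** mat_adj a))"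
  by (simp add: power2_norm_eq_inner inner_vec_def trace_def matrix_matrix_mult_def mat_adj_def inner_complex_def)

lemma positive_op_scaleR: "positive_op a \<Longrightarrow> 0 \<le> r \<Longrightarrow> positive_op (r *\<^sub>R a)"
  using linear_scale[OF linear_mat_adj, of r a]
  by (simp add: positive_op_def self_adjoint_def scaleR_matrix mat_mult_vec cinner_scale_left flip: matrix_vector_mul_assoc)

lemma convex_positive_op: "convex (Collect positive_op)"
  unfolding convex_def
proof safe
  fix a b :: "complex ^ 'n ^ 'n" and u v :: real
  assume ab: "positive_op a" "positive_op b" and uv: "0 \<le> u" "0 \<le> v"
  show "positive_op (u *\<^sub>R a + v *\<^sub>R b)"
    by (intro positive_op_add positive_op_scaleR ab uv)
qed

lemma convex_effects: "convex (effects :: (complex ^ 'n ^ 'n) set)"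
proof -
  have "effects = Collect positive_op \<inter> (\<lambda>a. mat 1 - a) -` Collect (positive_op :: complex ^ 'n ^ 'n \<Rightarrow> bool)"
    by (auto simp: effects_iff)
  moreover have "(\<lambda>a. mat 1 - a) -` Collect positive_op = (\<lambda>b. mat 1 - b) ` Collect (positive_op :: complex ^ 'n ^ 'n \<Rightarrow> bool)"
    by (auto intro!: image_eqI[of _ _ "mat 1 - _"])
  moreover have "(\<lambda>b. mat 1 - b) ` S = (+) (mat 1) ` uminus ` S" for S :: "(complex ^ 'n ^ 'n) set"
    by (auto simp: image_image)
  ultimately show ?thesis
    by (simp add: convex_Int convex_positive_op convex_negations convex_translation)
qed

lemma closed_positive_op: "closed (Collect (positive_op :: complex ^ 'n ^ 'n \<Rightarrow> bool))"
proof -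
  have "Collect (positive_op :: complex ^ 'n ^ 'n \<Rightarrow> bool) = {a. mat_adj a = a} \<inter> (\<Inter>x. {a. 0 \<le> Re (cinner (a *v x) x)})"
    by (auto simp: positive_op_def self_adjoint_def)
  moreover have "closed \<dots>"
    by (intro closed_Int closed_INT ballI closed_Collect_eq closed_Collect_le continuous_quadratic_form
        continuous_on_const continuous_on_id linear_continuous linear_mat_adj)
  ultimately show ?thesis by simp
qed

lemma effect_eigenvalues:
  assumes a: "a \<in> effects" and e: "orthonormal_basis e" and l: "\<And>i. a *v e i = of_real (l i) *s e i"
  shows "0 \<le> l i" "l i \<le> 1"
proof -
  show "0 \<le> l i" using positive_op_eigen[OF _ e l] a by (simp add: effects_iff)
  have "(mat 1 - a) *v e i = of_real (1 - l i) *s e i" for i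
    by (simp add: matrix_vector_mult_diff_rdistrib l vec_eq_iff algebra_simps)
  then show "l i \<le> 1" using positive_op_eigen[OF _ e, of "mat 1 - a" "\<lambda>i. 1 - l i" i] a by (simp add: effects_iff)
qed

lemma compact_effects: "compact (effects :: (complex ^ 'n ^ 'n) set)"
proof -
  have "effects = Collect positive_op \<inter> (\<lambda>a. mat 1 - a) -` Collect (positive_op :: complex ^ 'n ^ 'n \<Rightarrow> bool)"
    by (auto simp: effects_iff)
  moreover have "closed ((\<lambda>a. mat 1 - a) -` Collect (positive_op :: complex ^ 'n ^ 'n \<Rightarrow> bool))"
    by (intro continuous_closed_vimage closed_positive_op) (auto intro!: continuous_intros)
  ultimately have "closed (effects :: (complex ^ 'n ^ 'n) set)"
    using closed_positive_op by auto
  moreover have "norm a \<le> sqrt (real CARD('n))" if a: "a \<in> effects" for a :: "complex ^ 'n ^ 'n"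
  proof -
    have sa: "self_adjoint a" using a by (simp add: effects_iff positive_op_def)
    then obtain e l where e: "orthonormal_basis e" and l: "\<And>i. a *v e i = of_real (l i) *s e i"
      using spectral_theorem by blast
    have "(norm a)\<^sup>2 = (\<Sum>i\<in>UNIV. l i * l i)"
      using sa e unfolding norm_matrix_trace self_adjoint_def
      by (simp add: trace_orthonormal_basis[OF e] l vector_scalar_commute cinner_scale_left orthonormal_basis_def
          flip: matrix_vector_mul_assoc)
    also have "\<dots> \<le> (\<Sum>i\<in>(UNIV::'n set). 1)"
      using effect_eigenvalues[OF a e l] by (intro sum_mono mult_le_one) auto
    finally show ?thesis by (simp add: real_le_rsqrt)
  qed
  ultimately show ?thesis by (auto simp: compact_eq_bounded_closed bounded_iff)
qed

lemma effects_trace_real: "a \<in> effects \<Longrightarrow> trace a = of_real (Re (trace a))"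
  by (metis Reals_cnj_iff effects_iff of_real_Re positive_op_def self_adjoint_def trace_mat_adj)

section \<open>The numerical range as a set of traces\<close>

lemma sum_ketbra_projection:
  assumes "finite S" "\<And>i j. i \<in> S \<Longrightarrow> j \<in> S \<Longrightarrow> cinner (x i) (x j) = (if i = j then 1 else 0)"
  shows "projection (\<Sum>i\<in>S. ketbra (x i) (x i))"
proof -
  have "(\<Sum>i\<in>S. ketbra (x i) (x i)) ** (\<Sum>i\<in>S. ketbra (x i) (x i)) = (\<Sum>i\<in>S. \<Sum>j\<in>S. ketbra (x j) (x j) ** ketbra (x i) (x i))"
    by (simp add: matrix_mult_sum_left matrix_mult_sum_right)
  also have "\<dots> = (\<Sum>i\<in>S. \<Sum>j\<in>S. if i = j then ketbra (x i) (x i) else 0)"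
    using assms(2) by (intro sum.cong) (auto simp: mult_ketbra ketbra_vec, auto simp: ketbra_def vec_eq_iff)
  also have "\<dots> = (\<Sum>i\<in>S. ketbra (x i) (x i))" using assms(1) by simp
  finally show ?thesis by (simp add: projection_def self_adjoint_def mat_adj_sum)
qed

text \<open>The self-adjoint operators of trace zero on the span of two eigenvectors form a real space of dimension
  three, while \<open>trace (c ** d) = 0\<close> is two real conditions, so a nonzero \<open>d\<close>
  satisfies them. A small multiple of it can be added and subtracted, as the two eigenvalues are strictly
  between \<open>0\<close> and \<open>1\<close>.\<close>

lemma two_eigenvalues_perturbation:
  fixes c :: "complex ^ 'n ^ 'n"
  assumes a: "a \<in> effects" and e: "orthonormal_basis e" and l: "\<And>i. a *v e i = of_real (l i) *s e i"
    and ij: "i \<noteq> j" and li: "0 < l i" "l i < 1" and lj: "0 < l j" "l j < 1"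
  obtains d where "d \<noteq> 0" "trace d = 0" "trace (c ** d) = 0" "a + d \<in> effects" "a - d \<in> effects"
proof -
  \<comment> \<open>the three real parameters: one real diagonal and one complex off-diagonal entry\<close>
  define D where "D p = fst p *\<^sub>R (ketbra (e i) (e i) - ketbra (e j) (e j))
      + (mat (snd p) ** ketbra (e i) (e j) + mat (cnj (snd p)) ** ketbra (e j) (e i))" for p :: "real \<times> complex"
  have linD: "linear D"
    by (rule linearI) (auto simp: D_def algebra_simps vec_eq_iff scaleR_conv_of_real[of _ "_::complex"])
  have lin: "linear (\<lambda>p. trace (c ** D p))"
    using linear_compose[OF linD linear_trace_mult[of c]] by (simp add: o_def)
  have "\<not> inj (\<lambda>p. trace (c ** D p))"
  proof
    assume "inj (\<lambda>p. trace (c ** D p))"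
    then have "dim (range (\<lambda>p. trace (c ** D p))) = dim (UNIV :: (real \<times> complex) set)"
      using dim_image_eq[OF lin, of UNIV] by simp
    moreover have "dim (range (\<lambda>p. trace (c ** D p))) \<le> DIM(complex)" by (rule dim_subset_UNIV)
    ultimately show False by simp
  qed
  then obtain p where p: "p \<noteq> 0" "trace (c ** D p) = 0"
    using linear_injective_0[OF lin] by blast
  obtain u v where uv: "p = (u, v)" by force
  have on: "cinner (e a) (e b) = (if a = b then 1 else 0)" for a b using e by (simp add: orthonormal_basis_def)
  have tr: "trace (D p) = 0"
    using ij by (simp add: D_def uv trace_add trace_sub trace_mat_mult trace_ketbra on scaleR_matrix)
  have "D p *v e i = of_real u *s e i + cnj v *s e j"
    using ij by (simp add: D_def uv matrix_vector_mult_add_rdistrib matrix_vector_mult_diff_rdistrib ketbra_vec on scaleR_matrix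
        mat_mult_vec vector_scalar_mult_def vec_eq_iff flip: matrix_vector_mul_assoc)
  then have "cinner (D p *v e i) (e i) = of_real u" "cinner (D p *v e i) (e j) = cnj v"
    using ij by (simp_all add: cinner_add_left cinner_scale_left on)
  then have D0: "D p \<noteq> 0" using p(1) by (auto simp: uv zero_prod_def)
  have Dsa: "mat_adj (D p) = D p"
    by (simp add: D_def mat_adj_add mat_adj_diff mat_adj_mult mat_mult_commute scaleR_matrix)
  define w where "w x = (norm (cinner x (e i)))\<^sup>2 + (norm (cinner x (e j)))\<^sup>2" for x
  have w0: "0 \<le> w x" for x by (simp add: w_def)
  \<comment> \<open>the perturbation sees only the components of \<open>x\<close> along \<open>e i\<close> and \<open>e j\<close>, whose weight is \<open>w x\<close>\<close>
  have bound: "\<bar>Re (cinner (D p *v x) x)\<bar> \<le> (\<bar>u\<bar> + norm v) * w x" for x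
  proof -
    define y z where "y = cinner x (e i)" and "z = cinner x (e j)"
    have cx: "cinner (e i) x = cnj y" "cinner (e j) x = cnj z"
      by (simp_all add: y_def z_def flip: cinner_commute)
    have "cinner (D p *v x) x = of_real u * (y * cnj y - z * cnj z) + (v * (z * cnj y) + cnj v * (y * cnj z))"
      by (simp add: D_def uv matrix_vector_mult_add_rdistrib matrix_vector_mult_diff_rdistrib ketbra_vec scaleR_matrix
          mat_mult_vec cinner_add_left cinner_diff_left cinner_scale_left cx algebra_simps flip: matrix_vector_mul_assoc y_def z_def)
    also have "\<dots> = of_real (u * ((norm y)\<^sup>2 - (norm z)\<^sup>2)) + (v * (z * cnj y) + cnj (v * (z * cnj y)))"
      by (simp flip: complex_norm_square)
    also have "Re \<dots> = u * ((norm y)\<^sup>2 - (norm z)\<^sup>2) + 2 * Re (v * (z * cnj y))" by (simp add: algebra_simps)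
    finally have eq: "Re (cinner (D p *v x) x) = u * ((norm y)\<^sup>2 - (norm z)\<^sup>2) + 2 * Re (v * (z * cnj y))" .
    have "\<bar>Re (cinner (D p *v x) x)\<bar> \<le> \<bar>u * ((norm y)\<^sup>2 - (norm z)\<^sup>2)\<bar> + 2 * \<bar>Re (v * (z * cnj y))\<bar>"
      unfolding eq by linarith
    moreover have "\<bar>u * ((norm y)\<^sup>2 - (norm z)\<^sup>2)\<bar> \<le> \<bar>u\<bar> * w x"
    proof -
      have "\<bar>(norm y)\<^sup>2 - (norm z)\<^sup>2\<bar> \<le> w x"
        using zero_le_power2[of "norm y"] zero_le_power2[of "norm z"]
        unfolding w_def y_def[symmetric] z_def[symmetric] by linarith
      then show ?thesis unfolding abs_mult by (intro mult_left_mono) auto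
    qed
    moreover have "2 * \<bar>Re (v * (z * cnj y))\<bar> \<le> norm v * w x"
    proof -
      have "2 * \<bar>Re (v * (z * cnj y))\<bar> \<le> 2 * norm (v * (z * cnj y))"
        using abs_Re_le_cmod by (metis mult_left_mono zero_le_numeral)
      also have "\<dots> = norm v * (2 * norm y * norm z)" by (simp add: norm_mult)
      also have "\<dots> \<le> norm v * w x"
        using sum_squares_bound[of "norm y" "norm z"] by (intro mult_left_mono) (simp_all add: w_def y_def z_def)
      finally show ?thesis .
    qed
    ultimately show ?thesis by (simp add: distrib_right)
  qed
  define \<mu> where "\<mu> = min (min (l i) (l j)) (min (1 - l i) (1 - l j))"
  define \<epsilon> where "\<epsilon> = \<mu> / (\<bar>u\<bar> + norm v + 1)"
  have \<mu>: "\<mu> > 0" using li lj by (simp add: \<mu>_def)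
  have pos: "\<bar>u\<bar> + norm v + 1 > 0" using norm_ge_zero[of v] by linarith
  have \<epsilon>: "\<epsilon> > 0" using \<mu> pos by (simp add: \<epsilon>_def)
  have \<epsilon>\<mu>: "\<epsilon> * (\<bar>u\<bar> + norm v) \<le> \<mu>"
  proof -
    have "\<epsilon> * (\<bar>u\<bar> + norm v) \<le> \<epsilon> * (\<bar>u\<bar> + norm v + 1)" using \<epsilon> by simp
    also have "\<dots> = \<mu>" using pos by (simp add: \<epsilon>_def)
    finally show ?thesis .
  qed
  have small: "\<bar>Re (cinner ((\<epsilon> *\<^sub>R D p) *v x) x)\<bar> \<le> \<mu> * w x" for x
  proof -
    have "\<bar>Re (cinner ((\<epsilon> *\<^sub>R D p) *v x) x)\<bar> = \<epsilon> * \<bar>Re (cinner (D p *v x) x)\<bar>"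
      using \<epsilon> by (simp add: scaleR_matrix mat_mult_vec cinner_scale_left abs_mult flip: matrix_vector_mul_assoc)
    also have "\<dots> \<le> \<epsilon> * ((\<bar>u\<bar> + norm v) * w x)" using bound \<epsilon> by simp
    also have "\<dots> \<le> \<mu> * w x" using mult_right_mono[OF \<epsilon>\<mu> w0[of x]] by (simp add: mult.assoc)
    finally show ?thesis .
  qed
  have big: "\<mu> * w x \<le> Re (cinner (g *v x) x)"
    if "\<And>k. g *v e k = of_real (m k) *s e k" "\<And>k. 0 \<le> m k" "\<mu> \<le> m i" "\<mu> \<le> m j" for g m x
  proof -
    have "\<mu> * w x \<le> m i * (norm (cinner x (e i)))\<^sup>2 + m j * (norm (cinner x (e j)))\<^sup>2"
      unfolding w_def distrib_left using that by (intro add_mono mult_right_mono) auto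
    also have "\<dots> = (\<Sum>k\<in>{i,j}. m k * (norm (cinner x (e k)))\<^sup>2)" using ij by simp
    also have "\<dots> \<le> (\<Sum>k\<in>UNIV. m k * (norm (cinner x (e k)))\<^sup>2)"
      using that by (intro sum_mono2) auto
    also have "\<dots> = Re (cinner (g *v x) x)" by (simp add: quadratic_form_eigen[OF e that(1)])
    finally show ?thesis .
  qed
  have sa: "mat_adj a = a" using a by (simp add: effects_iff positive_op_def self_adjoint_def)
  have l01: "0 \<le> l k" "l k \<le> 1" for k using effect_eigenvalues[OF a e l] by auto
  have 1: "\<mu> * w x \<le> Re (cinner (a *v x) x)" for x
    by (rule big[OF l]) (auto simp: l01 \<mu>_def)
  have "(mat 1 - a) *v e k = of_real (1 - l k) *s e k" for k
    by (simp add: matrix_vector_mult_diff_rdistrib l vec_eq_iff algebra_simps)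
  then have 2: "\<mu> * w x \<le> Re (cinner ((mat 1 - a) *v x) x)" for x
    by (rule big) (auto simp: l01 \<mu>_def)
  let ?d = "\<epsilon> *\<^sub>R D p"
  have dsa: "mat_adj ?d = ?d" using Dsa by (simp add: linear_scale[OF linear_mat_adj])
  show thesis
  proof
    show "?d \<noteq> 0" using D0 \<epsilon> by simp
    show "trace ?d = 0" "trace (c ** ?d) = 0"
      using tr p by (simp_all add: linear_scale[OF linear_trace] linear_scale[OF linear_trace_mult])
    have *: "positive_op (g + s *\<^sub>R ?d)" if "mat_adj g = g" "\<And>x. \<mu> * w x \<le> Re (cinner (g *v x) x)" "s = 1 \<or> s = -1" for g s
    proof -
      have "0 \<le> Re (cinner ((g + s *\<^sub>R ?d) *v x) x)" for x
        using that(2)[of x] that(3) small[of x]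
        by (auto simp: matrix_vector_mult_add_rdistrib matrix_vector_minus cinner_add_left cinner_minus_left)
      then show ?thesis
        using that(1,3) dsa linear_neg[OF linear_mat_adj, of ?d]
        by (auto simp: positive_op_def self_adjoint_def mat_adj_add mat_adj_diff)
    qed
    show "a + ?d \<in> effects" "a - ?d \<in> effects"
      using *[OF sa 1, of 1] *[OF sa 1, of "-1"] *[OF _ 2, of 1] *[OF _ 2, of "-1"] sa
      by (simp_all add: effects_iff mat_adj_diff algebra_simps)
  qed
qed

text \<open>A \<open>k\<close>-tuple of orthonormal vectors is the same as a projection of rank \<open>k\<close>, so the
  claim is that effects of trace \<open>k\<close> give no new values. The effects with the given two traces
  form a compact convex set; at an extreme point of it at most one eigenvalue is fractional, by the previous
  lemma, and then none is, since the trace is an integer. The right-hand side is visibly compact and convex in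
  \<open>z\<close>, which is how the convexity of the \<open>k\<close>-numerical range is obtained.\<close>

theorem k_numerical_range_iff:
  fixes c :: "complex ^ 'n ^ 'n"
  assumes k: "0 < k"
  shows "z \<in> k_numerical_range k c \<longleftrightarrow>
    (\<exists>a\<in>effects. trace a = of_nat k \<and> trace (c ** a) = of_nat k * z)"
proof
  assume "z \<in> k_numerical_range k c"
  then obtain x where z: "z = (\<Sum>i=1..k. cinner (c *v x i) (x i)) / of_nat k"
    and x: "\<forall>i\<in>{1..k}. \<forall>j\<in>{1..k}. cinner (x i) (x j) = (if i = j then 1 else 0)"
    unfolding k_numerical_range_def by blast
  let ?a = "\<Sum>i=1..k. ketbra (x i) (x i)"
  have "?a \<in> effects" using x by (intro projection_effect sum_ketbra_projection) auto
  moreover have "trace ?a = of_nat k"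
    using x by (simp add: trace_sum trace_ketbra)
  moreover have "trace (c ** ?a) = of_nat k * z"
    using k by (simp add: z matrix_mult_sum_right trace_sum trace_mult_ketbra)
  ultimately show "\<exists>a\<in>effects. trace a = of_nat k \<and> trace (c ** a) = of_nat k * z" by blast
next
  assume "\<exists>a\<in>effects. trace a = of_nat k \<and> trace (c ** a) = of_nat k * z"
  define G where "G = effects \<inter> (trace -` {of_nat k} \<inter> (\<lambda>a. trace (c ** a)) -` {of_nat k * z})"
  have "G \<noteq> {}" using \<open>\<exists>a\<in>effects. _\<close> by (auto simp: G_def)
  moreover have "convex G"
    unfolding G_def by (intro convex_Int convex_effects convex_linear_vimage linear_trace linear_trace_mult) auto
  moreover have "compact G"
    unfolding G_def by (intro compact_Int_closed compact_effects closed_Int linear_closed_vimage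
        linear_trace linear_trace_mult closed_singleton)
  ultimately obtain a where ext: "a extreme_point_of G"
    using extreme_point_exists_convex by blast
  then have "a \<in> G" by (simp add: extreme_point_of_def)
  then have a: "a \<in> effects" and tr: "trace a = of_nat k" "trace (c ** a) = of_nat k * z" by (auto simp: G_def)
  have "self_adjoint a" using a by (simp add: effects_iff positive_op_def)
  then obtain e l where e: "orthonormal_basis e" and l: "\<And>i. a *v e i = of_real (l i) *s e i"
    using spectral_theorem by blast
  have on: "cinner (e i) (e j) = (if i = j then 1 else 0)" for i j using e by (simp add: orthonormal_basis_def)
  have l01: "0 \<le> l i" "l i \<le> 1" for i using effect_eigenvalues[OF a e l] by auto
  have one: "i = j" if "0 < l i" "l i < 1" "0 < l j" "l j < 1" for i j
  proof (rule ccontr)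
    assume "i \<noteq> j"
    from two_eigenvalues_perturbation[OF a e l this that, of c] obtain d where
      "d \<noteq> 0" "trace d = 0" "trace (c ** d) = 0" "a + d \<in> effects" "a - d \<in> effects" .
    moreover from this have "a + d \<in> G" "a - d \<in> G"
      using tr by (auto simp: G_def trace_add trace_sub matrix_distribs)
    ultimately show False using extreme_point_symmetric_segment[OF ext] by blast
  qed
  have suml: "(\<Sum>i\<in>UNIV. l i) = real k"
  proof -
    have "of_real (\<Sum>i\<in>UNIV. l i) = trace a"
      by (simp add: trace_orthonormal_basis[OF e] l cinner_scale_left on)
    with tr(1) show ?thesis by (metis of_real_eq_iff of_real_of_nat_eq)
  qed
  define J where "J = {i. l i = 1}"
  have l_cases: "l i = 0 \<or> l i = 1" for i
  proof (rule ccontr)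
    assume *: "\<not> (l i = 0 \<or> l i = 1)"
    then have i: "0 < l i" "l i < 1" using l01[of i] by auto
    have "l j = (if j \<in> J then 1 else 0)" if "j \<noteq> i" for j
      using one[OF i, of j] that l01[of j] unfolding J_def by (cases "l j = 0"; cases "l j = 1") auto
    then have "(\<Sum>j\<in>UNIV - {i}. l j) = (\<Sum>j\<in>UNIV - {i}. if j \<in> J then 1 else 0)" by (intro sum.cong) auto
    also have "\<dots> = real (card ((UNIV - {i}) \<inter> J))" by (simp add: sum.If_cases)
    finally have "real k = l i + real (card ((UNIV - {i}) \<inter> J))"
      using suml sum.remove[of UNIV i l] by simp
    then have "l i = of_int (int k - int (card ((UNIV - {i}) \<inter> J)))" by simp
    then obtain m :: int where "l i = of_int m" by blast
    with i show False by simp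
  qed
  then have lJ: "l i = (if i \<in> J then 1 else 0)" for i by (auto simp: J_def)
  have "card J = k"
    using suml by (simp add: lJ sum.If_cases)
  then obtain f where f: "bij_betw f {1..k} J"
    using finite_same_card_bij[of "{1..k}" J] by auto
  have "(\<Sum>i=1..k. cinner (c *v e (f i)) (e (f i))) = (\<Sum>j\<in>J. cinner (c *v e j) (e j))"
    by (rule sum.reindex_bij_betw[OF f])
  also have "\<dots> = (\<Sum>j\<in>UNIV. of_real (l j) * cinner (c *v e j) (e j))"
    by (rule sum.mono_neutral_cong_left) (auto simp: lJ)
  also have "\<dots> = trace (c ** a)"
    by (simp add: trace_orthonormal_basis[OF e] l vector_scalar_commute cinner_scale_left flip: matrix_vector_mul_assoc)
  finally have "(\<Sum>i=1..k. cinner (c *v e (f i)) (e (f i))) = of_nat k * z"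
    unfolding tr(2) .
  then have "z = (\<Sum>i=1..k. cinner (c *v e (f i)) (e (f i))) / of_nat k" using k by simp
  moreover have "cinner (e (f i)) (e (f j)) = (if i = j then 1 else 0)" if "i \<in> {1..k}" "j \<in> {1..k}" for i j
    using inj_onD[OF bij_betw_imp_inj_on[OF f] _ that] by (auto simp: on)
  ultimately show "z \<in> k_numerical_range k c"
    unfolding k_numerical_range_def mem_Collect_eq by (intro exI[of _ "\<lambda>i. e (f i)"]) blast
qed

section \<open>Faces of the spectral scale with two planes of support\<close>

lemma effects_self_adjoint: "a \<in> effects \<Longrightarrow> self_adjoint a"
  by (simp add: effects_iff positive_op_def)

lemma linear_Psi: "linear (Psi c)"
proof (rule linearI)
  show "Psi c (a + b) = Psi c a + Psi c b" for a b
    by (simp add: Psi_def norm_trace_def matrix_add_ldistrib trace_add add_divide_distrib)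
  show "Psi c (r *\<^sub>R a) = r *\<^sub>R Psi c a" for r a
    by (simp add: Psi_def norm_trace_def linear_scale[OF linear_trace] linear_scale[OF linear_trace_mult])
       (simp add: scaleR_conv_of_real)
qed

lemma convex_spectral_scale: "convex (spectral_scale c)"
  unfolding spectral_scale_def by (intro convex_linear_image linear_Psi convex_effects)

lemma compact_spectral_scale: "compact (spectral_scale c)"
  unfolding spectral_scale_def
  by (intro compact_continuous_image linear_continuous linear_Psi compact_effects)

lemma fst_Psi: "fst (Psi c a) = Re (trace a) / real CARD('n)" for c :: "complex ^ 'n ^ 'n"
  by (simp add: Psi_def norm_trace_def)

lemma slice_map_in_spectral_scale:
  fixes c :: "complex ^ 'n ^ 'n"
  assumes "0 < k"
  shows "slice_map CARD('n) k z \<in> spectral_scale c \<longleftrightarrow> z \<in> k_numerical_range k c"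
proof -
  have n: "(of_nat CARD('n) :: complex) \<noteq> 0" "real CARD('n) \<noteq> 0" by simp_all
  have "slice_map CARD('n) k z = Psi c a \<longleftrightarrow> trace a = of_nat k \<and> trace (c ** a) = of_nat k * z"
    if "a \<in> effects" for a
  proof -
    have "slice_map CARD('n) k z = Psi c a \<longleftrightarrow> real k = Re (trace a) \<and> of_nat k * z = trace (c ** a)"
      using n by (simp add: slice_map_def Psi_def norm_trace_def)
    also have "real k = Re (trace a) \<longleftrightarrow> trace a = of_nat k"
      by (subst (2) effects_trace_real[OF that]) (metis of_real_eq_iff of_real_of_nat_eq)
    finally show ?thesis by auto
  qed
  then show ?thesis
    unfolding spectral_scale_def k_numerical_range_iff[OF assms] by blast
qed

text \<open>The self-adjoint operator that represents the functional \<open>x \<mapsto> p \<bullet> x\<close> on the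
  spectral scale.\<close>

definition support_op :: "complex ^ 'n ^ 'n \<Rightarrow> real \<times> complex \<Rightarrow> complex ^ 'n ^ 'n" where
  "support_op c p = mat (of_real (fst p)) + mat (1/2) ** (mat (cnj (snd p)) ** c + mat (snd p) ** mat_adj c)"

lemma self_adjoint_support_op: "self_adjoint (support_op c p)"
  by (simp add: self_adjoint_def support_op_def mat_adj_add mat_adj_mult mat_mult_commute matrix_distribs add.commute)

lemma inner_Psi:
  fixes c :: "complex ^ 'n ^ 'n"
  assumes "self_adjoint a"
  shows "Re (trace (support_op c p ** a)) = real CARD('n) * (p \<bullet> Psi c a)"
proof -
  have "trace (mat_adj c ** a) = cnj (trace (c ** a))"
    using assms trace_mul_sym[of "mat_adj c" a] by (simp add: self_adjoint_def mat_adj_mult flip: trace_mat_adj)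
  then have "trace (support_op c p ** a) = of_real (fst p) * trace a +
     1/2 * (cnj (snd p) * trace (c ** a) + cnj (cnj (snd p) * trace (c ** a)))"
    by (simp add: support_op_def matrix_distribs trace_add trace_mat_mult flip: matrix_mul_assoc)
  then have "Re (trace (support_op c p ** a)) = fst p * Re (trace a) + Re (cnj (snd p) * trace (c ** a))"
    by simp
  also have "\<dots> = real CARD('n) * (p \<bullet> Psi c a)"
    by (simp add: Psi_def norm_trace_def inner_prod_def inner_complex_def field_simps)
  finally show ?thesis .
qed

text \<open>Two directions that are linearly independent over the reals determine the two unknowns \<open>c\<close> and
  its adjoint by Cramer's rule.\<close>

lemma support_op_span:
  assumes "Im (snd q * cnj (snd p)) \<noteq> 0"
  obtains \<alpha> \<beta> \<gamma> where "c = mat \<alpha> + mat \<beta> ** support_op c p + mat \<gamma> ** support_op c q"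
proof -
  define s t w where "s = snd p" and "t = snd q" and "w = t * cnj s - s * cnj t"
  have "Im w \<noteq> 0" using assms by (simp add: w_def s_def t_def algebra_simps)
  then have w: "w \<noteq> 0" by auto
  have "(mat (2 / w * (s * fst q - t * fst p)) + mat (2 * t / w) ** support_op c p + mat (- 2 * s / w) ** support_op c q) $ i $ j
      = c $ i $ j" for i j
  proof -
    have A: "support_op c p $ i $ j = (if i = j then of_real (fst p) else 0) + 1/2 * (cnj s * c $ i $ j + s * mat_adj c $ i $ j)"
      "support_op c q $ i $ j = (if i = j then of_real (fst q) else 0) + 1/2 * (cnj t * c $ i $ j + t * mat_adj c $ i $ j)"
      by (simp_all add: support_op_def s_def t_def) (simp_all add: mat_def)
    have "w * c $ i $ j = t * (cnj s * c $ i $ j + s * mat_adj c $ i $ j) - s * (cnj t * c $ i $ j + t * mat_adj c $ i $ j)"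
      by (simp add: w_def algebra_simps)
    then have B: "c $ i $ j = (t * (cnj s * c $ i $ j + s * mat_adj c $ i $ j) - s * (cnj t * c $ i $ j + t * mat_adj c $ i $ j)) / w"
      using w by (simp add: field_simps)
    show ?thesis
      unfolding vector_add_component mat_mult_nth A
      by (rule trans[OF _ B[symmetric]]) (use w in \<open>simp add: mat_def field_simps\<close>)
  qed
  then have "c = mat (2 / w * (s * fst q - t * fst p)) + mat (2 * t / w) ** support_op c p + mat (- 2 * s / w) ** support_op c q"
    by (simp add: vec_eq_iff)
  then show thesis by (rule that)
qed

text \<open>Testing with the projections onto eigenvectors shows that all eigenvalues are zero.\<close>

lemma self_adjoint_trace_zero:
  assumes sa: "self_adjoint g" and "\<And>b. b \<in> effects \<Longrightarrow> Re (trace (g ** b)) = 0"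
  shows "g = 0"
proof -
  obtain e l where e: "orthonormal_basis e" and l: "\<And>i. g *v e i = of_real (l i) *s e i"
    using spectral_theorem[OF sa] by blast
  have on: "cinner (e i) (e i) = 1" for i using e by (simp add: orthonormal_basis_def)
  have "l i = 0" for i
  proof -
    have "projection (ketbra (e i) (e i))"
      using on sum_ketbra_projection[of "{i}" e] by simp
    then have "Re (trace (g ** ketbra (e i) (e i))) = 0" using assms(2) projection_effect by blast
    then show ?thesis by (simp add: trace_mult_ketbra l cinner_scale_left on)
  qed
  then show ?thesis by (intro orthonormal_basis_eqI[OF e]) (simp add: l)
qed

lemma maximizer_commute:
  assumes sa: "self_adjoint h" and a: "a \<in> effects"
    and max: "\<And>b. b \<in> effects \<Longrightarrow> Re (trace (h ** b)) \<le> Re (trace (h ** a))"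
  shows "a ** h = h ** a"
proof -
  obtain zm zp where z: "support_pair h zm zp" using support_projections[OF sa] by metis
  then have "projection zm" by (simp add: support_pair_def)
  from max[OF projection_effect[OF this]] have "a \<in> op_interval zm zp"
    using support_pair_max[OF z a] a unfolding support_pair_maximizers[OF z] by auto
  with z show ?thesis by (rule support_pair_commute)
qed

text \<open>With \<open>g\<close> the compression of \<open>1 - a\<close> to \<open>z\<close>, the operator in question
  is \<open>z - 2 g\<close>; a positive operator of trace at most \<open>1/2\<close> is at most
  \<open>1/2\<close>.\<close>

lemma half_compression_positive:
  assumes z: "projection z" and a: "a \<in> effects" and small: "Re (trace (z ** (mat 1 - a))) \<le> 1/2"
  shows "positive_op (2 *\<^sub>R (z ** a ** z) - z)"
proof -
  define g where "g = z ** (mat 1 - a) ** z"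
  have zz: "z ** z = z" "self_adjoint z" "mat_adj z = z" using z by (auto simp: projection_def self_adjoint_def)
  have g: "positive_op g"
    using a zz unfolding g_def by (intro positive_op_compress_sa) (auto simp: effects_iff)
  have tg: "Re (trace g) \<le> 1/2" using small by (simp add: g_def trace_projection_mult[OF z])
  have eq: "2 *\<^sub>R (z ** a ** z) - z = z - 2 *\<^sub>R g"
    by (simp add: g_def matrix_distribs zz scaleR_2 algebra_simps)
  have "0 \<le> Re (cinner ((z - 2 *\<^sub>R g) *v x) x)" for x
  proof -
    have "z ** g ** z = g" by (simp add: g_def matrix_mul_assoc zz, simp add: zz flip: matrix_mul_assoc)
    then have "cinner (g *v x) x = cinner ((z ** g ** z) *v x) x" by simp
    also have "\<dots> = cinner (g *v (z *v x)) (z *v x)"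
      using self_adjoint_cinner[OF zz(2)] by (simp flip: matrix_vector_mul_assoc)
    finally have "cinner (g *v x) x = cinner (g *v (z *v x)) (z *v x)" .
    then have "Re (cinner (g *v x) x) \<le> 1/2 * (norm (z *v x))\<^sup>2"
      using positive_op_le_trace[OF g, of "z *v x"] mult_right_mono[OF tg, of "(norm (z *v x))\<^sup>2"] by simp
    moreover have "cinner (z *v x) x = of_real ((norm (z *v x))\<^sup>2)"
      using self_adjoint_cinner[OF zz(2), of "z *v x" x] by (simp add: matrix_vector_mul_assoc zz cinner_self)
    ultimately show ?thesis
      by (simp add: matrix_vector_mult_diff_rdistrib cinner_diff_left scaleR_matrix mat_mult_vec cinner_scale_left
          flip: matrix_vector_mul_assoc)
  qed
  moreover have "mat_adj (z - 2 *\<^sub>R g) = z - 2 *\<^sub>R g"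
    using g zz linear_scale[OF linear_mat_adj, of 2 g] by (simp add: mat_adj_diff positive_op_def self_adjoint_def)
  ultimately show ?thesis unfolding eq by (simp add: positive_op_def self_adjoint_def)
qed

lemma commute_generated_algebra:
  assumes "z ** c = c ** z" "z ** mat_adj c = mat_adj c ** z" "a \<in> generated_algebra c"
  shows "z ** a = a ** z"
proof -
  have "unital_subalgebra {a. z ** a = a ** z}"
    unfolding unital_subalgebra_def
  proof (intro conjI ballI allI)
    fix a b assume ab: "a \<in> {a. z ** a = a ** z}" "b \<in> {a. z ** a = a ** z}"
    have "z ** (a ** b) = a ** z ** b" using ab by (simp add: matrix_mul_assoc)
    also have "\<dots> = (a ** b) ** z" using ab by (simp flip: matrix_mul_assoc)
    finally show "a ** b \<in> {a. z ** a = a ** z}" by simp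
  qed (auto simp: matrix_distribs mat_mult_left_commute simp flip: matrix_mul_assoc)
  then have "generated_algebra c \<subseteq> {a. z ** a = a ** z}"
    unfolding generated_algebra_def using assms by (intro hull_minimal) auto
  with assms(3) show ?thesis by blast
qed

lemma unital_subalgebra_generated: "unital_subalgebra (generated_algebra c)"
  unfolding generated_algebra_def
  by (rule hull_in) (auto simp: unital_subalgebra_def)

lemma support_op_in_generated: "support_op c p \<in> generated_algebra c"
proof -
  let ?S = "generated_algebra c"
  have gen: "c \<in> ?S" "mat_adj c \<in> ?S"
    unfolding generated_algebra_def by (auto intro: hull_inc)
  have add: "a + b \<in> ?S" if "a \<in> ?S" "b \<in> ?S" for a b
    using that unital_subalgebra_generated[of c] by (auto simp: unital_subalgebra_def)
  have scale: "mat r ** a \<in> ?S" if "a \<in> ?S" for a r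
    using that unital_subalgebra_generated[of c] by (auto simp: unital_subalgebra_def)
  show ?thesis
    unfolding support_op_def by (intro add scale gen unital_subalgebra_mat unital_subalgebra_generated)
qed

lemma trace_self_adjoint_mult_real:
  assumes "self_adjoint a" "self_adjoint b"
  shows "trace (a ** b) = of_real (Re (trace (a ** b)))"
proof -
  have "cnj (trace (a ** b)) = trace (b ** a)"
    using assms by (simp add: self_adjoint_def mat_adj_mult flip: trace_mat_adj)
  then have "cnj (trace (a ** b)) = trace (a ** b)" by (simp only: trace_mul_sym[of b a])
  then show ?thesis by (metis Reals_cnj_iff of_real_Re)
qed

text \<open>Two planes of support with independent slice directions meet the spectral scale in the image of an interval
  with central endpoints, and the spectral scale is conical near each point \<open>y\<close> of that image:
  the displacement of nearby points of the scale from \<open>y\<close> can be doubled. For the second part,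
  let \<open>y\<close> be the image of \<open>b\<close>. The map \<open>\<Phi>\<close> below compresses to
  \<open>zm\<close> and \<open>1 - zp\<close> and replaces the compression to \<open>e = zp - zm\<close> by
  its average; it is linear and does not change \<open>Psi\<close>. So it is enough that \<open>\<Phi> (2 a -
  b)\<close> is an effect. On the pieces \<open>zm\<close> and \<open>1 - zp\<close>, \<open>b\<close> is
  \<open>1\<close> and \<open>0\<close>, and \<open>a\<close> is so close to these values that the reflection
  stays in range; on \<open>e\<close> only the scalar averages of \<open>a\<close> and \<open>b\<close>
  matter.\<close>

theorem spectral_scale_corner_face:
  fixes c :: "complex ^ 'n ^ 'n" and p q :: "real \<times> complex"
  assumes indep: "Im (snd q * cnj (snd p)) \<noteq> 0"
    and sup: "\<And>x. x \<in> spectral_scale c \<Longrightarrow> p \<bullet> x \<le> bp" "\<And>x. x \<in> spectral_scale c \<Longrightarrow> q \<bullet> x \<le> bq"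
    and x0: "x0 \<in> spectral_scale c" "p \<bullet> x0 = bp" "q \<bullet> x0 = bq"
  obtains zm zp where "central_projection c zm" "central_projection c zp" "op_le zm zp"
    "Psi c ` op_interval zm zp = {x \<in> spectral_scale c. p \<bullet> x = bp \<and> q \<bullet> x = bq}"
    "\<And>y. y \<in> Psi c ` op_interval zm zp \<Longrightarrow>
       \<exists>\<epsilon>>0. \<forall>x\<in>spectral_scale c. dist x y < \<epsilon> \<longrightarrow> 2 *\<^sub>R x - y \<in> spectral_scale c"
proof -
  let ?n = "real CARD('n)"
  define h1 h2 h where "h1 = support_op c p" and "h2 = support_op c q" and "h = h1 + h2"
  have sa: "self_adjoint h1" "self_adjoint h2" "self_adjoint h"
    using self_adjoint_support_op[of c p] self_adjoint_support_op[of c q]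
    by (auto simp: h1_def h2_def h_def self_adjoint_def mat_adj_add)
  have th1: "Re (trace (h1 ** a)) = ?n * (p \<bullet> Psi c a)"
    and th2: "Re (trace (h2 ** a)) = ?n * (q \<bullet> Psi c a)"
    and th: "Re (trace (h ** a)) = ?n * ((p + q) \<bullet> Psi c a)" if "a \<in> effects" for a
    using inner_Psi[OF effects_self_adjoint[OF that]]
    by (auto simp: h1_def h2_def h_def matrix_distribs trace_add inner_add_left distrib_left)
  have PsiB: "Psi c a \<in> spectral_scale c" if "a \<in> effects" for a using that by (auto simp: spectral_scale_def)
  obtain zm zp where pair: "support_pair h zm zp"
    and zA: "\<And>A. unital_subalgebra A \<Longrightarrow> h \<in> A \<Longrightarrow> zm \<in> A \<and> zp \<in> A"
    by (rule support_projections[OF sa(3)]) (rule that; assumption)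
  note M = support_pair_maximizers[OF pair] support_pair_max[OF pair]
  have z: "projection zm" "projection zp" "zm ** zp = zm" using pair by (simp_all add: support_pair_def)
  obtain \<delta> where \<delta>: "\<delta> > 0"
    and bound: "\<And>a. a \<in> effects \<Longrightarrow> Re (trace (h ** a)) +
        \<delta> * (Re (trace (zm ** (mat 1 - a))) + Re (trace ((mat 1 - zp) ** a))) \<le> Re (trace (h ** zm))"
    using pair unfolding support_pair_def by blast
  have zpm: "zp ** zm = zm" using projection_le_commute[OF z] .
  have zsa: "zm ** zm = zm" "zp ** zp = zp" "self_adjoint zm" "self_adjoint zp"
    using z by (auto simp: projection_def)
  obtain a0 where a0: "a0 \<in> effects" "Psi c a0 = x0" using x0(1) by (auto simp: spectral_scale_def)
  have max: "Re (trace (h ** zm)) = ?n * (bp + bq)"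
  proof (rule antisym)
    have "(p + q) \<bullet> Psi c zm \<le> bp + bq"
      using sup[OF PsiB[OF projection_effect[OF z(1)]]] by (simp add: inner_add_left)
    then show "Re (trace (h ** zm)) \<le> ?n * (bp + bq)"
      unfolding th[OF projection_effect[OF z(1)]] by (intro mult_left_mono) auto
    show "?n * (bp + bq) \<le> Re (trace (h ** zm))"
      using M(2)[OF a0(1)] x0 a0 unfolding th[OF a0(1)] by (simp add: inner_add_left)
  qed
  \<comment> \<open>the maximum of the sum is the sum of the maxima, because some effect attains both\<close>
  have int_iff: "a \<in> op_interval zm zp \<longleftrightarrow> a \<in> effects \<and> p \<bullet> Psi c a = bp \<and> q \<bullet> Psi c a = bq" for a
  proof -
    have "(p + q) \<bullet> Psi c a = bp + bq \<longleftrightarrow> p \<bullet> Psi c a = bp \<and> q \<bullet> Psi c a = bq" if "a \<in> effects"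
      using sup(1)[OF PsiB[OF that]] sup(2)[OF PsiB[OF that]] by (auto simp: inner_add_left)
    then show ?thesis using th[of a] by (auto simp: M(1) max)
  qed
  have comm: "a ** h1 = h1 ** a" "a ** h2 = h2 ** a" if a: "a \<in> op_interval zm zp" for a
  proof -
    have *: "a \<in> effects" "p \<bullet> Psi c a = bp" "q \<bullet> Psi c a = bq" using a int_iff by auto
    show "a ** h1 = h1 ** a"
      by (rule maximizer_commute[OF sa(1) *(1)])
         (use sup(1)[OF PsiB] in \<open>simp add: th1 *(1,2)\<close>)
    show "a ** h2 = h2 ** a"
      by (rule maximizer_commute[OF sa(2) *(1)])
         (use sup(2)[OF PsiB] in \<open>simp add: th2 *(1,3)\<close>)
  qed
  define e where "e = zp - zm"
  have e: "projection e" unfolding e_def by (rule projection_diff[OF z])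
  have ee: "e ** e = e" "self_adjoint e" "e ** zm = 0" "zm ** e = 0" "e ** (mat 1 - zp) = 0" "(mat 1 - zp) ** e = 0"
    using e by (auto simp: projection_def) (simp_all add: e_def matrix_distribs z zpm zsa)
  have le: "op_le zm zp" using projection_positive[OF e] by (simp add: op_le_def e_def)
  have in_int: "zm + e ** b ** e \<in> op_interval zm zp" if "b \<in> effects" for b
  proof -
    have "positive_op (e ** b ** e)" "positive_op (e ** (mat 1 - b) ** e)"
      using that ee by (auto simp: effects_iff intro!: positive_op_compress_sa)
    moreover have "e ** (mat 1 - b) ** e = zp - (zm + e ** b ** e)"
      by (simp add: matrix_distribs ee) (simp add: e_def algebra_simps)
    ultimately show ?thesis by (simp add: op_interval_def op_le_def)
  qed
  have zm_int: "zm \<in> op_interval zm zp" and zp_int: "zp \<in> op_interval zm zp"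
    using in_int[OF projection_effect, of 0] in_int[OF projection_effect, of "mat 1"] ee
    by (simp_all add: projection_def self_adjoint_def e_def)
  \<comment> \<open>every effect supported on \<open>e\<close> can be added to \<open>zm\<close> without leaving the interval, so its trace against \<open>hi\<close> is zero\<close>
  have zero: "hi ** e = 0" if hi: "hi \<in> {h1, h2}" for hi
  proof -
    obtain r b where r: "hi = support_op c r" "\<And>a. a \<in> op_interval zm zp \<Longrightarrow> r \<bullet> Psi c a = b"
    proof (cases "hi = h1")
      case True
      then show ?thesis using that[of p bp] by (simp add: h1_def int_iff)
    next
      case False
      then show ?thesis using that[of q bq] hi by (simp add: h2_def int_iff)
    qed
    have com: "e ** hi = hi ** e"
      using hi comm[OF zm_int] comm[OF zp_int] by (auto simp: e_def matrix_distribs)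
    have "e ** hi ** e = 0"
    proof (rule self_adjoint_trace_zero)
      show "self_adjoint (e ** hi ** e)"
        using ee hi sa by (auto simp: self_adjoint_def mat_adj_mult matrix_mul_assoc)
      fix b' :: "complex ^ 'n ^ 'n" assume b': "b' \<in> effects"
      have *: "Re (trace (hi ** a)) = ?n * b" if "a \<in> op_interval zm zp" for a
        using inner_Psi[of a c r] effects_self_adjoint[of a] that r by (auto simp: int_iff)
      have "Re (trace (hi ** (e ** b' ** e))) = 0"
        using *[OF in_int[OF b']] *[OF zm_int] by (simp add: matrix_add_ldistrib trace_add)
      also have "trace (hi ** (e ** b' ** e)) = trace (e ** hi ** e ** b')"
        using trace_mul_sym[of "hi ** e ** b'" e] by (simp add: matrix_mul_assoc)
      finally show "Re (trace (e ** hi ** e ** b')) = 0" .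
    qed
    then show ?thesis by (simp add: com ee flip: matrix_mul_assoc)
  qed
  obtain \<alpha> \<beta> \<gamma> where c: "c = mat \<alpha> + mat \<beta> ** h1 + mat \<gamma> ** h2"
    by (rule support_op_span[OF indep, of c, folded h1_def h2_def]) (rule that)
  have cadj: "mat_adj c = mat (cnj \<alpha>) + mat (cnj \<beta>) ** h1 + mat (cnj \<gamma>) ** h2"
    using sa by (subst c) (simp add: mat_adj_add mat_adj_mult self_adjoint_def mat_mult_commute)
  have central: "central_projection c a" if "projection a" "a \<in> op_interval zm zp" "a \<in> generated_algebra c" for a
  proof -
    have "a ** (mat u + mat v ** h1 + mat w ** h2) = (mat u + mat v ** h1 + mat w ** h2) ** a" for u v w
      by (simp add: matrix_distribs mat_mult_left_commute mat_mult_commute[of a] comm[OF that(2)] flip: matrix_mul_assoc)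
    from this[of \<alpha> \<beta> \<gamma>] this[of "cnj \<alpha>" "cnj \<beta>" "cnj \<gamma>"]
    have "a ** c = c ** a" "a ** mat_adj c = mat_adj c ** a"
      by (simp_all only: c[symmetric] cadj[symmetric])
    then show ?thesis
      using that commute_generated_algebra[of a c] unfolding central_projection_def projection_def by blast
  qed
  have "h \<in> generated_algebra c"
    using support_op_in_generated[of c] unital_subalgebra_generated[of c]
    by (simp add: h_def h1_def h2_def unital_subalgebra_def)
  then have gen: "zm \<in> generated_algebra c" "zp \<in> generated_algebra c"
    using zA[OF unital_subalgebra_generated] by auto
  \<comment> \<open>if \<open>e = 0\<close> the quotient of traces is \<open>0 / 0 = 0\<close>, and the last summand is zero anyway\<close>
  define \<Phi> where "\<Phi> y = zm ** y ** zm + (mat 1 - zp) ** y ** (mat 1 - zp) + mat (trace (e ** y) / trace e) ** e" for y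
  have r: "projection (mat 1 - zp)" using projection_complement[OF z(2)] .
  have tre: "trace e = 0 \<longleftrightarrow> e = 0"
    using positive_op_trace_zero[OF projection_positive[OF e]] by auto
  have decomp: "trace (g ** y) = trace (g ** zm ** y) + trace (g ** (mat 1 - zp) ** y) + trace (g ** e ** y)" for g y
    by (simp add: e_def matrix_distribs trace_add trace_sub)
  have trPhi: "trace (\<Phi> y) = trace y" for y
  proof -
    have "trace (\<Phi> y) = trace (zm ** y) + trace ((mat 1 - zp) ** y) + trace (e ** y)"
      using tre by (simp add: \<Phi>_def trace_add trace_mat_mult flip: trace_projection_mult[OF z(1)] trace_projection_mult[OF r])
    with decomp[of "mat 1" y] show ?thesis by simp
  qed
  have trhPhi: "trace (hi ** \<Phi> y) = trace (hi ** y)" if hi: "hi \<in> {h1, h2}" for hi y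
  proof -
    have tw: "trace (hi ** (w ** y ** w)) = trace (hi ** w ** y)" if "w ** w = w" "w ** hi = hi ** w" for w
    proof -
      have "trace (hi ** (w ** y ** w)) = trace ((w ** hi) ** (w ** y))"
        using trace_mul_sym[of "hi ** w ** y" w] by (simp add: matrix_mul_assoc)
      also have "(w ** hi) ** (w ** y) = hi ** (w ** w) ** y" by (simp only: that(2) matrix_mul_assoc)
      finally show ?thesis by (simp only: that(1))
    qed
    have "trace (hi ** \<Phi> y) = trace (hi ** zm ** y) + trace (hi ** (mat 1 - zp) ** y)"
    proof -
      have "zm ** hi = hi ** zm" "zp ** hi = hi ** zp" using hi comm[OF zm_int] comm[OF zp_int] by auto
      then have "zm ** hi = hi ** zm" "(mat 1 - zp) ** hi = hi ** (mat 1 - zp)" by (simp_all add: matrix_distribs)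
      then show ?thesis
        using zsa r zero[OF hi]
        by (simp add: \<Phi>_def matrix_add_ldistrib trace_add mat_mult_left_commute tw projection_def)
    qed
    with decomp[of hi y] zero[OF hi] show ?thesis by simp
  qed
  \<comment> \<open>\<open>c\<close> is a combination of \<open>1\<close>, \<open>h1\<close> and \<open>h2\<close>, whose traces are preserved\<close>
  have "trace (c ** \<Phi> y) = trace (c ** y)" for y
    using trhPhi[of h1] trhPhi[of h2] trPhi
    by (subst (1 2) c) (simp add: matrix_distribs trace_add trace_mat_mult flip: matrix_mul_assoc)
  then have PsiPhi: "Psi c (\<Phi> y) = Psi c y" for y
    by (simp add: Psi_def norm_trace_def trPhi)
  have cone: "\<exists>\<epsilon>>0. \<forall>x\<in>spectral_scale c. dist x y < \<epsilon> \<longrightarrow> 2 *\<^sub>R x - y \<in> spectral_scale c"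
    if "y \<in> Psi c ` op_interval zm zp" for y
  proof -
    from that obtain b where b: "b \<in> op_interval zm zp" "y = Psi c b" by blast
    have beff: "b \<in> effects" and bz: "b ** zm = zm" "b ** zp = b" using b(1) op_interval_projections_iff[OF z] by auto
    have zb: "zm ** b = zm" "zp ** b = b"
      using mat_adj_mult_eqD[OF bz(1)] mat_adj_mult_eqD[OF bz(2)] zsa effects_self_adjoint[OF beff]
      by (simp_all add: self_adjoint_def)
    define E B where "E = Re (trace e)" and "B a = Re (trace (e ** a)) / E" for a
    \<comment> \<open>the two defects that the quantitative maximality of \<open>zm\<close> controls\<close>
    define \<eta>1 \<eta>0 where "\<eta>1 a = Re (trace (zm ** (mat 1 - a)))" and "\<eta>0 a = Re (trace ((mat 1 - zp) ** a))" for a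
    have E0: "0 \<le> E" unfolding E_def by (rule positive_op_trace_nonneg[OF projection_positive[OF e]])
    have \<eta>nn: "0 \<le> \<eta>1 a" "0 \<le> \<eta>0 a" if "a \<in> effects" for a
      using that z r by (auto intro!: trace_projection_effect_nonneg simp: effects_iff \<eta>1_def \<eta>0_def)
    have trE: "trace e = of_real E"
      using trace_self_adjoint_mult_real[OF ee(2) ee(2)] ee by (simp add: E_def)
    have Bc: "trace (e ** a) / trace e = of_real (B a)" if "a \<in> effects" for a
      using trace_self_adjoint_mult_real[OF ee(2) effects_self_adjoint[OF that]] by (simp add: B_def trE)
    have B01: "0 \<le> B a" "B a \<le> 1" if "a \<in> effects" for a
    proof -
      have "0 \<le> Re (trace (e ** a))" "0 \<le> Re (trace (e ** (mat 1 - a)))"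
        using that e by (auto intro!: trace_projection_effect_nonneg simp: effects_iff)
      then show "0 \<le> B a" "B a \<le> 1"
        using E0 by (auto simp: B_def E_def matrix_distribs trace_sub divide_le_eq_1)
    qed
    have diff: "Re (trace (e ** a)) - Re (trace (e ** b)) = Re (trace a) - Re (trace b) + \<eta>1 a - \<eta>0 a" for a
    proof -
      have *: "Re (trace w) = Re (trace (zm ** w)) + Re (trace ((mat 1 - zp) ** w)) + Re (trace (e ** w))" for w
        using decomp[of "mat 1" w] by simp
      have "(mat 1 - zp) ** b = 0" by (simp add: matrix_distribs zb)
      with *[of a] *[of b] show ?thesis
        by (simp add: \<eta>1_def \<eta>0_def matrix_sub_ldistrib trace_sub zb)
    qed
    define K where "K = ?n * norm (p + q) / \<delta> + ?n"
    have K: "K > 0" unfolding K_def using \<delta> by (intro add_nonneg_pos) auto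
    have eta: "\<eta>1 a + \<eta>0 a \<le> K * dist (Psi c a) y" "\<bar>Re (trace (e ** a)) - Re (trace (e ** b))\<bar> \<le> K * dist (Psi c a) y"
      if a: "a \<in> effects" for a
    proof -
      have "\<delta> * (\<eta>1 a + \<eta>0 a) \<le> ?n * ((p + q) \<bullet> Psi c b) - ?n * ((p + q) \<bullet> Psi c a)"
        using bound[OF a] th[OF a] b(1) th[OF beff] unfolding M(1) by (simp add: \<eta>1_def \<eta>0_def)
      also have "\<dots> = ?n * ((p + q) \<bullet> (y - Psi c a))" by (simp add: b(2) inner_diff_right algebra_simps)
      also have "\<dots> \<le> ?n * (norm (p + q) * norm (y - Psi c a))"
        by (intro mult_left_mono norm_cauchy_schwarz) auto
      finally have 1: "\<eta>1 a + \<eta>0 a \<le> ?n * norm (p + q) / \<delta> * dist (Psi c a) y"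
        using \<delta> by (simp add: field_simps dist_norm norm_minus_commute)
      have "\<bar>fst (Psi c a - y)\<bar> \<le> dist (Psi c a) y"
        unfolding dist_norm using norm_fst_le[of "fst (Psi c a - y)" "snd (Psi c a - y)"] by (simp only: prod.collapse real_norm_def)
      then have 2: "\<bar>Re (trace a) - Re (trace b)\<bar> \<le> ?n * dist (Psi c a) y"
        by (simp add: b(2) fst_Psi field_simps flip: diff_divide_distrib)
      have "0 \<le> ?n * dist (Psi c a) y" by simp
      with 1 show "\<eta>1 a + \<eta>0 a \<le> K * dist (Psi c a) y" unfolding K_def distrib_right by linarith
      show "\<bar>Re (trace (e ** a)) - Re (trace (e ** b))\<bar> \<le> K * dist (Psi c a) y"
        unfolding diff using 1 2 \<eta>nn[OF a] unfolding K_def distrib_right by linarith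
    qed
    \<comment> \<open>half the distance of the average of \<open>b\<close> to the ends of \<open>[0,1]\<close>, except that an end at which the
      average already lies imposes no bound, because averages of effects stay in \<open>[0,1]\<close>\<close>
    define \<kappa> where "\<kappa> = min (if B b = 0 then 1/2 else B b / 2) (if B b = 1 then 1/2 else (1 - B b) / 2)"
    have \<kappa>: "\<kappa> > 0" using B01[OF beff] by (simp add: \<kappa>_def)
    define \<epsilon> where "\<epsilon> = (if E = 0 then 1/2 else min (1/2) (\<kappa> * E)) / K"
    have \<epsilon>: "\<epsilon> > 0" using E0 \<kappa> K by (simp add: \<epsilon>_def)
    have "2 *\<^sub>R Psi c a - y \<in> spectral_scale c" if a: "a \<in> effects" and d: "dist (Psi c a) y < \<epsilon>" for a
    proof -
      have Kd: "K * dist (Psi c a) y \<le> (if E = 0 then 1/2 else min (1/2) (\<kappa> * E))"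
        using mult_left_mono[OF less_imp_le[OF d], of K] K by (simp add: \<epsilon>_def)
      then have "K * dist (Psi c a) y \<le> 1/2" by (auto split: if_splits)
      then have half: "\<eta>1 a \<le> 1/2" "\<eta>0 a \<le> 1/2" using eta(1)[OF a] \<eta>nn[OF a] by linarith+
      define t where "t = 2 * B a - B b"
      have t: "E = 0 \<or> 0 \<le> t \<and> t \<le> 1"
      proof (cases "E = 0")
        case False
        have "\<bar>Re (trace (e ** a)) - Re (trace (e ** b))\<bar> \<le> \<kappa> * E" using eta(2)[OF a] Kd False by auto
        then have "\<bar>B a - B b\<bar> \<le> \<kappa>"
          using False E0 by (simp add: B_def divide_simps flip: diff_divide_distrib)
        then have "B a - B b \<le> \<kappa>" "B b - B a \<le> \<kappa>" by linarith+
        then show ?thesis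
          using B01[OF a] B01[OF beff] by (auto simp: t_def \<kappa>_def min_def split: if_splits)
      qed simp
      have te: "positive_op (t *\<^sub>R e)" "positive_op ((1 - t) *\<^sub>R e)"
      proof -
        have "e = 0" if "E = 0" using that tre trE by simp
        with t projection_positive[OF e] show "positive_op (t *\<^sub>R e)" "positive_op ((1 - t) *\<^sub>R e)"
          by (cases "E = 0"; auto intro!: positive_op_scaleR)+
      qed
      define y' where "y' = 2 *\<^sub>R a - b"
      have "trace (e ** y') / trace e = of_real t"
        unfolding t_def of_real_diff of_real_mult Bc[OF a, symmetric] Bc[OF beff, symmetric]
        by (simp add: y'_def matrix_distribs trace_sub linear_scale[OF linear_trace_mult]
            diff_divide_distrib scaleR_conv_of_real[of _ "_::complex"])
      moreover have "zm ** y' ** zm = 2 *\<^sub>R (zm ** a ** zm) - zm"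
        by (simp add: y'_def matrix_distribs zb zsa scaleR_matrix mat_mult_left_commute flip: matrix_mul_assoc)
      moreover have "(mat 1 - zp) ** y' ** (mat 1 - zp) = 2 *\<^sub>R ((mat 1 - zp) ** a ** (mat 1 - zp))"
      proof -
        have "(mat 1 - zp) ** b = 0" by (simp add: matrix_distribs zb)
        then show ?thesis
          by (simp add: y'_def matrix_sub_ldistrib matrix_sub_rdistrib[of _ "_ ** b"] scaleR_matrix mat_mult_left_commute flip: matrix_mul_assoc)
      qed
      ultimately have Phi: "\<Phi> y' = (2 *\<^sub>R (zm ** a ** zm) - zm) + 2 *\<^sub>R ((mat 1 - zp) ** a ** (mat 1 - zp)) + t *\<^sub>R e"
        by (simp add: \<Phi>_def scaleR_matrix)
      have pos: "positive_op (\<Phi> y')"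
        unfolding Phi using half(1) a te r
        by (intro te positive_op_add half_compression_positive z positive_op_scaleR[of _ 2] positive_op_compress_sa)
           (auto simp: \<eta>1_def effects_iff projection_def)
      have "mat 1 - \<Phi> y' = 2 *\<^sub>R (zm ** (mat 1 - a) ** zm)
         + (2 *\<^sub>R ((mat 1 - zp) ** (mat 1 - a) ** (mat 1 - zp)) - (mat 1 - zp)) + (1 - t) *\<^sub>R e"
      proof -
        have w: "w ** (mat 1 - a) ** w = w - w ** a ** w" if "w ** w = w" for w
          using that by (simp add: matrix_distribs)
        have idem: "(mat 1 - zp) ** (mat 1 - zp) = mat 1 - zp" using r by (simp add: projection_def)
        show ?thesis
          unfolding Phi w[OF zsa(1)] w[OF idem]
          by (simp add: e_def algebra_simps scaleR_2)
      qed
      also have "positive_op \<dots>"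
        using half(2) effects_complement[OF a] te z
        by (intro te positive_op_add half_compression_positive r positive_op_scaleR[of _ 2] positive_op_compress_sa)
           (auto simp: \<eta>0_def effects_iff projection_def)
      finally have "\<Phi> y' \<in> effects" using pos by (simp only: effects_iff)
      from PsiB[OF this] show ?thesis
        unfolding PsiPhi by (simp add: y'_def b(2) linear_diff[OF linear_Psi] linear_scale[OF linear_Psi])
    qed
    with \<epsilon> show ?thesis unfolding spectral_scale_def by blast
  qed
  show thesis
  proof (rule that)
    show "central_projection c zm" "central_projection c zp"
      using central zm_int zp_int z gen by auto
    show "op_le zm zp" by fact
    show "Psi c ` op_interval zm zp = {x \<in> spectral_scale c. p \<bullet> x = bp \<and> q \<bullet> x = bq}"
      by (auto simp: int_iff spectral_scale_def)
  qed (rule cone)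
qed

section \<open>Corners of plane convex sets\<close>

text \<open>Two complex numbers are linearly independent over the reals exactly if \<open>Im (b * cnj a) \<noteq>
  0\<close>; this form of independence is used for normals throughout.\<close>

lemma inner_eq_zero_both:
  fixes a b z :: complex
  assumes "Im (b * cnj a) \<noteq> 0" "a \<bullet> z = 0" "b \<bullet> z = 0"
  shows "z = 0"
proof -
  have "Im (b * cnj a) * Re z = Im b * (a \<bullet> z) - Im a * (b \<bullet> z)"
    "Im (b * cnj a) * Im z = Re a * (b \<bullet> z) - Re b * (a \<bullet> z)"
    by (simp_all add: inner_complex_def algebra_simps)
  with assms show ?thesis by (simp add: complex_eq_iff)
qed

lemma parallel_normals:
  fixes a b :: complex
  assumes "Im (b * cnj a) = 0" "a \<noteq> 0"
  obtains r where "b = of_real r * a"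
proof -
  obtain s where s: "b * cnj a = of_real s"
    using assms(1) by (metis complex_is_Real_iff Reals_cases)
  have "b * (cnj a * a) = of_real s * a" using s by (simp flip: mult.assoc)
  moreover have "cnj a * a = of_real ((norm a)\<^sup>2)"
    using complex_norm_square[of a] by (simp add: mult.commute)
  ultimately have "b * of_real ((norm a)\<^sup>2) = of_real s * a" by simp
  then have "b = of_real (s / (norm a)\<^sup>2) * a"
    using assms(2) by (simp add: divide_simps)
  then show thesis by (rule that)
qed

lemma supported_not_interior:
  fixes W :: "'a::euclidean_space set"
  assumes "a \<noteq> 0" "\<And>z. z \<in> W \<Longrightarrow> a \<bullet> (z - l) \<le> 0"
  shows "l \<notin> interior W"
proof
  assume "l \<in> interior W"
  then obtain e where e: "e > 0" "ball l e \<subseteq> W" by (auto simp: mem_interior)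
  define r where "r = e / (2 * norm a)"
  have r: "r > 0" using e assms(1) by (simp add: r_def)
  have "norm (r *\<^sub>R a) = e / 2" using e(1) assms(1) by (simp add: r_def)
  then have "l + r *\<^sub>R a \<in> W" using e by (auto simp: dist_norm)
  moreover have "0 < r * (a \<bullet> a)" using r assms(1) by simp
  ultimately show False using assms(2)[of "l + r *\<^sub>R a"] by simp
qed

text \<open>Two lines through \<open>l\<close> are distinct exactly if their normals are not parallel, and a point of
  \<open>W\<close> on a line of support is a boundary point.\<close>

lemma has_corner_at_iff:
  fixes W :: "complex set"
  assumes W: "closed W"
  shows "has_corner_at W l \<longleftrightarrow> l \<in> W \<and> (\<exists>a b. Im (b * cnj a) \<noteq> 0 \<and> (\<forall>z\<in>W. a \<bullet> (z - l) \<le> 0) \<and> (\<forall>z\<in>W. b \<bullet> (z - l) \<le> 0))"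
proof
  assume corner: "has_corner_at W l"
  then have lW: "l \<in> W" using frontier_subset_closed[OF W] unfolding has_corner_at_def by blast
  obtain L M where LM: "L \<noteq> M" "supporting_hyperplane W L" "l \<in> L" "supporting_hyperplane W M" "l \<in> M"
    using corner unfolding has_corner_at_def tangent_line_of_support_def by blast
  from LM(2) obtain a c where a: "a \<noteq> 0" "L = {x. a \<bullet> x = c}" "W \<subseteq> {x. a \<bullet> x \<le> c}"
    unfolding supporting_hyperplane_def by blast
  from LM(4) obtain b d where b: "b \<noteq> 0" "M = {x. b \<bullet> x = d}" "W \<subseteq> {x. b \<bullet> x \<le> d}"
    unfolding supporting_hyperplane_def by blast
  have cd: "a \<bullet> l = c" "b \<bullet> l = d" using LM(3,5) unfolding a(2) b(2) by simp_all
  have "Im (b * cnj a) \<noteq> 0"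
  proof
    assume "Im (b * cnj a) = 0"
    then obtain r where r: "b = of_real r * a" using parallel_normals[OF _ a(1)] by blast
    then have "r \<noteq> 0" using b by auto
    have "b \<bullet> x = r * (a \<bullet> x)" for x by (simp add: r inner_complex_def algebra_simps)
    then have "L = M" using \<open>r \<noteq> 0\<close> unfolding a(2) b(2) by (simp flip: cd)
    with LM show False by simp
  qed
  moreover have "\<forall>z\<in>W. a \<bullet> (z - l) \<le> 0" "\<forall>z\<in>W. b \<bullet> (z - l) \<le> 0"
    using a(3) b(3) by (auto simp: inner_diff_right cd)
  ultimately show "l \<in> W \<and> (\<exists>a b. Im (b * cnj a) \<noteq> 0 \<and> (\<forall>z\<in>W. a \<bullet> (z - l) \<le> 0) \<and> (\<forall>z\<in>W. b \<bullet> (z - l) \<le> 0))"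
    using lW by blast
next
  assume "l \<in> W \<and> (\<exists>a b. Im (b * cnj a) \<noteq> 0 \<and> (\<forall>z\<in>W. a \<bullet> (z - l) \<le> 0) \<and> (\<forall>z\<in>W. b \<bullet> (z - l) \<le> 0))"
  then obtain a b where l: "l \<in> W" and ab: "Im (b * cnj a) \<noteq> 0"
    and sup: "\<forall>z\<in>W. a \<bullet> (z - l) \<le> 0" "\<forall>z\<in>W. b \<bullet> (z - l) \<le> 0" by blast
  have nz: "a \<noteq> 0" "b \<noteq> 0" using ab by auto
  have "l \<notin> interior W"
    by (rule supported_not_interior[OF nz(1)]) (use sup(1) in blast)
  then have fr: "l \<in> frontier W"
    unfolding frontier_def using l closure_subset by blast
  have tangent: "tangent_line_of_support W l {x. c \<bullet> x = c \<bullet> l}" if "c \<noteq> 0" "\<forall>z\<in>W. c \<bullet> (z - l) \<le> 0" for c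
    unfolding tangent_line_of_support_def supporting_hyperplane_def using that l
    by (intro conjI exI[of _ c] exI[of _ "c \<bullet> l"]) (auto simp: inner_diff_right)
  have "{x. a \<bullet> x = a \<bullet> l} \<noteq> {x. b \<bullet> x = b \<bullet> l}"
  proof
    assume eq: "{x. a \<bullet> x = a \<bullet> l} = {x. b \<bullet> x = b \<bullet> l}"
    have "a \<bullet> (\<i> * a) = 0" by (simp add: inner_complex_def)
    then have "l + \<i> * a \<in> {x. a \<bullet> x = a \<bullet> l}" by (simp add: inner_add_right)
    then have "l + \<i> * a \<in> {x. b \<bullet> x = b \<bullet> l}" by (simp only: eq)
    then have "b \<bullet> (\<i> * a) = 0" by (simp add: inner_add_right)
    from inner_eq_zero_both[OF ab \<open>a \<bullet> (\<i> * a) = 0\<close> this] have "\<i> * a = 0" .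
    with nz show False by simp
  qed
  then show "has_corner_at W l"
    unfolding has_corner_at_def
    by (intro conjI fr exI[of _ "{x. a \<bullet> x = a \<bullet> l}"] exI[of _ "{x. b \<bullet> x = b \<bullet> l}"]
        tangent nz sup)
qed

text \<open>Each outer normal has a local maximum along the curve at the corner, so the velocity is orthogonal to two
  independent normals.\<close>

lemma corner_not_differentiable:
  fixes W :: "complex set"
  assumes W: "closed W" and corner: "has_corner_at W l"
  shows "\<not> boundary_differentiable_at W l"
proof
  assume "boundary_differentiable_at W l"
  then obtain U \<gamma> \<delta> v where hom: "homeomorphism {-1<..<1} (frontier W \<inter> U) \<gamma> \<delta>"
    and \<gamma>: "\<gamma> 0 = l" "v \<noteq> 0" "(\<gamma> has_vector_derivative v) (at 0)"
    unfolding boundary_differentiable_at_def by blast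
  obtain a b where ab: "Im (b * cnj a) \<noteq> 0"
    and sup: "\<forall>z\<in>W. a \<bullet> (z - l) \<le> 0" "\<forall>z\<in>W. b \<bullet> (z - l) \<le> 0"
    using corner unfolding has_corner_at_iff[OF W] by blast
  have "c \<bullet> v = 0" if c: "\<forall>z\<in>W. c \<bullet> (z - l) \<le> 0" for c
  proof -
    have "((\<lambda>t. c \<bullet> \<gamma> t) has_real_derivative c \<bullet> v) (at 0)"
      using \<gamma>(3) unfolding has_vector_derivative_def has_field_derivative_def
      by (auto intro!: derivative_eq_intros simp: fun_eq_iff)
    moreover have "\<forall>t. \<bar>0 - t\<bar> < 1 \<longrightarrow> c \<bullet> \<gamma> t \<le> c \<bullet> \<gamma> 0"
    proof (intro allI impI)
      fix t :: real assume "\<bar>0 - t\<bar> < 1"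
      then have "\<gamma> t \<in> \<gamma> ` {-1<..<1}" by (intro imageI) auto
      then have "\<gamma> t \<in> frontier W" using hom unfolding homeomorphism_def by blast
      then have "\<gamma> t \<in> W" using W frontier_subset_closed by blast
      then show "c \<bullet> \<gamma> t \<le> c \<bullet> \<gamma> 0" using c by (auto simp: \<gamma>(1) inner_diff_right)
    qed
    ultimately show ?thesis using DERIV_local_max zero_less_one by blast
  qed
  from inner_eq_zero_both[OF ab this[OF sup(1)] this[OF sup(2)]] have "v = 0" .
  with \<gamma>(2) show False by simp
qed

text \<open>If no line \<open>m x\<close> with \<open>m \<noteq> 0\<close> stays below \<open>f\<close>, then for every
  \<open>\<epsilon> > 0\<close> the graph dips under both \<open>\<epsilon> x\<close> and \<open>- \<epsilon>
  x\<close>, and by convexity it remains under them on the way back to the origin.\<close>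

lemma convex_function_derivative_zero:
  fixes f :: "real \<Rightarrow> real"
  assumes r: "r > 0" and conv: "convex_on {-r<..<r} f" and f0: "f 0 = 0" and nn: "\<And>x. x \<in> {-r<..<r} \<Longrightarrow> 0 \<le> f x"
    and no: "\<And>m. m \<noteq> 0 \<Longrightarrow> \<exists>x\<in>{-r<..<r}. f x < m * x"
  shows "(f has_real_derivative 0) (at 0)"
proof -
  have sub: "f (s * x) \<le> s * f x" if "x \<in> {-r<..<r}" "0 \<le> s" "s \<le> 1" for x s
    using convex_onD[OF conv, of s 0 x] that f0 r by simp
  have "\<exists>d>0. \<forall>h. 0 < \<bar>h\<bar> \<and> \<bar>h\<bar> < d \<longrightarrow> \<bar>f h / h\<bar> < e" if e: "e > 0" for e
  proof -
    obtain x where x: "x \<in> {-r<..<r}" "f x < (e/2) * x" using no[of "e/2"] e by auto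
    obtain y where y: "y \<in> {-r<..<r}" "f y < - (e/2) * y" using no[of "-(e/2)"] e by auto
    have "0 < (e/2) * x" using nn[OF x(1)] x(2) by linarith
    then have xp: "x > 0" using e by (simp add: zero_less_mult_iff)
    have "0 < (e/2) * (- y)" using nn[OF y(1)] y(2) by simp
    then have yp: "- y > 0" using e by (simp add: zero_less_mult_iff mult_less_0_iff)
    have "\<bar>f h / h\<bar> < e" if h: "0 < \<bar>h\<bar>" "\<bar>h\<bar> < min x (-y)" for h
    proof -
      have "f h \<le> e/2 * \<bar>h\<bar> \<and> 0 \<le> f h"
      proof (cases "h > 0")
        case True
        have "f (h / x * x) \<le> h / x * f x" using True h xp x by (intro sub) auto
        also have "\<dots> \<le> h / x * ((e/2) * x)" using x True xp by (intro mult_left_mono) auto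
        finally have "f h \<le> e/2 * h" using xp by (simp add: mult.commute)
        moreover have "0 \<le> f h" using nn[of h] True h x by auto
        ultimately show ?thesis using True by simp
      next
        case False
        then have hn: "h < 0" using h by simp
        have "f (h / y * y) \<le> h / y * f y" using hn h yp y by (intro sub) (auto simp: divide_simps)
        also have "\<dots> \<le> h / y * (- (e/2) * y)" using y hn yp by (intro mult_left_mono) (auto simp: divide_simps)
        finally have "f h \<le> e/2 * (- h)" using yp by (simp add: mult.commute)
        moreover have "0 \<le> f h" using nn[of h] hn h y by auto
        ultimately show ?thesis using hn by simp
      qed
      then have "\<bar>f h / h\<bar> \<le> e/2" using h by (simp add: divide_simps)
      with e show ?thesis by linarith
    qed
    with xp yp show ?thesis by (intro exI[of _ "min x (-y)"]) auto
  qed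
  then show ?thesis
    unfolding DERIV_def LIM_eq by (simp add: f0)
qed

text \<open>Use coordinates \<open>X\<close> along a line of support and \<open>Y\<close> towards an interior point
  \<open>q\<close>. Near \<open>l\<close> the boundary is the graph of the convex function \<open>f\<close>
  that gives the lowest point of \<open>W\<close> over each \<open>X\<close>, and the graph parametrizes it. A
  nonzero slope under \<open>f\<close> would be a second line of support, so \<open>f\<close> has derivative
  \<open>0\<close>.\<close>

lemma not_corner_differentiable:
  fixes W :: "complex set"
  assumes W: "compact W" "convex W" "aff_dim W = 2" and l: "l \<in> frontier W" and no: "\<not> has_corner_at W l"
  shows "boundary_differentiable_at W l"
proof -
  have cl: "closed W" using W(1) compact_imp_closed by blast
  have lW: "l \<in> W" using l cl frontier_subset_closed by blast
  have ri: "rel_interior W = interior W" using W(3) by (intro interior_rel_interior) simp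
  have "l \<notin> rel_interior W" using l by (simp add: ri frontier_def)
  then obtain a where a: "a \<noteq> 0" "\<And>y. y \<in> W \<Longrightarrow> a \<bullet> l \<le> a \<bullet> y" "\<And>y. y \<in> rel_interior W \<Longrightarrow> a \<bullet> l < a \<bullet> y"
    by (rule supporting_hyperplane_rel_boundary[OF W(2) lW]) (rule that)
  have "rel_interior W \<noteq> {}" using lW W(2) rel_interior_eq_empty by blast
  then obtain q where q: "q \<in> interior W" "a \<bullet> l < a \<bullet> q" using a(3) ri by auto
  define w u D where "w = q - l" and "u = \<i> * a" and "D = a \<bullet> w"
  have D: "D > 0" using q by (simp add: D_def w_def inner_diff_right)
  define X Y where "X z = ((\<i> * w) \<bullet> (z - l)) / D" and "Y z = (a \<bullet> (z - l)) / D" for z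
  define P where "P x y = l + of_real x * u + of_real y * w" for x y :: real
  have XP: "X (P x y) = x" and YP: "Y (P x y) = y" for x y
    using D by (auto simp: X_def Y_def P_def u_def D_def inner_complex_def field_simps)
  have PXY: "P (X z) (Y z) = z" for z
  proof -
    have "of_real ((\<i> * w) \<bullet> (z - l)) * u + of_real (a \<bullet> (z - l)) * w = of_real D * (z - l)"
      by (simp add: complex_eq_iff u_def D_def inner_complex_def algebra_simps)
    then have "of_real (X z) * u + of_real (Y z) * w = z - l"
      using D by (simp add: X_def Y_def divide_simps)
    then show ?thesis by (simp add: P_def algebra_simps)
  qed
  have lin: "P (s * x + t * x') (s * y + t * y') = s *\<^sub>R P x y + t *\<^sub>R P x' y'" if "s + t = 1" for s t x x' y y'
  proof -
    have "l = of_real (s + t) * l" using that by simp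
    then show ?thesis unfolding P_def by (simp add: scaleR_conv_of_real algebra_simps)
  qed
  have contP: "continuous_on UNIV (\<lambda>x. P x y)" "continuous_on UNIV (P x)" for x y
    unfolding P_def by (intro continuous_intros)+
  have Y0: "0 \<le> Y z" if "z \<in> W" for z using a(2)[OF that] D by (simp add: Y_def inner_diff_right)
  have Pl: "P 0 0 = l" "P 0 1 = q" by (simp_all add: P_def w_def)
  obtain r where r: "r > 0" "\<And>x. \<bar>x\<bar> < r \<Longrightarrow> P x 1 \<in> interior W"
  proof -
    have "open ((\<lambda>x. P x 1) -` interior W)" using contP(1) by (simp add: open_vimage)
    moreover have "0 \<in> (\<lambda>x. P x 1) -` interior W" using q Pl by simp
    ultimately obtain r where "r > 0" "ball 0 r \<subseteq> (\<lambda>x. P x 1) -` interior W"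
      using openE by blast
    then show ?thesis using that[of r] by (auto simp: subset_eq)
  qed
  define f where "f x = Inf {y. P x y \<in> W}" for x
  have bdd: "bdd_below {y. P x y \<in> W}" for x
    using Y0[of "P x _"] by (intro bdd_belowI[of _ 0]) (simp add: YP)
  have ne: "{y. P x y \<in> W} \<noteq> {}" if "\<bar>x\<bar> < r" for x using r(2)[OF that] interior_subset by auto
  have closedP: "closed {y. P x y \<in> W}" for x
    using closed_vimage[OF cl contP(2)] by (simp add: vimage_def)
  have fW: "P x (f x) \<in> W" if "\<bar>x\<bar> < r" for x
    using closed_contains_Inf[OF ne[OF that] bdd closedP] by (simp add: f_def)
  have f_le: "f x \<le> y" if "P x y \<in> W" for x y
    unfolding f_def using that bdd by (intro cInf_lower) auto
  have f_nn: "0 \<le> f x" if "\<bar>x\<bar> < r" for x using Y0[OF fW[OF that]] by (simp add: YP)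
  have f0: "f 0 = 0" using f_le[of 0 0] f_nn[of 0] r lW by (simp add: Pl)
  have not_int: "P x (f x) \<notin> interior W" if "\<bar>x\<bar> < r" for x
  proof
    assume "P x (f x) \<in> interior W"
    moreover have "open (P x -` interior W)" using contP(2) by (simp add: open_vimage)
    ultimately obtain e where e: "e > 0" "ball (f x) e \<subseteq> P x -` interior W" using openE by blast
    have "f x - e/2 \<in> ball (f x) e" using e(1) by (simp add: dist_real_def)
    then have "P x (f x - e/2) \<in> W" using e(2) interior_subset by blast
    from f_le[OF this] e(1) show False by simp
  qed
  have f1: "f x < 1" if "\<bar>x\<bar> < r" for x
  proof -
    have "P x 1 \<in> W" using r(2)[OF that] interior_subset by blast
    then have "f x \<le> 1" by (rule f_le)
    moreover have "f x \<noteq> 1" using not_int[OF that] r(2)[OF that] by auto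
    ultimately show ?thesis by simp
  qed
  have conv: "convex_on {-r<..<r} f"
  proof (rule convex_onI)
    fix t x y assume t: "0 < t" "t < (1::real)" and xy: "x \<in> {-r<..<r}" "y \<in> {-r<..<r}"
    have "P ((1 - t) * x + t * y) ((1 - t) * f x + t * f y) = (1 - t) *\<^sub>R P x (f x) + t *\<^sub>R P y (f y)"
      by (rule lin) simp
    also have "\<dots> \<in> W" using t xy fW by (intro convexD[OF W(2)]) auto
    finally show "f ((1 - t) *\<^sub>R x + t *\<^sub>R y) \<le> (1 - t) * f x + t * f y" using f_le by simp
  qed simp
  have contf: "continuous_on {-r<..<r} f" by (rule convex_on_continuous[OF _ conv]) simp
  \<comment> \<open>the condition \<open>Y z < 1\<close> cuts off the upper part of the boundary\<close>
  define U where "U = {z. \<bar>X z\<bar> < r \<and> Y z < 1}"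
  have contXY: "continuous_on UNIV X" "continuous_on UNIV Y"
    unfolding X_def Y_def by (intro continuous_intros; use D in simp)+
  have "open U" unfolding U_def
    by (intro open_Collect_conj open_Collect_less continuous_intros contXY)
  have front: "z \<in> frontier W \<inter> U \<longleftrightarrow> \<bar>X z\<bar> < r \<and> z = P (X z) (f (X z))" for z
  proof
    assume z: "z \<in> frontier W \<inter> U"
    then have x: "\<bar>X z\<bar> < r" and y1: "Y z < 1" by (auto simp: U_def)
    have zW: "z \<in> W" and zi: "z \<notin> interior W" using z cl frontier_subset_closed by (auto simp: frontier_def)
    have "f (X z) \<le> Y z" using f_le[of "X z" "Y z"] zW by (simp add: PXY)
    moreover have "\<not> f (X z) < Y z"
    proof
      assume lt: "f (X z) < Y z"
      define t where "t = (Y z - f (X z)) / (1 - f (X z))"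
      have t: "0 < t" "t \<le> 1" using lt f1[OF x] y1 by (auto simp: t_def)
      have "P (X z) (f (X z)) - t *\<^sub>R (P (X z) (f (X z)) - P (X z) 1) \<in> interior W"
        using t by (intro mem_interior_convex_shrink W r(2) fW x)
      also have "P (X z) (f (X z)) - t *\<^sub>R (P (X z) (f (X z)) - P (X z) 1) = P ((1 - t) * X z + t * X z) ((1 - t) * f (X z) + t * 1)"
        by (subst lin) (simp_all add: algebra_simps)
      also have "(1 - t) * X z + t * X z = X z" by (simp add: algebra_simps)
      also have "(1 - t) * f (X z) + t * 1 = f (X z) + t * (1 - f (X z))" by (simp add: algebra_simps)
      also have "\<dots> = Y z" using f1[OF x] by (simp add: t_def)
      finally show False using zi by (simp add: PXY)
    qed
    ultimately have "f (X z) = Y z" by simp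
    with x show "\<bar>X z\<bar> < r \<and> z = P (X z) (f (X z))" by (simp add: PXY)
  next
    assume z: "\<bar>X z\<bar> < r \<and> z = P (X z) (f (X z))"
    then have x: "\<bar>X z\<bar> < r" and Yz: "Y z = f (X z)" using YP[of "X z" "f (X z)"] by auto
    have zP: "z = P (X z) (f (X z))" using z by blast
    have "z \<in> W" "z \<notin> interior W" using fW[OF x] not_int[OF x] by (simp_all flip: zP)
    then have "z \<in> frontier W" using closure_subset by (auto simp: frontier_def)
    moreover have "z \<in> U" using x f1[OF x] by (simp add: U_def Yz)
    ultimately show "z \<in> frontier W \<inter> U" by blast
  qed
  have deriv: "(f has_real_derivative 0) (at 0)"
  proof (rule convex_function_derivative_zero[OF r(1) conv f0])
    show "0 \<le> f x" if "x \<in> {-r<..<r}" for x using f_nn that by auto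
    fix m :: real assume m: "m \<noteq> 0"
    show "\<exists>x\<in>{-r<..<r}. f x < m * x"
    proof (rule ccontr)
      assume "\<not> ?thesis"
      then have fm: "m * x \<le> f x" if "\<bar>x\<bar> < r" for x using that by (force simp: not_less)
      \<comment> \<open>a slope that supports \<open>f\<close> near \<open>l\<close> supports all of \<open>W\<close>: shrink \<open>z\<close> towards \<open>l\<close>\<close>
      have YmX: "m * X z \<le> Y z" if z: "z \<in> W" for z
      proof -
        define s where "s = r / (r + \<bar>X z\<bar>)"
        have s: "0 < s" "s \<le> 1" using r by (auto simp: s_def divide_simps)
        have "s * \<bar>X z\<bar> < r"
        proof -
          have "\<bar>X z\<bar> < r + \<bar>X z\<bar>" using r by simp
          then show ?thesis using r(1) by (simp add: s_def divide_simps)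
        qed
        then have sx: "\<bar>s * X z\<bar> < r" using s by (simp add: abs_mult)
        have "P ((1 - s) * 0 + s * X z) ((1 - s) * 0 + s * Y z) = (1 - s) *\<^sub>R l + s *\<^sub>R z"
          by (subst lin) (simp_all add: Pl PXY)
        also have "\<dots> \<in> W" using s lW z by (intro convexD[OF W(2)]) auto
        finally have "f (s * X z) \<le> s * Y z" using f_le by simp
        with fm[OF sx] have "s * (m * X z) \<le> s * Y z" by (simp add: algebra_simps)
        with s show ?thesis by simp
      qed
      define b where "b = of_real m * (\<i> * w) - a"
      have ba: "b \<bullet> (z - l) = D * (m * X z - Y z)" for z
      proof -
        have "(of_real m * v) \<bullet> y = m * (v \<bullet> y)" for v y :: complex by (simp add: inner_complex_def algebra_simps)
        moreover have "(\<i> * w) \<bullet> (z - l) = D * X z" "a \<bullet> (z - l) = D * Y z" using D by (simp_all add: X_def Y_def)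
        ultimately have "b \<bullet> (z - l) = m * (D * X z) - D * Y z"
          unfolding b_def inner_diff_left by simp
        then show ?thesis by (simp add: algebra_simps)
      qed
      have "Im (b * cnj (- a)) = - m * D"
        by (simp add: b_def D_def inner_complex_def algebra_simps)
      then have "Im (b * cnj (- a)) \<noteq> 0" using m D by simp
      moreover have "\<forall>z\<in>W. b \<bullet> (z - l) \<le> 0"
        using YmX D by (auto simp: ba mult_le_0_iff)
      moreover have "\<forall>z\<in>W. (- a) \<bullet> (z - l) \<le> 0" using a(2) by (simp add: inner_diff_right)
      ultimately have "has_corner_at W l"
        unfolding has_corner_at_iff[OF cl] by (intro conjI lW exI[of _ "- a"] exI[of _ b])
      with no show False by simp
    qed
  qed
  define \<gamma> \<delta> where "\<gamma> t = P (r * t) (f (r * t))" and "\<delta> z = X z / r" for t z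
  have rt: "\<bar>r * t\<bar> < r" "r * t \<in> {-r<..<r}" if "t \<in> {-1<..<1}" for t
  proof -
    have "\<bar>t\<bar> < 1" using that by auto
    then have "r * \<bar>t\<bar> < r * 1" using r(1) by (intro mult_strict_left_mono) auto
    then show "\<bar>r * t\<bar> < r" using r(1) by (simp add: abs_mult)
    then show "r * t \<in> {-r<..<r}" by auto
  qed
  have hom: "homeomorphism {-1<..<1} (frontier W \<inter> U) \<gamma> \<delta>"
  proof
    have "continuous_on {-1<..<1} (\<lambda>t. f (r * t))"
      by (rule continuous_on_compose2[OF contf]) (use rt(2) in \<open>auto intro!: continuous_intros\<close>)
    then show "continuous_on {-1<..<1} \<gamma>"
      unfolding \<gamma>_def P_def by (intro continuous_intros)
    show "continuous_on (frontier W \<inter> U) \<delta>"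
      unfolding \<delta>_def using r(1) by (intro continuous_intros continuous_on_subset[OF contXY(1)]) auto
    show "\<gamma> ` {-1<..<1} \<subseteq> frontier W \<inter> U"
    proof
      fix z assume "z \<in> \<gamma> ` {-1<..<1}"
      then obtain t where t: "t \<in> {-1<..<1}" "z = \<gamma> t" by blast
      then show "z \<in> frontier W \<inter> U" unfolding front using rt(1)[OF t(1)] by (simp add: \<gamma>_def XP)
    qed
    show "\<delta> ` (frontier W \<inter> U) \<subseteq> {-1<..<1}"
    proof
      fix t assume "t \<in> \<delta> ` (frontier W \<inter> U)"
      then obtain z where z: "z \<in> frontier W \<inter> U" "t = X z / r" unfolding \<delta>_def by blast
      then have "\<bar>t\<bar> < 1" using r(1) unfolding front by simp
      then show "t \<in> {-1<..<1}" by auto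
    qed
    show "\<delta> (\<gamma> t) = t" if "t \<in> {-1<..<1}" for t using r(1) by (simp add: \<gamma>_def \<delta>_def XP)
    show "\<gamma> (\<delta> z) = z" if "z \<in> frontier W \<inter> U" for z
      using that r(1) unfolding front by (simp add: \<gamma>_def \<delta>_def)
  qed
  have "(\<gamma> has_vector_derivative (of_real r * u)) (at 0)"
  proof -
    have fr: "((\<lambda>t. f (r * t)) has_real_derivative 0) (at 0)"
      using DERIV_chain2[of f 0 "\<lambda>t. r * t" 0 r UNIV] deriv by (auto intro!: derivative_eq_intros)
    have "((\<lambda>t. l + (r * t) *\<^sub>R u + f (r * t) *\<^sub>R w) has_vector_derivative (r *\<^sub>R u)) (at 0)"
      by (rule has_vector_derivative_eq_rhs, (rule derivative_intros has_vector_derivative_scaleR fr)+)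
         (auto intro!: derivative_eq_intros)
    then show ?thesis by (simp add: \<gamma>_def[abs_def] P_def scaleR_conv_of_real)
  qed
  moreover have "of_real r * u \<noteq> 0" using r(1) a(1) by (simp add: u_def)
  moreover have "\<gamma> 0 = l" by (simp add: \<gamma>_def f0 Pl)
  ultimately show ?thesis
    unfolding boundary_differentiable_at_def
    by (intro exI[of _ U] exI[of _ \<gamma>] exI[of _ \<delta>] exI[of _ "of_real r * u"] conjI hom \<open>open U\<close>)
qed

theorem singular_iff_corner:
  fixes W :: "complex set"
  assumes "compact W" "convex W" "aff_dim W = 2"
  shows "singular_boundary_point W l \<longleftrightarrow> has_corner_at W l"
proof -
  have "l \<in> frontier W" if "has_corner_at W l" using that by (simp add: has_corner_at_def)
  then show ?thesis
    using corner_not_differentiable[OF compact_imp_closed[OF assms(1)], of l] not_corner_differentiable[OF assms, of l]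
    unfolding singular_boundary_point_def by blast
qed

text \<open>Let \<open>K\<close> be the closed convex hull of the other extreme points. It does not contain
  \<open>l\<close>, since \<open>l\<close> would be an extreme point of \<open>K\<close> and so a limit of
  extreme points. Seen from \<open>l\<close>, in a frame in which \<open>K\<close> is in front, the slope
  \<open>f\<close> is continuous on the compact set \<open>K\<close>, and the points where it is largest and
  smallest span the two edges.\<close>

lemma isolated_extreme_point_edges:
  fixes W :: "complex set"
  assumes W: "compact W" "convex W" "aff_dim W = 2" and iso: "isolated_extreme_point W l"
  obtains a1 a2 w1 w2 where "Im (a2 * cnj a1) \<noteq> 0"
    "\<And>z. z \<in> W \<Longrightarrow> a1 \<bullet> (z - l) \<le> 0" "\<And>z. z \<in> W \<Longrightarrow> a2 \<bullet> (z - l) \<le> 0"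
    "w1 \<in> W" "w1 \<noteq> l" "a1 \<bullet> (w1 - l) = 0" "w2 \<in> W" "w2 \<noteq> l" "a2 \<bullet> (w2 - l) = 0"
proof -
  define E A where "E = {x. x extreme_point_of W}" and "A = E - {l}"
  have lE: "l \<in> E" and isoE: "l isolated_in E" using iso by (auto simp: isolated_extreme_point_def E_def isolated_in_def)
  have WE: "W = convex hull E" unfolding E_def by (rule Krein_Milman_Minkowski[OF W(1,2)])
  have EW: "E \<subseteq> W" by (auto simp: E_def extreme_point_of_def)
  define K where "K = convex hull (closure A)"
  have clA: "closure A \<subseteq> W" using EW W(1) by (intro closure_minimal compact_imp_closed) (auto simp: A_def)
  have "compact (closure A)"
    using bounded_subset[OF compact_imp_bounded[OF W(1)] order_trans[OF closure_subset clA]] by (simp add: compact_closure)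
  then have K: "compact K" unfolding K_def by (rule compact_convex_hull)
  have KW: "K \<subseteq> W" unfolding K_def by (rule hull_minimal[of "closure A" W convex]) (use clA W(2) in auto)
  have AK: "A \<subseteq> K" unfolding K_def by (rule order_trans[OF closure_subset hull_subset])
  have lK: "l \<notin> K"
  proof
    assume "l \<in> K"
    then have "l extreme_point_of K"
      using lE KW by (auto simp: E_def extreme_point_of_def)
    then have "l \<in> closure A" unfolding K_def by (rule extreme_point_of_convex_hull)
    then have "l islimpt E" using islimpt_subset[of l A E] by (auto simp: closure_def A_def)
    with isoE show False by (simp add: isolated_in_islimpt_iff)
  qed
  have "K \<noteq> {}"
  proof
    assume "K = {}"
    then have "E = {l}" using AK lE by (auto simp: A_def)
    with WE W(3) show False by simp
  qed
  obtain u d where ud: "u \<bullet> l < d" "\<And>x. x \<in> K \<Longrightarrow> d < u \<bullet> x"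
  proof -
    have "convex K" "closed K" using K by (simp_all add: compact_imp_closed K_def)
    then show ?thesis using separating_hyperplane_closed_point[OF _ _ lK] that by metis
  qed
  have pos: "0 < u \<bullet> (x - l)" if "x \<in> K" for x using ud(1) ud(2)[OF that] by (simp add: inner_diff_right)
  have u0: "u \<noteq> 0" using pos \<open>K \<noteq> {}\<close> by fastforce
  define f where "f z = ((\<i> * u) \<bullet> (z - l)) / (u \<bullet> (z - l))" for z
  have cont: "continuous_on K f"
    unfolding f_def by (intro continuous_intros) (use pos in force)
  obtain w1 where w1: "w1 \<in> K" "\<And>z. z \<in> K \<Longrightarrow> f z \<le> f w1"
    using continuous_attains_sup[OF K \<open>K \<noteq> {}\<close> cont] by blast
  obtain w2 where w2: "w2 \<in> K" "\<And>z. z \<in> K \<Longrightarrow> f w2 \<le> f z"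
    using continuous_attains_inf[OF K \<open>K \<noteq> {}\<close> cont] by blast
  define a1 a2 where "a1 = \<i> * u - of_real (f w1) * u" and "a2 = of_real (f w2) * u - \<i> * u"
  have a1: "a1 \<bullet> (z - l) = (u \<bullet> (z - l)) * (f z - f w1)" and a2: "a2 \<bullet> (z - l) = (u \<bullet> (z - l)) * (f w2 - f z)"
    if "z \<in> K" for z
  proof -
    have "(\<i> * u) \<bullet> (z - l) = (u \<bullet> (z - l)) * f z" using pos[OF that] by (simp add: f_def)
    moreover have "(of_real m * u) \<bullet> y = m * (u \<bullet> y)" for m y by (simp add: inner_complex_def algebra_simps)
    ultimately show "a1 \<bullet> (z - l) = (u \<bullet> (z - l)) * (f z - f w1)" "a2 \<bullet> (z - l) = (u \<bullet> (z - l)) * (f w2 - f z)"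
      by (simp_all add: a1_def a2_def inner_diff_left algebra_simps)
  qed
  have ext: "c \<bullet> (z - l) \<le> 0" if "\<And>x. x \<in> K \<Longrightarrow> c \<bullet> (x - l) \<le> 0" "z \<in> W" for c z
  proof -
    have "W \<subseteq> {z. c \<bullet> z \<le> c \<bullet> l}"
      unfolding WE
    proof (intro hull_minimal convex_halfspace_le subsetI)
      fix x assume "x \<in> E"
      then have "x = l \<or> x \<in> K" using AK by (auto simp: A_def)
      then show "x \<in> {z. c \<bullet> z \<le> c \<bullet> l}" using that(1)[of x] by (auto simp: inner_diff_right)
    qed
    then show ?thesis using that(2) by (auto simp: inner_diff_right)
  qed
  have s1: "a1 \<bullet> (z - l) \<le> 0" and s2: "a2 \<bullet> (z - l) \<le> 0" if "z \<in> W" for z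
    by (rule ext[OF _ that], simp add: a1 a2 mult_le_0_iff w1(2) w2(2) less_imp_le[OF pos])+
  \<comment> \<open>otherwise all of \<open>W\<close> is on one line through \<open>l\<close>\<close>
  have "f w1 \<noteq> f w2"
  proof
    assume eq: "f w1 = f w2"
    have fK: "f z = f w1" if "z \<in> K" for z using w1(2)[OF that] w2(2)[OF that] eq by simp
    have "a1 \<noteq> 0"
    proof
      assume "a1 = 0"
      then have "(\<i> - of_real (f w1)) * u = 0" by (simp add: a1_def left_diff_distrib)
      moreover have "\<i> - of_real (f w1) \<noteq> 0" by (simp add: complex_eq_iff)
      ultimately show False using u0 by simp
    qed
    have "W \<subseteq> {z. a1 \<bullet> z = a1 \<bullet> l}"
    proof
      fix z assume z: "z \<in> W"
      have "(- a1) \<bullet> (x - l) \<le> 0" if "x \<in> K" for x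
      proof -
        have "a1 \<bullet> (x - l) = 0" using a1[OF that] unfolding fK[OF that] by simp
        then show ?thesis by simp
      qed
      then have "(- a1) \<bullet> (z - l) \<le> 0" using z by (rule ext)
      with s1[OF z] show "z \<in> {z. a1 \<bullet> z = a1 \<bullet> l}" by (simp add: inner_diff_right)
    qed
    from aff_dim_subset[OF this] \<open>a1 \<noteq> 0\<close> W(3) show False by (simp add: aff_dim_hyperplane)
  qed
  moreover have "Im (a2 * cnj a1) = (f w1 - f w2) * (norm u)\<^sup>2"
  proof -
    have n: "(norm u)\<^sup>2 = Re u * Re u + Im u * Im u" using cmod_power2[of u] by (simp add: power2_eq_square)
    show ?thesis unfolding n by (simp add: a1_def a2_def algebra_simps)
  qed
  ultimately have indep: "Im (a2 * cnj a1) \<noteq> 0" using u0 by simp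
  have edges: "a1 \<bullet> (w1 - l) = 0" "a2 \<bullet> (w2 - l) = 0" using w1(1) w2(1) by (simp_all add: a1 a2)
  have "w1 \<in> W" "w2 \<in> W" "w1 \<noteq> l" "w2 \<noteq> l" using w1(1) w2(1) KW lK by auto
  then show thesis
    by (intro that[OF indep, of w1 w2] s1 s2 edges)
qed

section \<open>Slices of the spectral scale\<close>

text \<open>This is the one-dimensional step of the Hahn-Banach theorem. Each point of \<open>B\<close> on the left of
  the slice bounds the slope \<open>\<beta>\<close> from below, and each point on the right bounds it from
  above. These bounds are compatible because the segment that joins two such points crosses the slice.\<close>

lemma extend_support:
  fixes B :: "(real \<times> complex) set"
  assumes B: "convex B" and lo: "x \<in> B" "fst x < t" and hi: "y \<in> B" "t < fst y"
    and sup: "\<And>z. (t, z) \<in> B \<Longrightarrow> a \<bullet> z \<le> b"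
  obtains \<beta> where "\<And>p. p \<in> B \<Longrightarrow> (\<beta>, a) \<bullet> p \<le> \<beta> * t + b"
proof -
  define S where "S = (\<lambda>p. (a \<bullet> snd p - b) / (t - fst p)) ` {p \<in> B. fst p < t}"
  have key: "(a \<bullet> snd p - b) / (t - fst p) \<le> (b - a \<bullet> snd q) / (fst q - t)"
    if p: "p \<in> B" "fst p < t" and q: "q \<in> B" "t < fst q" for p q
  proof -
    define s where "s = (t - fst p) / (fst q - fst p)"
    have d: "fst q - fst p > 0" using p q by simp
    have s: "0 \<le> s" "s \<le> 1" "1 - s = (fst q - t) / (fst q - fst p)" using p q by (auto simp: s_def field_simps)
    have "(1 - s) *\<^sub>R p + s *\<^sub>R q \<in> B" using p q s by (intro convexD[OF B]) auto
    moreover have "fst ((1 - s) *\<^sub>R p + s *\<^sub>R q) = t"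
    proof -
      have "fst ((1 - s) *\<^sub>R p + s *\<^sub>R q) = fst p + s * (fst q - fst p)" by (simp add: algebra_simps)
      also have "\<dots> = t" using d by (simp add: s_def)
      finally show ?thesis .
    qed
    ultimately have "(t, (1 - s) *\<^sub>R snd p + s *\<^sub>R snd q) \<in> B"
      by (metis prod.collapse snd_add snd_scaleR)
    from sup[OF this] have "(1 - s) * (a \<bullet> snd p) + s * (a \<bullet> snd q) \<le> b" by (simp add: inner_add_right)
    then have "(fst q - t) * (a \<bullet> snd p) + (t - fst p) * (a \<bullet> snd q) \<le> b * (fst q - fst p)"
    proof -
      have "((fst q - t) * (a \<bullet> snd p) + (t - fst p) * (a \<bullet> snd q)) / (fst q - fst p) \<le> b"
        using \<open>(1 - s) * _ + _ \<le> b\<close> unfolding s(3) by (simp add: s_def add_divide_distrib)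
      then show ?thesis using d by (simp add: divide_le_eq)
    qed
    then have "(a \<bullet> snd p - b) * (fst q - t) \<le> (b - a \<bullet> snd q) * (t - fst p)" by (simp add: algebra_simps)
    then show ?thesis using p q by (simp add: frac_le_eq divide_simps)
  qed
  have Sne: "S \<noteq> {}" using lo unfolding S_def by blast
  have up: "s \<le> (b - a \<bullet> snd q) / (fst q - t)" if "s \<in> S" "q \<in> B" "t < fst q" for s q
    using that key by (auto simp: S_def)
  then have bdd: "bdd_above S" using hi by (intro bdd_aboveI) blast
  show thesis
  proof (rule that)
    fix p assume p: "p \<in> B"
    consider "fst p < t" | "fst p = t" | "t < fst p" by linarith
    then have "Sup S * (fst p - t) \<le> b - a \<bullet> snd p"
    proof cases
      case 1
      then have "(a \<bullet> snd p - b) / (t - fst p) \<le> Sup S" using p bdd by (intro cSup_upper) (auto simp: S_def)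
      then show ?thesis using 1 by (simp add: field_simps)
    next
      case 2
      then show ?thesis using sup[of "snd p"] p by (metis diff_ge_0_iff_ge diff_self mult_zero_right prod.collapse)
    next
      case 3
      have "Sup S \<le> (b - a \<bullet> snd p) / (fst p - t)" using up[OF _ p 3] Sne by (intro cSup_least) auto
      then show ?thesis using 3 by (simp add: field_simps)
    qed
    then show "(Sup S, a) \<bullet> p \<le> Sup S * t + b" by (simp add: inner_prod_def algebra_simps)
  qed
qed

text \<open>A nearby extreme point \<open>x \<noteq> y\<close> would be the midpoint of \<open>y\<close> and \<open>2 x
  - y\<close>.\<close>

lemma isolated_extreme_point_of_cone:
  fixes S :: "'a::euclidean_space set"
  assumes ext: "y extreme_point_of S" and e: "e > 0"
    and cone: "\<And>x. x \<in> S \<Longrightarrow> dist x y < e \<Longrightarrow> 2 *\<^sub>R x - y \<in> S"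
  shows "isolated_extreme_point S y"
  unfolding isolated_extreme_point_def isolated_in_dist_Ex_iff
proof (intro conjI exI[of _ e] ballI impI)
  show "y \<in> {x. x extreme_point_of S}" using ext by simp
  fix x assume x: "x \<in> {x. x extreme_point_of S}" and d: "dist y x < e"
  have xe: "x extreme_point_of S" using x by simp
  then have "x \<in> S" by (simp add: extreme_point_of_def)
  then have "2 *\<^sub>R x - y \<in> S" using d by (intro cone) (simp_all add: dist_commute)
  then have "x + (x - y) \<in> S" by (simp add: scaleR_2 algebra_simps)
  moreover have "x - (x - y) \<in> S" using ext by (simp add: extreme_point_of_def)
  ultimately show "x = y" using extreme_point_symmetric_segment[OF xe] by fastforce
qed (fact e)

lemma slice_map_eq: "slice_map n k z = (real k / real n, of_real (real k / real n) * z)"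
  by (simp add: slice_map_def)

lemma inner_slice_map: "(\<beta>, a) \<bullet> slice_map n k z = real k / real n * (\<beta> + a \<bullet> z)"
proof -
  have "a \<bullet> (of_real t * z) = t * (a \<bullet> z)" for t by (simp add: inner_complex_def algebra_simps)
  then show ?thesis unfolding slice_map_eq inner_prod_def by (simp only: fst_conv snd_conv) (simp add: algebra_simps add_divide_distrib)
qed

lemma slice_map_affine:
  "slice_map n k (u *\<^sub>R x + v *\<^sub>R y) = u *\<^sub>R slice_map n k x + v *\<^sub>R slice_map n k y" if "u + v = 1"
proof -
  define t where "t = real k / real n"
  have t: "t * u + t * v = t" using that by (metis distrib_left mult.right_neutral)
  show ?thesis
    unfolding slice_map_eq t_def[symmetric]
    by (rule prod_eqI) (simp_all add: t algebra_simps scaleR_conv_of_real)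
qed

lemma slice_map_inject: "0 < k \<Longrightarrow> 0 < n \<Longrightarrow> slice_map n k x = slice_map n k y \<longleftrightarrow> x = y"
  by (simp add: slice_map_def)

lemma slice_map_surj:
  fixes c :: "complex ^ 'n ^ 'n"
  assumes "0 < k" "p \<in> spectral_scale c" "fst p = real k / real CARD('n)"
  obtains z where "z \<in> k_numerical_range k c" "p = slice_map CARD('n) k z"
proof -
  define z where "z = of_real (real CARD('n) / real k) * snd p"
  have "p = slice_map CARD('n) k z"
    using assms(1,3) by (simp add: slice_map_def z_def prod_eq_iff)
  moreover from this have "z \<in> k_numerical_range k c"
    using assms(2) slice_map_in_spectral_scale[OF assms(1), of z c] by simp
  ultimately show thesis using that by blast
qed

lemma
  fixes c :: "complex ^ 'n ^ 'n"
  assumes k: "0 < k"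
  shows convex_k_numerical_range: "convex (k_numerical_range k c)"
    and compact_k_numerical_range: "compact (k_numerical_range k c)"
proof -
  let ?t = "real k / real CARD('n)"
  let ?S = "spectral_scale c \<inter> {p. (1, 0) \<bullet> p = ?t}"
  let ?f = "\<lambda>p :: real \<times> complex. (real CARD('n) / real k) *\<^sub>R snd p"
  have eq: "k_numerical_range k c = ?f ` ?S"
  proof (intro equalityI subsetI)
    fix z assume "z \<in> k_numerical_range k c"
    then have "slice_map CARD('n) k z \<in> ?S"
      by (simp add: slice_map_in_spectral_scale[OF k]) (simp add: slice_map_def inner_prod_def)
    moreover have "z = ?f (slice_map CARD('n) k z)" using k by (simp add: slice_map_def scaleR_conv_of_real)
    ultimately show "z \<in> ?f ` ?S" by (rule rev_image_eqI)
  next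
    fix z assume "z \<in> ?f ` ?S"
    then obtain p where p: "p \<in> spectral_scale c" "fst p = ?t" "z = ?f p" by (auto simp: inner_prod_def)
    from slice_map_surj[OF k p(1,2)] obtain w where w: "w \<in> k_numerical_range k c" "p = slice_map CARD('n) k w" .
    then have "z = w" using k by (simp add: p(3) slice_map_def scaleR_conv_of_real)
    with w show "z \<in> k_numerical_range k c" by simp
  qed
  have lin: "linear ?f" by (rule linearI) (simp_all add: algebra_simps)
  show "convex (k_numerical_range k c)"
    unfolding eq by (intro convex_linear_image lin convex_Int convex_spectral_scale convex_hyperplane)
  show "compact (k_numerical_range k c)"
    unfolding eq by (intro compact_continuous_image linear_continuous lin compact_Int_closed compact_spectral_scale closed_hyperplane)
qed

text \<open>The images of \<open>0\<close> and \<open>1\<close> lie strictly on the two sides of the slice, as \<open>0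
  < k < n\<close>.\<close>

lemma extend_line_of_support:
  fixes c :: "complex ^ 'n ^ 'n"
  assumes k: "0 < k" "k < CARD('n)" and sup: "\<And>z. z \<in> k_numerical_range k c \<Longrightarrow> a \<bullet> (z - l) \<le> 0"
  obtains \<beta> where "\<And>p. p \<in> spectral_scale c \<Longrightarrow> (\<beta>, a) \<bullet> p \<le> (\<beta>, a) \<bullet> slice_map CARD('n) k l"
proof -
  let ?t = "real k / real CARD('n)"
  have z01: "projection (0 :: complex ^ 'n ^ 'n)" "projection (mat 1 :: complex ^ 'n ^ 'n)"
    by (simp_all add: projection_def self_adjoint_def)
  have lo: "Psi c 0 \<in> spectral_scale c" "fst (Psi c 0) < ?t"
    using projection_effect[OF z01(1)] k by (auto simp: spectral_scale_def fst_Psi)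
  have hi: "Psi c (mat 1) \<in> spectral_scale c" "?t < fst (Psi c (mat 1))"
    using projection_effect[OF z01(2)] k by (auto simp: spectral_scale_def fst_Psi trace_I)
  have bound: "a \<bullet> z \<le> ?t * (a \<bullet> l)" if z: "(?t, z) \<in> spectral_scale c" for z
  proof -
    from slice_map_surj[OF k(1) z] obtain w where w: "w \<in> k_numerical_range k c" "(?t, z) = slice_map CARD('n) k w" by auto
    have "a \<bullet> z = (0, a) \<bullet> (?t, z)" by (simp add: inner_prod_def)
    also have "\<dots> = ?t * (a \<bullet> w)" unfolding w(2) inner_slice_map by simp
    also have "\<dots> \<le> ?t * (a \<bullet> l)" using sup[OF w(1)] by (intro mult_left_mono) (simp_all add: inner_diff_right)
    finally show ?thesis .
  qed
  from extend_support[OF convex_spectral_scale lo hi bound]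
  obtain \<beta> where b: "\<And>p. p \<in> spectral_scale c \<Longrightarrow> (\<beta>, a) \<bullet> p \<le> \<beta> * ?t + ?t * (a \<bullet> l)" by blast
  have "\<beta> * ?t + ?t * (a \<bullet> l) = (\<beta>, a) \<bullet> slice_map CARD('n) k l"
    unfolding inner_slice_map by (simp add: algebra_simps add_divide_distrib)
  with b show thesis by (intro that[of \<beta>]) simp
qed

section \<open>Faces over an edge of the numerical range\<close>

text \<open>The lowest and the highest point of the face are the images of the two support projections. An operator over
  the slice that has the trace of one of these projections equals it, so a slice with two points is at neither
  end.\<close>

lemma exposed_face_both_sides:
  fixes c :: "complex ^ 'n ^ 'n"
  assumes sup: "\<And>x. x \<in> spectral_scale c \<Longrightarrow> p \<bullet> x \<le> b"
    and x: "x \<in> spectral_scale c" "p \<bullet> x = b" and y: "y \<in> spectral_scale c" "p \<bullet> y = b"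
    and xy: "x \<noteq> y" "fst x = fst y"
  obtains u v where "u \<in> spectral_scale c" "p \<bullet> u = b" "fst u < fst x" "v \<in> spectral_scale c" "p \<bullet> v = b" "fst x < fst v"
proof -
  let ?n = "real CARD('n)"
  define h where "h = support_op c p"
  have th: "Re (trace (h ** a)) = ?n * (p \<bullet> Psi c a)" if "a \<in> effects" for a
    using inner_Psi[OF effects_self_adjoint[OF that]] by (simp add: h_def)
  have "self_adjoint h" by (simp add: h_def self_adjoint_support_op)
  then obtain zm zp where pair: "support_pair h zm zp" using support_projections by metis
  note M = support_pair_maximizers[OF pair] support_pair_max[OF pair]
  have z: "projection zm" "projection zp" "h ** zp = h ** zm" using pair by (simp_all add: support_pair_def)
  obtain a a' where a: "a \<in> effects" "Psi c a = x" and a': "a' \<in> effects" "Psi c a' = y"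
    using x(1) y(1) by (auto simp: spectral_scale_def)
  have eff: "zm \<in> effects" "zp \<in> effects" using z projection_effect by auto
  have zB: "Psi c zm \<in> spectral_scale c" "Psi c zp \<in> spectral_scale c" using eff by (auto simp: spectral_scale_def)
  have max: "Re (trace (h ** zm)) = ?n * b"
  proof (rule antisym)
    show "Re (trace (h ** zm)) \<le> ?n * b" unfolding th[OF eff(1)] using sup[OF zB(1)] by (intro mult_left_mono) auto
    show "?n * b \<le> Re (trace (h ** zm))" using M(2)[OF a(1)] x(2) unfolding th[OF a(1)] a(2) by simp
  qed
  have int: "a \<in> op_interval zm zp" "a' \<in> op_interval zm zp"
    unfolding M(1) max using a a' x y th[OF a(1)] th[OF a'(1)] by simp_all
  have val: "p \<bullet> Psi c zm = b" "p \<bullet> Psi c zp = b"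
    using max th[OF eff(1)] th[OF eff(2)] z(3) by simp_all
  have tr: "Re (trace a) = Re (trace a')"
    using xy(2) by (simp add: fst_Psi flip: a(2) a'(2))
  have le: "op_le zm a" "op_le zm a'" "op_le a zp" "op_le a' zp" using int by (auto simp: op_interval_def)
  have "Re (trace zm) \<noteq> Re (trace a)"
    using op_le_trace_eq[OF le(1)] op_le_trace_eq[OF le(2)] tr xy(1) a(2) a'(2) by auto
  then have lt: "Re (trace zm) < Re (trace a)" using op_le_trace_mono[OF le(1)] by simp
  have "Re (trace a) \<noteq> Re (trace zp)"
    using op_le_trace_eq[OF le(3)] op_le_trace_eq[OF le(4)] tr xy(1) a(2) a'(2) by auto
  then have gt: "Re (trace a) < Re (trace zp)" using op_le_trace_mono[OF le(3)] by simp
  show thesis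
  proof (rule that[OF zB(1) val(1) _ zB(2) val(2)])
    show "fst (Psi c zm) < fst x" "fst x < fst (Psi c zp)"
      using lt gt by (simp_all add: fst_Psi divide_strict_right_mono flip: a(2))
  qed
qed

lemma aff_dim_transversal_slice:
  fixes F :: "(real \<times> complex) set"
  assumes "x \<in> F" "y \<in> F" "x \<noteq> y" "fst x = fst y" "u \<in> F" "fst u \<noteq> fst x"
  shows "2 \<le> aff_dim F"
proof -
  let ?H = "{v. (1, 0) \<bullet> v = fst x}"
  have sub: "F \<subseteq> affine hull F" by (rule hull_subset)
  have e: "(1, 0) \<bullet> v = fst v" for v :: "real \<times> complex" by (simp add: inner_prod_def)
  have "{x, y} \<subseteq> affine hull F \<inter> ?H" using assms sub by (auto simp: e)
  then have "aff_dim {x, y} \<le> aff_dim (affine hull F \<inter> ?H)" by (rule aff_dim_subset)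
  moreover have "aff_dim {x, y} = 1" using assms(3) by simp
  moreover have "\<not> affine hull F \<subseteq> ?H" using assms(5,6) sub by (auto simp: e)
  moreover have "affine hull F \<inter> ?H \<noteq> {}" using \<open>{x, y} \<subseteq> _\<close> by auto
  ultimately show ?thesis
    using aff_dim_affine_Int_hyperplane[OF affine_affine_hull[of F], of "(1, 0)" "fst x"] by simp
qed

lemma collinear_plane_slice:
  fixes a :: complex and t :: real
  assumes "a \<noteq> 0"
  shows "collinear ({x. (\<beta>, a) \<bullet> x = b} \<inter> {x. fst x = t})"
proof -
  have e: "(1, 0) \<bullet> v = fst v" for v :: "real \<times> complex" by (simp add: inner_prod_def)
  have nz: "(\<beta>, a) \<noteq> 0" using assms by (simp add: zero_prod_def)
  have "\<not> {x. (\<beta>, a) \<bullet> x = b} \<subseteq> {v. (1, 0) \<bullet> v = t}"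
  proof
    define s where "s = (b - \<beta> * (t + 1)) / (a \<bullet> a)"
    assume "{x. (\<beta>, a) \<bullet> x = b} \<subseteq> {v. (1, 0) \<bullet> v = t}"
    moreover have "(t + 1, s *\<^sub>R a) \<in> {x. (\<beta>, a) \<bullet> x = b}"
      using assms by (simp add: inner_prod_def s_def)
    ultimately have "(t + 1, s *\<^sub>R a) \<in> {v. (1, 0) \<bullet> v = t}" by blast
    then show False by (simp add: e)
  qed
  then have "aff_dim ({x. (\<beta>, a) \<bullet> x = b} \<inter> {v. (1, 0) \<bullet> v = t}) \<le> 1"
    using aff_dim_affine_Int_hyperplane[OF affine_hyperplane[of "(\<beta>, a)" b], of "(1, 0)" t] nz
    by (simp add: aff_dim_hyperplane)
  then show ?thesis by (simp add: collinear_aff_dim e)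
qed

text \<open>Join \<open>g\<close> to that one of the points \<open>h\<close>, \<open>h'\<close> of the line which is on
  the other side of the slice; the crossing point is not on the line, because \<open>g\<close> is not.\<close>

lemma slice_off_line_point:
  fixes G :: "(real \<times> complex) set"
  assumes G: "convex G" "x \<in> G" "h \<in> G" "h' \<in> G" "g \<in> G" and side: "fst h < fst x" "fst x < fst h'"
    and A: "affine A" "x \<in> A" "h \<in> A" "h' \<in> A" "g \<notin> A"
  shows "\<exists>y\<in>G. fst y = fst x \<and> y \<noteq> x"
proof -
  have cross: "\<exists>y\<in>G. fst y = fst x \<and> y \<noteq> x"
    if f: "f \<in> G" "f \<in> A" "(fst g - fst x) * (fst f - fst x) < 0" for f
  proof -
    define s where "s = (fst x - fst g) / (fst f - fst g)"
    have d: "fst f - fst g \<noteq> 0" using f(3) by (metis diff_eq_eq add_0 not_square_less_zero)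
    have s: "0 < s" "s < 1"
      using f(3) by (auto simp: s_def mult_less_0_iff divide_simps)
    define y where "y = (1 - s) *\<^sub>R g + s *\<^sub>R f"
    have "y \<in> G" unfolding y_def using s G f by (intro convexD) auto
    moreover have "fst y = fst x"
    proof -
      have "fst y = fst g + s * (fst f - fst g)" by (simp add: y_def algebra_simps)
      then show ?thesis using d by (simp add: s_def)
    qed
    moreover have "y \<noteq> x"
    proof
      assume "y = x"
      then have "(1 - s) *\<^sub>R g = x - s *\<^sub>R f" by (simp add: y_def algebra_simps)
      then have "(1 / (1 - s)) *\<^sub>R ((1 - s) *\<^sub>R g) = (1 / (1 - s)) *\<^sub>R (x - s *\<^sub>R f)" by simp
      then have "g = (1 / (1 - s)) *\<^sub>R x + (- s / (1 - s)) *\<^sub>R f"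
        using s by (simp add: scaleR_right_diff_distrib)
      moreover have "1 / (1 - s) + - s / (1 - s) = 1" using s by (simp add: divide_simps)
      ultimately have "g \<in> A" using mem_affine[OF A(1,2) f(2)] by metis
      with A show False by simp
    qed
    ultimately show ?thesis by blast
  qed
  consider "fst g = fst x" | "fst g < fst x" | "fst x < fst g" by linarith
  then show ?thesis
  proof cases
    case 1
    with G A show ?thesis by blast
  next
    case 2
    with side G A show ?thesis by (intro cross[of h']) (auto simp: mult_less_0_iff)
  next
    case 3
    with side G A show ?thesis by (intro cross[of h]) (auto simp: mult_less_0_iff)
  qed
qed

text \<open>Points of \<open>G\<close> are limits of its relative interior, so that there are relative interior points
  on both sides.\<close>

lemma rel_interior_meets_slice:
  fixes G :: "(real \<times> complex) set"
  assumes G: "convex G" "u \<in> G" "v \<in> G" "fst u < t" "t < fst v"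
  shows "\<exists>y\<in>rel_interior G. fst y = t"
proof -
  have cl: "u \<in> closure (rel_interior G)" "v \<in> closure (rel_interior G)"
    using G closure_subset by (auto simp: convex_closure_rel_interior)
  have "open {x :: real \<times> complex. fst x < t}" "open {x :: real \<times> complex. t < fst x}"
    by (intro open_Collect_less continuous_intros)+
  then have "{x. fst x < t} \<inter> rel_interior G \<noteq> {}" "{x. t < fst x} \<inter> rel_interior G \<noteq> {}"
    using cl G open_Int_closure_eq_empty by blast+
  then obtain u' v' where uv: "u' \<in> rel_interior G" "fst u' < t" "v' \<in> rel_interior G" "t < fst v'" by blast
  define s where "s = (t - fst u') / (fst v' - fst u')"
  have s: "0 \<le> s" "s \<le> 1" using uv by (auto simp: s_def divide_simps)
  have "(1 - s) *\<^sub>R u' + s *\<^sub>R v' \<in> rel_interior G"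
    using s uv by (intro convexD[OF convex_rel_interior[OF G(1)]]) auto
  moreover have "fst ((1 - s) *\<^sub>R u' + s *\<^sub>R v') = t"
  proof -
    have "fst ((1 - s) *\<^sub>R u' + s *\<^sub>R v') = fst u' + s * (fst v' - fst u')" by (simp add: algebra_simps)
    then show ?thesis using uv by (simp add: s_def)
  qed
  ultimately show ?thesis by blast
qed

lemma line_eq:
  fixes a b d :: complex
  assumes "a \<noteq> 0" "b \<noteq> 0" "d \<noteq> 0" "a \<bullet> d = 0" "b \<bullet> d = 0"
  shows "{z. a \<bullet> (z - l) = 0} = {z. b \<bullet> (z - l) = 0}"
proof -
  have "Im (b * cnj a) = 0" using inner_eq_zero_both[of b a d] assms by auto
  then obtain r where r: "b = of_real r * a" using parallel_normals[OF _ assms(1)] by metis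
  have "r \<noteq> 0" using r assms(2) by auto
  moreover have "b \<bullet> x = r * (a \<bullet> x)" for x by (simp add: r inner_complex_def algebra_simps)
  ultimately show ?thesis by simp
qed

lemma tangent_line_of_supportI:
  fixes a :: complex
  assumes "a \<noteq> 0" "\<And>z. z \<in> W \<Longrightarrow> a \<bullet> (z - l) \<le> 0" "l \<in> W"
  shows "tangent_line_of_support W l {z. a \<bullet> (z - l) = 0}"
  unfolding tangent_line_of_support_def supporting_hyperplane_def
  using assms by (intro conjI exI[of _ a] exI[of _ "a \<bullet> l"]) (auto simp: inner_diff_right)

text \<open>The line of an edge is a line of support, so on it the product of the two sectorial forms is \<open>\<le>
  0\<close>; at the far end of the edge both forms are \<open>\<le> 0\<close>, so that one of them vanishes
  there and the lines agree.\<close>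

lemma sectorial_tangent_lines_unique:
  assumes sec: "sectorial_tangent_lines W l L1 L2" and lW: "l \<in> W" and indep: "Im (a2 * cnj a1) \<noteq> 0"
    and sup: "\<And>z. z \<in> W \<Longrightarrow> a1 \<bullet> (z - l) \<le> 0" "\<And>z. z \<in> W \<Longrightarrow> a2 \<bullet> (z - l) \<le> 0"
    and w1: "w1 \<in> W" "w1 \<noteq> l" "a1 \<bullet> (w1 - l) = 0" and w2: "w2 \<in> W" "w2 \<noteq> l" "a2 \<bullet> (w2 - l) = 0"
  shows "L1 = {z. a1 \<bullet> (z - l) = 0} \<and> L2 = {z. a2 \<bullet> (z - l) = 0} \<or>
         L1 = {z. a2 \<bullet> (z - l) = 0} \<and> L2 = {z. a1 \<bullet> (z - l) = 0}"
proof -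
  obtain b1 b2 where b: "b1 \<noteq> 0" "b2 \<noteq> 0"
    and L: "L1 = {z. b1 \<bullet> (z - l) = 0}" "L2 = {z. b2 \<bullet> (z - l) = 0}"
    and bW: "W \<subseteq> {z. b1 \<bullet> (z - l) \<le> 0}" "W \<subseteq> {z. b2 \<bullet> (z - l) \<le> 0}"
    and all: "\<forall>L. tangent_line_of_support W l L \<longrightarrow> L \<subseteq> {z. (b1 \<bullet> (z - l)) * (b2 \<bullet> (z - l)) \<le> 0}"
    using sec unfolding sectorial_tangent_lines_def by (elim conjE exE) (rule that; assumption)
  have nz: "a1 \<noteq> 0" "a2 \<noteq> 0" using indep by auto
  have on: "L1 = {z. a \<bullet> (z - l) = 0} \<or> L2 = {z. a \<bullet> (z - l) = 0}"
    if a: "a \<noteq> 0" "\<And>z. z \<in> W \<Longrightarrow> a \<bullet> (z - l) \<le> 0" and w: "w \<in> W" "w \<noteq> l" "a \<bullet> (w - l) = 0" for a w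
  proof -
    have "{z. a \<bullet> (z - l) = 0} \<subseteq> {z. (b1 \<bullet> (z - l)) * (b2 \<bullet> (z - l)) \<le> 0}"
      using all tangent_line_of_supportI[OF a lW] by simp
    then have "(b1 \<bullet> (w - l)) * (b2 \<bullet> (w - l)) \<le> 0" using w by blast
    moreover have "b1 \<bullet> (w - l) \<le> 0" "b2 \<bullet> (w - l) \<le> 0" using bW w by auto
    ultimately have "b1 \<bullet> (w - l) = 0 \<or> b2 \<bullet> (w - l) = 0" by (auto simp: mult_le_0_iff)
    then show ?thesis
      unfolding L using line_eq[OF b(1) a(1), of "w - l" l] line_eq[OF b(2) a(1), of "w - l" l] w by auto
  qed
  have "{z. a1 \<bullet> (z - l) = 0} \<noteq> {z. a2 \<bullet> (z - l) = 0}"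
  proof
    assume "{z. a1 \<bullet> (z - l) = 0} = {z. a2 \<bullet> (z - l) = 0}"
    then have "a2 \<bullet> (w1 - l) = 0" using w1 by blast
    from inner_eq_zero_both[OF indep w1(3) this] w1 show False by simp
  qed
  with on[OF nz(1) sup(1) w1] on[OF nz(2) sup(2) w2] show ?thesis by metis
qed

text \<open>The local cone at the corner, given by \<open>spectral_scale_corner_face\<close> for the spectral scale, is
  inherited by the slice, because doubling a displacement in the slice does not leave its plane.\<close>

lemma corner_imp_isolated:
  fixes c :: "complex ^ 'n ^ 'n"
  assumes k: "0 < k" "k < CARD('n)" and corner: "has_corner_at (k_numerical_range k c) l"
  shows "isolated_extreme_point (k_numerical_range k c) l"
proof -
  let ?W = "k_numerical_range k c" and ?p = "slice_map CARD('n) k"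
  have n: "0 < CARD('n)" by simp
  have cl: "closed ?W" using compact_k_numerical_range[OF k(1)] by (rule compact_imp_closed)
  obtain a b where lW: "l \<in> ?W" and ab: "Im (b * cnj a) \<noteq> 0"
    and sup: "\<forall>z\<in>?W. a \<bullet> (z - l) \<le> 0" "\<forall>z\<in>?W. b \<bullet> (z - l) \<le> 0"
    using corner unfolding has_corner_at_iff[OF cl] by (elim conjE exE) (rule that; assumption)
  obtain \<alpha> where \<alpha>: "\<And>x. x \<in> spectral_scale c \<Longrightarrow> (\<alpha>, a) \<bullet> x \<le> (\<alpha>, a) \<bullet> ?p l"
    by (rule extend_line_of_support[OF k sup(1)[rule_format]]) (assumption, rule that)
  obtain \<beta> where \<beta>: "\<And>x. x \<in> spectral_scale c \<Longrightarrow> (\<beta>, b) \<bullet> x \<le> (\<beta>, b) \<bullet> ?p l"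
    by (rule extend_line_of_support[OF k sup(2)[rule_format]]) (assumption, rule that)
  have lB: "?p l \<in> spectral_scale c" using lW by (simp add: slice_map_in_spectral_scale[OF k(1)])
  have indep: "Im (snd (\<beta>, b) * cnj (snd (\<alpha>, a))) \<noteq> 0" using ab by simp
  obtain zm zp where F: "Psi c ` op_interval zm zp = {x \<in> spectral_scale c. (\<alpha>, a) \<bullet> x = (\<alpha>, a) \<bullet> ?p l \<and> (\<beta>, b) \<bullet> x = (\<beta>, b) \<bullet> ?p l}"
    and cone: "\<And>y. y \<in> Psi c ` op_interval zm zp \<Longrightarrow>
       \<exists>\<epsilon>>0. \<forall>x\<in>spectral_scale c. dist x y < \<epsilon> \<longrightarrow> 2 *\<^sub>R x - y \<in> spectral_scale c"
    using spectral_scale_corner_face[OF indep \<alpha> \<beta> lB refl refl] by (metis (no_types, lifting))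
  have "?p l \<in> Psi c ` op_interval zm zp" unfolding F using lB by simp
  from cone[OF this] obtain \<epsilon> where \<epsilon>: "\<epsilon> > 0"
    "\<And>x. x \<in> spectral_scale c \<Longrightarrow> dist x (?p l) < \<epsilon> \<Longrightarrow> 2 *\<^sub>R x - ?p l \<in> spectral_scale c" by blast
  have ext: "l extreme_point_of ?W"
    unfolding extreme_point_of_def
  proof (intro conjI lW ballI notI)
    fix u v assume u: "u \<in> ?W" and v: "v \<in> ?W" and luv: "l \<in> open_segment u v"
    then obtain s where s: "u \<noteq> v" "0 < s" "s < 1" "l = (1 - s) *\<^sub>R u + s *\<^sub>R v" by (auto simp: in_segment)
    have zero: "d \<bullet> (v - u) = 0" if d: "\<forall>z\<in>?W. d \<bullet> (z - l) \<le> 0" for d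
    proof -
      have "u - l = - s *\<^sub>R (v - u)" "v - l = (1 - s) *\<^sub>R (v - u)" unfolding s(4) by (simp_all add: algebra_simps)
      then have "- s * (d \<bullet> (v - u)) \<le> 0" "(1 - s) * (d \<bullet> (v - u)) \<le> 0"
        using d u v by (metis inner_scaleR_right)+
      with s show ?thesis by (simp add: mult_le_0_iff zero_le_mult_iff)
    qed
    have "v - u = 0" using inner_eq_zero_both[OF ab zero[OF sup(1)] zero[OF sup(2)]] .
    with s show False by simp
  qed
  have cone': "2 *\<^sub>R z - l \<in> ?W" if z: "z \<in> ?W" "dist z l < \<epsilon>" for z
  proof -
    define t where "t = real k / real CARD('n)"
    have "?p z - ?p l = (0, of_real t * (z - l))"
      unfolding slice_map_eq t_def[symmetric] by (simp add: right_diff_distrib)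
    moreover have "0 \<le> t" by (simp add: t_def)
    ultimately have "dist (?p z) (?p l) = real k / real CARD('n) * dist z l"
      unfolding t_def[symmetric] by (simp add: dist_norm norm_Pair norm_mult)
    also have "\<dots> \<le> 1 * dist z l" using k by (intro mult_right_mono) auto
    finally have d: "dist (?p z) (?p l) < \<epsilon>" using z by simp
    have "2 *\<^sub>R ?p z - ?p l = ?p (2 *\<^sub>R z - l)"
      using slice_map_affine[of 2 "-1" "CARD('n)" k z l] by simp
    then show ?thesis
      using \<epsilon>(2)[OF _ d] z(1) by (simp add: slice_map_in_spectral_scale[OF k(1)])
  qed
  show ?thesis by (rule isolated_extreme_point_of_cone[OF ext \<epsilon>(1) cone'])
qed

lemma slice_map_line:
  assumes "0 < k" "0 < n" "(\<beta>, a) \<bullet> slice_map n k z = (\<beta>, a) \<bullet> slice_map n k l"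
  shows "a \<bullet> (z - l) = 0"
  using assms by (simp add: inner_slice_map inner_diff_right)

text \<open>Among the points of the face only \<open>Psi c zm\<close> has the smallest first coordinate, since an
  operator above \<open>zm\<close> with the same trace is \<open>zm\<close>; so it is an extreme point, and
  likewise for \<open>zp\<close>.\<close>

lemma central_endpoints_isolated:
  fixes c :: "complex ^ 'n ^ 'n"
  assumes face: "Psi c ` op_interval zm zp face_of spectral_scale c" and le: "op_le zm zp"
    and cone: "\<And>y. y \<in> Psi c ` op_interval zm zp \<Longrightarrow>
       \<exists>\<epsilon>>0. \<forall>x\<in>spectral_scale c. dist x y < \<epsilon> \<longrightarrow> 2 *\<^sub>R x - y \<in> spectral_scale c"
  shows "isolated_extreme_point (spectral_scale c) (Psi c zm)"
    and "isolated_extreme_point (spectral_scale c) (Psi c zp)"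
proof -
  let ?F = "Psi c ` op_interval zm zp"
  have mem: "Psi c zm \<in> ?F" "Psi c zp \<in> ?F" using le op_le_refl by (auto simp: op_interval_def)
  have e: "(1, 0) \<bullet> v = fst v" for v :: "real \<times> complex" by (simp add: inner_prod_def)
  have cF: "convex ?F" using face by (rule face_of_imp_convex)
  have "?F \<inter> {x. (1, 0) \<bullet> x = fst (Psi c zm)} face_of ?F"
    by (intro face_of_Int_supporting_hyperplane_ge cF) (auto simp: e fst_Psi op_interval_def intro!: divide_right_mono op_le_trace_mono)
  moreover have "?F \<inter> {x. (1, 0) \<bullet> x = fst (Psi c zm)} = {Psi c zm}"
  proof (intro equalityI subsetI)
    fix x assume "x \<in> ?F \<inter> {x. (1, 0) \<bullet> x = fst (Psi c zm)}"
    then obtain a where a: "op_le zm a" "x = Psi c a" "fst (Psi c a) = fst (Psi c zm)"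
      by (auto simp: e op_interval_def)
    then have "zm = a" by (intro op_le_trace_eq) (simp_all add: fst_Psi)
    with a(2) show "x \<in> {Psi c zm}" by simp
  qed (use mem in \<open>simp add: e\<close>)
  ultimately have "Psi c zm extreme_point_of spectral_scale c"
    using face_of_trans[OF _ face] by (metis face_of_singleton)
  then show "isolated_extreme_point (spectral_scale c) (Psi c zm)"
    using cone[OF mem(1)] isolated_extreme_point_of_cone by blast
  have "?F \<inter> {x. (1, 0) \<bullet> x = fst (Psi c zp)} face_of ?F"
    by (intro face_of_Int_supporting_hyperplane_le cF) (auto simp: e fst_Psi op_interval_def intro!: divide_right_mono op_le_trace_mono)
  moreover have "?F \<inter> {x. (1, 0) \<bullet> x = fst (Psi c zp)} = {Psi c zp}"
  proof (intro equalityI subsetI)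
    fix x assume "x \<in> ?F \<inter> {x. (1, 0) \<bullet> x = fst (Psi c zp)}"
    then obtain a where a: "op_le a zp" "x = Psi c a" "fst (Psi c a) = fst (Psi c zp)"
      by (auto simp: e op_interval_def)
    then have "a = zp" by (intro op_le_trace_eq) (simp_all add: fst_Psi)
    with a(2) show "x \<in> {Psi c zp}" by simp
  qed (use mem in \<open>simp add: e\<close>)
  ultimately have "Psi c zp extreme_point_of spectral_scale c"
    using face_of_trans[OF _ face] by (metis face_of_singleton)
  then show "isolated_extreme_point (spectral_scale c) (Psi c zp)"
    using cone[OF mem(2)] isolated_extreme_point_of_cone by blast
qed

text \<open>The plane that extends the line of the edge contains a two-dimensional piece of the spectral scale: the edge
  itself, and points on both sides of the slice.\<close>

lemma supporting_face_over_edge: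
  fixes c :: "complex ^ 'n ^ 'n"
  assumes k: "0 < k" "k < CARD('n)" and a: "a \<noteq> 0"
    and sup: "\<And>z. z \<in> k_numerical_range k c \<Longrightarrow> a \<bullet> (z - l) \<le> 0"
    and l: "l \<in> k_numerical_range k c" and w: "w \<in> k_numerical_range k c" "w \<noteq> l" "a \<bullet> (w - l) = 0"
  obtains \<beta> P G where "P = {x. (\<beta>, a) \<bullet> x = (\<beta>, a) \<bullet> slice_map CARD('n) k l}" "G = spectral_scale c \<inter> P"
    "\<forall>x\<in>spectral_scale c. (\<beta>, a) \<bullet> x \<le> (\<beta>, a) \<bullet> slice_map CARD('n) k l"
    "supporting_hyperplane (spectral_scale c) P" "G face_of spectral_scale c" "aff_dim G = 2"
    "slice_map CARD('n) k w \<in> G" "slice_map CARD('n) k ` {z. a \<bullet> (z - l) = 0} \<inter> rel_interior G \<noteq> {}"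
proof -
  let ?B = "spectral_scale c" and ?p = "slice_map CARD('n) k"
  obtain \<beta> where \<beta>: "\<And>x. x \<in> ?B \<Longrightarrow> (\<beta>, a) \<bullet> x \<le> (\<beta>, a) \<bullet> ?p l"
    by (rule extend_line_of_support[OF k sup]) (assumption, rule that)
  define b where "b = (\<beta>, a) \<bullet> ?p l"
  let ?P = "{x. (\<beta>, a) \<bullet> x = b}"
  have nz: "(\<beta>, a) \<noteq> 0" using a by (simp add: zero_prod_def)
  have pB: "?p l \<in> ?B" "?p w \<in> ?B" using l w by (simp_all add: slice_map_in_spectral_scale[OF k(1)])
  have pw: "(\<beta>, a) \<bullet> ?p w = b" using w(3) by (simp add: b_def inner_slice_map inner_diff_right)
  have ne: "?p l \<noteq> ?p w" using w(2) slice_map_inject[OF k(1), of "CARD('n)" l w] by simp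
  have t: "fst (?p z) = real k / real CARD('n)" for z by (simp add: slice_map_def)
  have conv: "convex (?B \<inter> ?P)" by (intro convex_Int convex_spectral_scale convex_hyperplane)
  obtain u v where uv: "u \<in> ?B" "(\<beta>, a) \<bullet> u = b" "fst u < fst (?p l)" "v \<in> ?B" "(\<beta>, a) \<bullet> v = b" "fst (?p l) < fst v"
    by (rule exposed_face_both_sides[OF \<beta>[folded b_def] pB(1) b_def[symmetric] pB(2) pw ne]) (simp_all add: t)
  have d2: "aff_dim (?B \<inter> ?P) = 2"
  proof (rule antisym)
    have "aff_dim (?B \<inter> ?P) \<le> aff_dim ?P" by (intro aff_dim_subset) auto
    also have "\<dots> = 2" using nz by (simp add: aff_dim_hyperplane)
    finally show "aff_dim (?B \<inter> ?P) \<le> 2" .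
    show "2 \<le> aff_dim (?B \<inter> ?P)"
      by (rule aff_dim_transversal_slice[of "?p l" _ "?p w" u]) (use uv pB pw ne in \<open>simp_all add: t b_def\<close>)
  qed
  obtain y where y: "y \<in> rel_interior (?B \<inter> ?P)" "fst y = fst (?p l)"
    using rel_interior_meets_slice[OF conv, of u v "fst (?p l)"] uv by blast
  then have yB: "y \<in> ?B" "(\<beta>, a) \<bullet> y = b" using rel_interior_subset by blast+
  obtain z where z: "z \<in> k_numerical_range k c" "y = ?p z"
    by (rule slice_map_surj[OF k(1) yB(1)]) (use y(2) in \<open>simp_all add: t\<close>)
  have "a \<bullet> (z - l) = 0"
    by (rule slice_map_line[OF k(1), of "CARD('n)" \<beta>]) (use yB(2) in \<open>simp_all add: z b_def\<close>)
  then have meet: "?p ` {z. a \<bullet> (z - l) = 0} \<inter> rel_interior (?B \<inter> ?P) \<noteq> {}" using y(1) z(2) by blast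
  show thesis
  proof (rule that[of ?P \<beta> "?B \<inter> ?P"], unfold b_def[symmetric])
    show "?p w \<in> ?B \<inter> ?P" using pB pw by simp
    show "\<forall>x\<in>?B. (\<beta>, a) \<bullet> x \<le> b" using \<beta> by (simp add: b_def)
    show "?B \<inter> ?P face_of ?B"
      by (intro face_of_Int_supporting_hyperplane_le convex_spectral_scale) (use \<beta> in \<open>simp add: b_def\<close>)
    show "supporting_hyperplane ?B ?P"
      unfolding supporting_hyperplane_def
      by (intro exI[of _ "(\<beta>, a)"] exI[of _ b] conjI nz refl) (use \<beta> pB in \<open>auto simp: b_def\<close>)
  qed (fact d2 meet refl)+
qed

text \<open>The faces \<open>F1\<close> and \<open>F2\<close> lie over the two edges at \<open>\<mu>\<close>, and
  \<open>F\<close> is on the line \<open>P1 \<inter> P2\<close>, which meets each slice in at most one point.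
  In the slice of \<open>\<mu>\<close>, which may belong to an endpoint of \<open>F\<close>, the sections of
  \<open>F1\<close> and \<open>F2\<close> contain the edges; in the slices of the other relative interior
  points of \<open>F\<close> they contain a second point by \<open>slice_off_line_point\<close>.\<close>

lemma isolated_imp_faces:
  fixes c :: "complex ^ 'n ^ 'n"
  assumes k: "0 < k" "k < CARD('n)" and dim: "aff_dim (k_numerical_range k c) = 2"
    and iso: "isolated_extreme_point (k_numerical_range k c) \<mu>"
  shows "\<exists>F. F face_of spectral_scale c \<and> F \<noteq> {} \<and> slice_map CARD('n) k \<mu> \<in> F \<and>
              sharp_face (spectral_scale c) F \<and> aff_dim F \<le> 1 \<and>
              (\<exists>zm zp. central_projection c zm \<and> central_projection c zp \<and> op_le zm zp \<and>
                 F = Psi c ` op_interval zm zp \<and>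
                 isolated_extreme_point (spectral_scale c) (Psi c zm) \<and>
                 isolated_extreme_point (spectral_scale c) (Psi c zp)) \<and>
              (\<exists>F1 F2. F1 face_of spectral_scale c \<and> F2 face_of spectral_scale c \<and>
                 aff_dim F1 = 2 \<and> aff_dim F2 = 2 \<and> F1 \<inter> F2 = F \<and>
                 (\<forall>t \<gamma>. (t, \<gamma>) \<in> F \<longrightarrow> (\<forall>G\<in>{F1, F2}. \<exists>p q.
                    G \<inter> isotrace_slice c t = closed_segment p q \<and>
                    ((t, \<gamma>) \<in> rel_interior F \<or> (t, \<gamma>) = slice_map CARD('n) k \<mu> \<longrightarrow> p \<noteq> q))) \<and>
                 (\<forall>L1 L2. sectorial_tangent_lines (k_numerical_range k c) \<mu> L1 L2 \<longrightarrow>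
                    slice_map CARD('n) k ` L1 \<inter> rel_interior F1 \<noteq> {} \<and>
                    slice_map CARD('n) k ` L2 \<inter> rel_interior F2 \<noteq> {} \<or>
                    slice_map CARD('n) k ` L1 \<inter> rel_interior F2 \<noteq> {} \<and>
                    slice_map CARD('n) k ` L2 \<inter> rel_interior F1 \<noteq> {}))"
proof -
  let ?W = "k_numerical_range k c" and ?B = "spectral_scale c" and ?p = "slice_map CARD('n) k"
  have cW: "convex ?W" and kW: "compact ?W"
    using convex_k_numerical_range[OF k(1)] compact_k_numerical_range[OF k(1)] by auto
  obtain a1 a2 w1 w2 where indep: "Im (a2 * cnj a1) \<noteq> 0"
    and s1: "\<And>z. z \<in> ?W \<Longrightarrow> a1 \<bullet> (z - \<mu>) \<le> 0" and s2: "\<And>z. z \<in> ?W \<Longrightarrow> a2 \<bullet> (z - \<mu>) \<le> 0"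
    and w1: "w1 \<in> ?W" "w1 \<noteq> \<mu>" "a1 \<bullet> (w1 - \<mu>) = 0" and w2: "w2 \<in> ?W" "w2 \<noteq> \<mu>" "a2 \<bullet> (w2 - \<mu>) = 0"
    by (rule isolated_extreme_point_edges[OF kW cW dim iso]) (rule that; assumption)
  have nz: "a1 \<noteq> 0" "a2 \<noteq> 0" using indep by auto
  have muW: "\<mu> \<in> ?W" using iso by (auto simp: isolated_extreme_point_def isolated_in_def extreme_point_of_def)
  obtain \<beta>1 P1 F1 where P1_def: "P1 = {x. (\<beta>1, a1) \<bullet> x = (\<beta>1, a1) \<bullet> ?p \<mu>}" and F1_def: "F1 = ?B \<inter> P1"
    and b1: "\<forall>x\<in>?B. (\<beta>1, a1) \<bullet> x \<le> (\<beta>1, a1) \<bullet> ?p \<mu>"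
    and f1: "supporting_hyperplane ?B P1" "F1 face_of ?B" "aff_dim F1 = 2"
      "?p w1 \<in> F1" "?p ` {z. a1 \<bullet> (z - \<mu>) = 0} \<inter> rel_interior F1 \<noteq> {}"
    by (rule supporting_face_over_edge[OF k nz(1) s1 muW w1]) (assumption, (rule that; assumption))
  obtain \<beta>2 P2 F2 where P2_def: "P2 = {x. (\<beta>2, a2) \<bullet> x = (\<beta>2, a2) \<bullet> ?p \<mu>}" and F2_def: "F2 = ?B \<inter> P2"
    and b2: "\<forall>x\<in>?B. (\<beta>2, a2) \<bullet> x \<le> (\<beta>2, a2) \<bullet> ?p \<mu>"
    and f2: "supporting_hyperplane ?B P2" "F2 face_of ?B" "aff_dim F2 = 2"
      "?p w2 \<in> F2" "?p ` {z. a2 \<bullet> (z - \<mu>) = 0} \<inter> rel_interior F2 \<noteq> {}"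
    by (rule supporting_face_over_edge[OF k nz(2) s2 muW w2]) (assumption, (rule that; assumption))
  define F where "F = F1 \<inter> F2"
  have muB: "?p \<mu> \<in> ?B" using muW by (simp add: slice_map_in_spectral_scale[OF k(1)])
  have muF: "?p \<mu> \<in> F" using muB by (simp add: F_def F1_def F2_def P1_def P2_def)
  have w1n: "?p w1 \<notin> P2"
  proof
    assume "?p w1 \<in> P2"
    then have "a2 \<bullet> (w1 - \<mu>) = 0" using slice_map_line[OF k(1), of "CARD('n)" \<beta>2 a2 w1 \<mu>] by (simp add: P2_def)
    from inner_eq_zero_both[OF indep w1(3) this] w1(2) show False by simp
  qed
  have w2n: "?p w2 \<notin> P1"
  proof
    assume "?p w2 \<in> P1"
    then have "a1 \<bullet> (w2 - \<mu>) = 0" using slice_map_line[OF k(1), of "CARD('n)" \<beta>1 a1 w2 \<mu>] by (simp add: P1_def)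
    from inner_eq_zero_both[OF indep this w2(3)] w2(2) show False by simp
  qed
  have Fface: "F face_of ?B" unfolding F_def using f1(2) f2(2) by (rule face_of_Int)
  have P12: "P1 \<noteq> P2" using w1n f1(4) by (auto simp: F1_def)
  have sharp: "sharp_face ?B F"
    unfolding sharp_face_def
    by (intro conjI Fface exI[of _ P1] exI[of _ P2] P12 f1(1) f2(1)) (use muF in \<open>auto simp: F_def F1_def F2_def\<close>)
  have Fline: "F \<subseteq> P1 \<inter> P2" by (auto simp: F_def F1_def F2_def)
  have aff12: "affine (P1 \<inter> P2)" unfolding P1_def P2_def by (intro affine_Int affine_hyperplane)
  have "aff_dim (P1 \<inter> P2) \<le> 1"
  proof -
    have "\<not> P1 \<subseteq> P2" using w1n f1(4) by (auto simp: F1_def)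
    moreover have "aff_dim P1 = 2" using nz unfolding P1_def by (subst aff_dim_hyperplane) (simp_all add: zero_prod_def)
    moreover have "affine P1" unfolding P1_def by (rule affine_hyperplane)
    ultimately show ?thesis
      using aff_dim_affine_Int_hyperplane[of P1 "(\<beta>2, a2)" "(\<beta>2, a2) \<bullet> ?p \<mu>"] unfolding P2_def[symmetric]
      by (simp split: if_splits)
  qed
  then have dF: "aff_dim F \<le> 1" using aff_dim_subset[OF Fline] by linarith
  have indep': "Im (snd (\<beta>2, a2) * cnj (snd (\<beta>1, a1))) \<noteq> 0" using indep by simp
  obtain zm zp where z: "central_projection c zm" "central_projection c zp" "op_le zm zp"
    and Fz: "Psi c ` op_interval zm zp = {x \<in> ?B. (\<beta>1, a1) \<bullet> x = (\<beta>1, a1) \<bullet> ?p \<mu> \<and> (\<beta>2, a2) \<bullet> x = (\<beta>2, a2) \<bullet> ?p \<mu>}"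
    and cone: "\<And>y. y \<in> Psi c ` op_interval zm zp \<Longrightarrow>
       \<exists>\<epsilon>>0. \<forall>x\<in>?B. dist x y < \<epsilon> \<longrightarrow> 2 *\<^sub>R x - y \<in> ?B"
    by (rule spectral_scale_corner_face[OF indep' b1[rule_format] b2[rule_format] muB refl refl]) (assumption, assumption, (rule that; blast))
  have FPsi: "F = Psi c ` op_interval zm zp" unfolding Fz by (auto simp: F_def F1_def F2_def P1_def P2_def)
  have isoz: "isolated_extreme_point ?B (Psi c zm)" "isolated_extreme_point ?B (Psi c zp)"
    using central_endpoints_isolated[OF Fface[unfolded FPsi] z(3) cone] by blast+
  have slice1: "y = x" if "x \<in> P1 \<inter> P2" "y \<in> P1 \<inter> P2" "fst y = fst x" for x y
  proof -
    have "a1 \<bullet> (snd y - snd x) = 0" "a2 \<bullet> (snd y - snd x) = 0"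
      using that by (auto simp: P1_def P2_def inner_prod_def inner_diff_right)
    then have "snd y - snd x = 0" by (rule inner_eq_zero_both[OF indep])
    then show ?thesis using that(3) by (simp add: prod_eq_iff)
  qed
  have segment: "\<exists>p q. G \<inter> isotrace_slice c t = closed_segment p q \<and> ((t, \<gamma>) \<in> rel_interior F \<or> (t, \<gamma>) = ?p \<mu> \<longrightarrow> p \<noteq> q)"
    if tF: "(t, \<gamma>) \<in> F" and G: "G = ?B \<inter> {x. (\<beta>, a) \<bullet> x = b}" "a \<noteq> 0" "F \<subseteq> G" "?p w \<in> G" "?p w \<notin> P1 \<inter> P2"
    for t \<gamma> G \<beta> a b w
  proof -
    let ?S = "G \<inter> isotrace_slice c t"
    have Sx: "?S = G \<inter> {x. (1, 0) \<bullet> x = t}" using G(1) by (auto simp: isotrace_slice_def inner_prod_def)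
    have cG: "convex G" unfolding G(1) by (intro convex_Int convex_spectral_scale convex_hyperplane)
    have "compact G" unfolding G(1) by (intro compact_Int_closed compact_spectral_scale closed_hyperplane)
    then have "compact ?S" "convex ?S"
      unfolding Sx using cG by (auto intro!: compact_Int_closed closed_hyperplane convex_Int convex_hyperplane)
    moreover have memS: "(t, \<gamma>) \<in> ?S" using tF G(3) unfolding Sx by (auto simp: inner_prod_def)
    moreover have "collinear ?S"
      by (rule collinear_subset[OF collinear_plane_slice[OF G(2), of \<beta> b t]]) (auto simp: G(1) isotrace_slice_def)
    ultimately obtain p q where pq: "?S = closed_segment p q"
      using compact_convex_collinear_segment[of ?S] by blast
    have "p \<noteq> q" if nd: "(t, \<gamma>) \<in> rel_interior F \<or> (t, \<gamma>) = ?p \<mu>"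
    proof -
      have "\<exists>y\<in>G. fst y = t \<and> y \<noteq> (t, \<gamma>)"
      proof (cases "(t, \<gamma>) = ?p \<mu>")
        case True
        then have "t = real k / real CARD('n)" by (simp add: slice_map_def)
        moreover have "?p w \<noteq> ?p \<mu>" using G(5) muF Fline by auto
        ultimately show ?thesis using G(4) True by (intro bexI[of _ "?p w"]) (auto simp: slice_map_def)
      next
        case False
        then have ri: "(t, \<gamma>) \<in> rel_interior F" using nd by blast
        have ft: "fst (?p \<mu>) \<noteq> t"
          using slice1[of "(t, \<gamma>)" "?p \<mu>"] False muF tF Fline by auto
        have "\<forall>x\<in>F. \<exists>e>1. (1 - e) *\<^sub>R x + e *\<^sub>R (t, \<gamma>) \<in> F"
          using ri convex_rel_interior_iff[of F "(t, \<gamma>)"] face_of_imp_convex[OF Fface] tF by blast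
        then obtain e where e: "e > 1" "(1 - e) *\<^sub>R ?p \<mu> + e *\<^sub>R (t, \<gamma>) \<in> F" using muF by blast
        \<comment> \<open>prolong the segment from \<open>?p \<mu>\<close> beyond \<open>(t, \<gamma>)\<close> to have points of the line on both sides\<close>
        define f where "f = (1 - e) *\<^sub>R ?p \<mu> + e *\<^sub>R (t, \<gamma>)"
        have fF: "f \<in> F" using e by (simp add: f_def)
        have "fst f - t = (1 - e) * (fst (?p \<mu>) - t)" by (simp add: f_def algebra_simps)
        then have side: "fst (?p \<mu>) < t \<and> t < fst f \<or> fst f < t \<and> t < fst (?p \<mu>)"
          using e(1) ft by (metis diff_gt_0_iff_gt diff_less_0_iff_less less_linear mult_neg_neg mult_neg_pos)
        have A: "(t, \<gamma>) \<in> P1 \<inter> P2" "?p \<mu> \<in> P1 \<inter> P2" "f \<in> P1 \<inter> P2" using Fline tF muF fF by auto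
        have inG: "(t, \<gamma>) \<in> G" "?p \<mu> \<in> G" "f \<in> G" using G(3) tF muF fF by auto
        from side show ?thesis
        proof
          assume "fst (?p \<mu>) < t \<and> t < fst f"
          then show ?thesis
            using slice_off_line_point[OF cG inG(1,2,3) G(4) _ _ aff12 A G(5)] by simp
        next
          assume "fst f < t \<and> t < fst (?p \<mu>)"
          then show ?thesis
            using slice_off_line_point[OF cG inG(1,3,2) G(4) _ _ aff12 A(1,3,2) G(5)] by simp
        qed
      qed
      then obtain y where y: "y \<in> G" "fst y = t" "y \<noteq> (t, \<gamma>)" by blast
      then have "y \<in> closed_segment p q" unfolding pq[symmetric] Sx by (simp add: inner_prod_def)
      moreover have "(t, \<gamma>) \<in> closed_segment p q" using memS unfolding pq .
      ultimately show ?thesis using y(3) by auto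
    qed
    with pq show ?thesis by blast
  qed
  have seg: "\<forall>t \<gamma>. (t, \<gamma>) \<in> F \<longrightarrow> (\<forall>G\<in>{F1, F2}. \<exists>p q.
                    G \<inter> isotrace_slice c t = closed_segment p q \<and>
                    ((t, \<gamma>) \<in> rel_interior F \<or> (t, \<gamma>) = ?p \<mu> \<longrightarrow> p \<noteq> q))"
  proof (intro allI impI ballI)
    fix t \<gamma> G assume t: "(t, \<gamma>) \<in> F" and "G \<in> {F1, F2}"
    then consider "G = F1" | "G = F2" by blast
    then show "\<exists>p q. G \<inter> isotrace_slice c t = closed_segment p q \<and>
                    ((t, \<gamma>) \<in> rel_interior F \<or> (t, \<gamma>) = ?p \<mu> \<longrightarrow> p \<noteq> q)"
    proof cases
      case 1
      show ?thesis
        by (rule segment[OF t, of G \<beta>1 a1 "(\<beta>1, a1) \<bullet> ?p \<mu>" w1])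
           (use 1 nz f1(4) w1n in \<open>auto simp: F_def F1_def P1_def\<close>)
    next
      case 2
      show ?thesis
        by (rule segment[OF t, of G \<beta>2 a2 "(\<beta>2, a2) \<bullet> ?p \<mu>" w2])
           (use 2 nz f2(4) w2n in \<open>auto simp: F_def F2_def P2_def\<close>)
    qed
  qed
  have sect: "?p ` L1 \<inter> rel_interior F1 \<noteq> {} \<and> ?p ` L2 \<inter> rel_interior F2 \<noteq> {} \<or>
      ?p ` L1 \<inter> rel_interior F2 \<noteq> {} \<and> ?p ` L2 \<inter> rel_interior F1 \<noteq> {}"
    if "sectorial_tangent_lines ?W \<mu> L1 L2" for L1 L2
    using sectorial_tangent_lines_unique[OF that muW indep s1 s2 w1 w2] f1(5) f2(5) by auto
  show ?thesis
  proof (rule exI[of _ F], intro conjI, goal_cases)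
    case 2
    show ?case using muF by blast
  next
    case 6
    show ?case by (rule exI[of _ zm], rule exI[of _ zp], intro conjI z FPsi isoz)
  next
    case 7
    show ?case
      by (rule exI[of _ F1], rule exI[of _ F2])
         (intro conjI f1(2,3) f2(2,3) F_def[symmetric] seg allI impI sect)
  qed (fact Fface muF sharp dF)+
qed

section \<open>From a pair of faces back to a corner\<close>

text \<open>A line of support at the midpoint of the edge contains both ends.\<close>

lemma edge_supporting_line:
  fixes W :: "complex set"
  assumes W: "convex W" "aff_dim W = 2" and face: "closed_segment u v face_of W" and uv: "u \<noteq> v"
    and l: "l \<in> closed_segment u v"
  obtains a where "a \<noteq> 0" "\<And>z. z \<in> W \<Longrightarrow> a \<bullet> (z - l) \<le> 0" "\<And>z. z \<in> closed_segment u v \<Longrightarrow> a \<bullet> (z - l) = 0"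
proof -
  have sub: "closed_segment u v \<subseteq> W" using face by (rule face_of_imp_subset)
  have "aff_dim (closed_segment u v) = 1"
    using uv by (metis aff_dim_2 aff_dim_convex_hull segment_convex_hull)
  then have "closed_segment u v \<noteq> W" using W(2) by auto
  then have disj: "closed_segment u v \<inter> rel_interior W = {}" by (rule face_of_disjoint_rel_interior[OF face])
  define m where "m = midpoint u v"
  have m: "m \<in> closed_segment u v" by (simp add: m_def)
  obtain a where a: "a \<noteq> 0" "\<And>y. y \<in> W \<Longrightarrow> a \<bullet> m \<le> a \<bullet> y"
    by (rule supporting_hyperplane_rel_boundary[OF W(1), of m]) (use m sub disj in auto)
  have "a \<bullet> m = (a \<bullet> u + a \<bullet> v) / 2" by (simp add: m_def midpoint_def inner_add_right)
  moreover have "a \<bullet> m \<le> a \<bullet> u" "a \<bullet> m \<le> a \<bullet> v" using a(2) sub by auto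
  ultimately have uv': "a \<bullet> u = a \<bullet> m" "a \<bullet> v = a \<bullet> m" by simp_all
  have const: "a \<bullet> z = a \<bullet> m" if "z \<in> closed_segment u v" for z
  proof -
    from that obtain s where s: "z = (1 - s) *\<^sub>R u + s *\<^sub>R v" by (auto simp: in_segment)
    show ?thesis by (simp add: s inner_add_right uv' left_diff_distrib)
  qed
  show thesis
    by (rule that[of "- a"]) (use a const l in \<open>auto simp: inner_diff_right\<close>)
qed

lemma face_pullback:
  fixes c :: "complex ^ 'n ^ 'n"
  assumes k: "0 < k" and G: "G face_of spectral_scale c"
  shows "{z. slice_map CARD('n) k z \<in> G} face_of k_numerical_range k c"
proof -
  let ?p = "slice_map CARD('n) k"
  have n: "0 < CARD('n)" by simp
  have aff: "?p ((1 - u) *\<^sub>R x + u *\<^sub>R y) = (1 - u) *\<^sub>R ?p x + u *\<^sub>R ?p y" for u x y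
    by (rule slice_map_affine) simp
  have GB: "G \<subseteq> spectral_scale c" and cG: "convex G" using G face_of_imp_subset face_of_imp_convex by auto
  show ?thesis
    unfolding face_of_def
  proof (intro conjI ballI impI subsetI)
    fix z assume "z \<in> {z. ?p z \<in> G}"
    then show "z \<in> k_numerical_range k c" using GB slice_map_in_spectral_scale[OF k] by blast
  next
    show "convex {z. ?p z \<in> G}"
      unfolding convex_alt using cG by (auto simp: aff intro!: convexD_alt[OF cG])
  next
    fix x y z assume xy: "x \<in> k_numerical_range k c" "y \<in> k_numerical_range k c"
      and z: "z \<in> {z. ?p z \<in> G}" "z \<in> open_segment x y"
    then obtain u where u: "x \<noteq> y" "0 < u" "u < 1" "z = (1 - u) *\<^sub>R x + u *\<^sub>R y" by (auto simp: in_segment)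
    have "?p x \<noteq> ?p y" using slice_map_inject[OF k n] u(1) by simp
    then have "?p z \<in> open_segment (?p x) (?p y)"
      unfolding in_segment u(4) aff using u by blast
    then have "?p x \<in> G \<and> ?p y \<in> G"
      using face_ofD[OF G] xy z slice_map_in_spectral_scale[OF k] by blast
    then show "x \<in> {z. ?p z \<in> G}" "y \<in> {z. ?p z \<in> G}" by auto
  qed
qed

text \<open>Both faces cut the slice in an edge through \<open>\<mu>\<close>. If the edges are on one line, each is the
  whole intersection of the numerical range with that line, so they agree and lie in \<open>F\<close>. As
  \<open>F\<close> has dimension at most one, all of \<open>F\<close> is then in the slice, \<open>zm\<close>
  and \<open>zp\<close> have the same trace and coincide, and \<open>F\<close> is a point.\<close>

lemma faces_imp_corner:
  fixes c :: "complex ^ 'n ^ 'n"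
  assumes k: "0 < k" "k < CARD('n)" and dim: "aff_dim (k_numerical_range k c) = 2"
    and muF: "slice_map CARD('n) k \<mu> \<in> F" and dF: "aff_dim F \<le> 1"
    and Fz: "F = Psi c ` op_interval zm zp" and le: "op_le zm zp"
    and F12: "F1 face_of spectral_scale c" "F2 face_of spectral_scale c" "F1 \<inter> F2 = F"
    and seg: "\<And>G. G \<in> {F1, F2} \<Longrightarrow> \<exists>p q. G \<inter> isotrace_slice c (real k / real CARD('n)) = closed_segment p q \<and> p \<noteq> q"
  shows "has_corner_at (k_numerical_range k c) \<mu>"
proof -
  let ?W = "k_numerical_range k c" and ?B = "spectral_scale c" and ?p = "slice_map CARD('n) k"
  let ?t = "real k / real CARD('n)"
  have n: "0 < CARD('n)" by simp
  have cW: "convex ?W" and kW: "compact ?W"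
    using convex_k_numerical_range[OF k(1)] compact_k_numerical_range[OF k(1)] by auto
  have aff: "?p ((1 - u) *\<^sub>R x + u *\<^sub>R y) = (1 - u) *\<^sub>R ?p x + u *\<^sub>R ?p y" for u x y
    by (rule slice_map_affine) simp
  have pB: "?p z \<in> ?B \<longleftrightarrow> z \<in> ?W" for z using slice_map_in_spectral_scale[OF k(1)] .
  have pt: "fst (?p z) = ?t" for z by (simp add: slice_map_def)
  have edge: "\<exists>u v. u \<noteq> v \<and> {z. ?p z \<in> G} = closed_segment u v"
    if G: "G \<in> {F1, F2}" "G face_of ?B" for G
  proof -
    obtain p q where pq: "G \<inter> isotrace_slice c ?t = closed_segment p q" "p \<noteq> q" using seg[OF G(1)] by blast
    have sub: "G \<subseteq> ?B" using G(2) by (rule face_of_imp_subset)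
    have "p \<in> G \<inter> isotrace_slice c ?t" "q \<in> G \<inter> isotrace_slice c ?t" unfolding pq by simp_all
    then have p: "p \<in> ?B" "fst p = ?t" and q: "q \<in> ?B" "fst q = ?t" by (auto simp: isotrace_slice_def)
    obtain u where u: "u \<in> ?W" "p = ?p u" by (rule slice_map_surj[OF k(1) p])
    obtain v where v: "v \<in> ?W" "q = ?p v" by (rule slice_map_surj[OF k(1) q])
    have "{z. ?p z \<in> G} = closed_segment u v"
    proof (intro equalityI subsetI)
      fix z assume "z \<in> {z. ?p z \<in> G}"
      then have "?p z \<in> closed_segment p q" using sub pt unfolding pq(1)[symmetric] isotrace_slice_def by blast
      then obtain s where s: "0 \<le> s" "s \<le> 1" "?p z = ?p ((1 - s) *\<^sub>R u + s *\<^sub>R v)" unfolding in_segment u v aff by blast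
      then show "z \<in> closed_segment u v" unfolding slice_map_inject[OF k(1) n] in_segment by blast
    next
      fix z assume "z \<in> closed_segment u v"
      then have "?p z \<in> closed_segment p q" unfolding in_segment u v using aff by blast
      then show "z \<in> {z. ?p z \<in> G}" unfolding pq(1)[symmetric] by blast
    qed
    moreover have "u \<noteq> v" using pq(2) u v by auto
    ultimately show ?thesis by blast
  qed
  have mu12: "?p \<mu> \<in> F1" "?p \<mu> \<in> F2" using muF F12(3) by auto
  obtain u1 v1 where e1: "u1 \<noteq> v1" "{z. ?p z \<in> F1} = closed_segment u1 v1" using edge[of F1] F12 by auto
  obtain u2 v2 where e2: "u2 \<noteq> v2" "{z. ?p z \<in> F2} = closed_segment u2 v2" using edge[of F2] F12 by auto
  have face1: "closed_segment u1 v1 face_of ?W" using face_pullback[OF k(1) F12(1)] unfolding e1(2) .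
  have face2: "closed_segment u2 v2 face_of ?W" using face_pullback[OF k(1) F12(2)] unfolding e2(2) .
  have mu1: "\<mu> \<in> closed_segment u1 v1" unfolding e1(2)[symmetric] using mu12 by simp
  have mu2: "\<mu> \<in> closed_segment u2 v2" unfolding e2(2)[symmetric] using mu12 by simp
  obtain a1 where a1: "a1 \<noteq> 0" "\<And>z. z \<in> ?W \<Longrightarrow> a1 \<bullet> (z - \<mu>) \<le> 0" "\<And>z. z \<in> closed_segment u1 v1 \<Longrightarrow> a1 \<bullet> (z - \<mu>) = 0"
    by (rule edge_supporting_line[OF cW dim face1 e1(1) mu1]) (rule that; assumption)
  obtain a2 where a2: "a2 \<noteq> 0" "\<And>z. z \<in> ?W \<Longrightarrow> a2 \<bullet> (z - \<mu>) \<le> 0" "\<And>z. z \<in> closed_segment u2 v2 \<Longrightarrow> a2 \<bullet> (z - \<mu>) = 0"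
    by (rule edge_supporting_line[OF cW dim face2 e2(1) mu2]) (rule that; assumption)
  have "Im (a2 * cnj a1) \<noteq> 0"
  proof
    assume "Im (a2 * cnj a1) = 0"
    then obtain r where r: "a2 = of_real r * a1" by (rule parallel_normals[OF _ a1(1)])
    then have r0: "r \<noteq> 0" using a2(1) by auto
    have "a2 \<bullet> x = r * (a1 \<bullet> x)" for x by (simp add: r inner_complex_def algebra_simps)
    then have on2: "a1 \<bullet> (z - \<mu>) = 0" if "z \<in> closed_segment u2 v2" for z using a2(3)[OF that] r0 by simp
    define E where "E = ?W \<inter> {z. a1 \<bullet> z = a1 \<bullet> \<mu>}"
    have cE: "convex E" unfolding E_def by (intro convex_Int cW convex_hyperplane)
    have "aff_dim E \<le> aff_dim {z. a1 \<bullet> z = a1 \<bullet> \<mu>}" unfolding E_def by (intro aff_dim_subset) auto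
    then have dE: "aff_dim E \<le> 1" using a1(1) by (simp add: aff_dim_hyperplane)
    have eq: "closed_segment u v = E"
      if face: "closed_segment u v face_of ?W" and uv: "u \<noteq> v" and on: "\<And>z. z \<in> closed_segment u v \<Longrightarrow> a1 \<bullet> (z - \<mu>) = 0" for u v
    proof (rule ccontr)
      assume ne: "closed_segment u v \<noteq> E"
      have "closed_segment u v \<subseteq> E"
        using face_of_imp_subset[OF face] on by (auto simp: E_def inner_diff_right)
      then have "closed_segment u v face_of E"
        by (rule face_of_subset[OF face]) (auto simp: E_def)
      from face_of_aff_dim_lt[OF cE this ne] dE have "aff_dim (closed_segment u v) < 1" by linarith
      moreover have "aff_dim (closed_segment u v) = 1"
        using uv by (metis aff_dim_2 aff_dim_convex_hull segment_convex_hull)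
      ultimately show False by simp
    qed
    have "closed_segment u1 v1 = closed_segment u2 v2"
      by (rule trans[OF eq[OF face1 e1(1) a1(3)] eq[OF face2 e2(1) on2, symmetric]])
    then have "{u1, v1} \<subseteq> {z. ?p z \<in> F1} \<inter> {z. ?p z \<in> F2}" unfolding e1(2) e2(2) by auto
    then have uvF: "?p u1 \<in> F" "?p v1 \<in> F" using F12(3) by auto
    have ne: "?p u1 \<noteq> ?p v1" using slice_map_inject[OF k(1) n] e1(1) by simp
    have flat: "fst x = ?t" if "x \<in> F" for x
    proof (rule ccontr)
      assume "fst x \<noteq> ?t"
      then have "2 \<le> aff_dim F" using aff_dim_transversal_slice[OF uvF ne _ that] by (simp add: pt)
      with dF show False by simp
    qed
      have tz: "Re (trace x) = real k" if "x \<in> op_interval zm zp" for x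
      using flat[of "Psi c x"] that by (simp add: Fz fst_Psi)
    have "Re (trace zm) = real k" by (rule tz) (simp add: op_interval_def le op_le_refl)
    then have zm: "x = zm" if "x \<in> op_interval zm zp" for x
      using op_le_trace_eq[of zm x] that tz[OF that] by (auto simp: op_interval_def)
    have "F \<subseteq> {Psi c zm}" unfolding Fz using zm by auto
    then have "?p u1 = Psi c zm" "?p v1 = Psi c zm" using uvF by blast+
    with ne show False by simp
  qed
  moreover have "\<mu> \<in> ?W" using face_of_imp_subset[OF face1] mu1 by blast
  ultimately show ?thesis
    unfolding has_corner_at_iff[OF compact_imp_closed[OF kW]] using a1(2) a2(2)
    by (intro conjI exI[of _ a1] exI[of _ a2] ballI)
qed

lemma isolated_imp_corner:
  fixes W :: "complex set"
  assumes W: "compact W" "convex W" "aff_dim W = 2" and iso: "isolated_extreme_point W l"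
  shows "has_corner_at W l"
proof -
  obtain a1 a2 w1 w2 where indep: "Im (a2 * cnj a1) \<noteq> 0"
    and s: "\<And>z. z \<in> W \<Longrightarrow> a1 \<bullet> (z - l) \<le> 0" "\<And>z. z \<in> W \<Longrightarrow> a2 \<bullet> (z - l) \<le> 0"
    by (rule isolated_extreme_point_edges[OF W iso]) (rule that; assumption)
  have "l \<in> W" using iso by (auto simp: isolated_extreme_point_def isolated_in_def extreme_point_of_def)
  then show ?thesis
    unfolding has_corner_at_iff[OF compact_imp_closed[OF W(1)]] using indep s
    by (intro conjI exI[of _ a1] exI[of _ a2] ballI)
qed

theorem theorem3p4:
  fixes c :: "complex ^ 'n ^ 'n" and k :: nat and \<mu> :: complex
  assumes "0 < k" and "k < CARD('n)"
    and "aff_dim (k_numerical_range k c) = 2"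
  shows "(has_corner_at (k_numerical_range k c) \<mu> \<longleftrightarrow>
            singular_boundary_point (k_numerical_range k c) \<mu>) \<and>
         (has_corner_at (k_numerical_range k c) \<mu> \<longleftrightarrow>
            (\<exists>F. F face_of spectral_scale c \<and> F \<noteq> {} \<and> slice_map CARD('n) k \<mu> \<in> F \<and>
              sharp_face (spectral_scale c) F \<and> aff_dim F \<le> 1 \<and>
              (\<exists>zm zp. central_projection c zm \<and> central_projection c zp \<and> op_le zm zp \<and>
                 F = Psi c ` op_interval zm zp \<and>
                 isolated_extreme_point (spectral_scale c) (Psi c zm) \<and>
                 isolated_extreme_point (spectral_scale c) (Psi c zp)) \<and>
              (\<exists>F1 F2. F1 face_of spectral_scale c \<and> F2 face_of spectral_scale c \<and>
                 aff_dim F1 = 2 \<and> aff_dim F2 = 2 \<and> F1 \<inter> F2 = F \<and>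
                 (\<forall>t \<gamma>. (t, \<gamma>) \<in> F \<longrightarrow> (\<forall>G\<in>{F1, F2}. \<exists>p q.
                    G \<inter> isotrace_slice c t = closed_segment p q \<and>
                    ((t, \<gamma>) \<in> rel_interior F \<or> (t, \<gamma>) = slice_map CARD('n) k \<mu> \<longrightarrow> p \<noteq> q))) \<and>
                 (\<forall>L1 L2. sectorial_tangent_lines (k_numerical_range k c) \<mu> L1 L2 \<longrightarrow>
                    slice_map CARD('n) k ` L1 \<inter> rel_interior F1 \<noteq> {} \<and>
                    slice_map CARD('n) k ` L2 \<inter> rel_interior F2 \<noteq> {} \<or>
                    slice_map CARD('n) k ` L1 \<inter> rel_interior F2 \<noteq> {} \<and>
                    slice_map CARD('n) k ` L2 \<inter> rel_interior F1 \<noteq> {})))) \<and>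
         (has_corner_at (k_numerical_range k c) \<mu> \<longleftrightarrow>
            isolated_extreme_point (k_numerical_range k c) \<mu>)"
proof -
  let ?W = "k_numerical_range k c"
  have W: "compact ?W" "convex ?W"
    using compact_k_numerical_range[OF assms(1)] convex_k_numerical_range[OF assms(1)] by auto
  have iso: "has_corner_at ?W \<mu> \<longleftrightarrow> isolated_extreme_point ?W \<mu>"
    using corner_imp_isolated[OF assms(1,2)] isolated_imp_corner[OF W assms(3)] by blast
  show ?thesis
  proof (intro conjI iffI, goal_cases)
    case 3
    then show ?case by (intro isolated_imp_faces assms) (simp only: iso)
  next
    case 4
    then obtain F zm zp F1 F2 where F: "slice_map CARD('n) k \<mu> \<in> F" "aff_dim F \<le> 1"
      "F = Psi c ` op_interval zm zp" "op_le zm zp"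
      "F1 face_of spectral_scale c" "F2 face_of spectral_scale c" "F1 \<inter> F2 = F"
      and seg: "\<forall>t \<gamma>. (t, \<gamma>) \<in> F \<longrightarrow> (\<forall>G\<in>{F1, F2}. \<exists>p q.
                    G \<inter> isotrace_slice c t = closed_segment p q \<and>
                    ((t, \<gamma>) \<in> rel_interior F \<or> (t, \<gamma>) = slice_map CARD('n) k \<mu> \<longrightarrow> p \<noteq> q))"
      by (elim exE conjE) (rule that; assumption)
    show ?case
    proof (rule faces_imp_corner[OF assms F])
      fix G assume "G \<in> {F1, F2}"
      with seg F(1) show "\<exists>p q. G \<inter> isotrace_slice c (real k / real CARD('n)) = closed_segment p q \<and> p \<noteq> q"
        unfolding slice_map_eq by blast
    qed
  qed (use singular_iff_corner[OF W assms(3), of \<mu>] iso in blast)+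
qed

end
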